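(* Let $A$ be a finite-dimensional algebra over a field $F$, let $\{S_i \mid 1 \le i \le \ell(A)\}$ be a complete set of pairwise non-isomorphic simple right $A$-modules, and suppose that $F$ is a splitting field for $A$. Then the following hold. (i) $\operatorname{codim} KR^1(A) = \ell(A)$. (ii) $\operatorname{codim} KR^2(A) = \ell(A) + \sum_{1 \le i \le \ell(A)} \dim \operatorname{Ext}^1_A(S_i, S_i)$. (iii) $\ell(A) + \sum_{1 \le i \le \ell(A)} \dim \operatorname{Ext}^1_A(S_i, S_i) \le k(A) \le \operatorname{tr} C_A$.
   Context: Algebras are associative and unital; dimensions are over $F$ and codimensions are those of $F$-subspaces of $A$. $K(A)$ denotes the commutator subspace of $A$, i.e. the $F$-subspace of $A$ spanned by all $xy - yx$ with $x, y \in A$, and $k(A) := \operatorname{codim} K(A) = \dim_F A/K(A)$. $\operatorname{Rad}^n(A)$ is the $n$th power of the Jacobson radical of $A$, and $KR^n(A) := K(A) + \operatorname{Rad}^n(A)$. $\ell(A)$ is the number of isomorphism classes of simple right $A$-modules. $C_A$ is the Cartan matrix of $A$: the $\ell(A) \times \ell(A)$ matrix whose entries are the multiplicities of the $S_j$ as composition factors of the projective covers $P_i$ of the $S_i$. $F$ is a splitting field for $A$ if $\operatorname{End}_A(S) = F$ for every simple right $A$-module $S$. *)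

theory Defs
  imports
    "HOL-Algebra.Ideal_Product"
    "Jordan_Normal_Form.Matrix"
    "Jordan_Normal_Form.Missing_VectorSpace"
begin

section \<open>Algebras and right modules\<close>

text \<open>
  The locale \<open>algebra\<close> of HOL-Algebra is restricted to commutative algebras. Here the record
  \<^typ>\<open>('f, 'a) module\<close> carries both the ring structure of \<open>A\<close> and the scalar action of \<open>F\<close>;
  \<open>A\<close> may be the zero algebra.
\<close>

locale assoc_algebra = vectorspace F A + A: ring A
  for F :: "('f, 'k) ring_scheme" and A :: "('f, 'a) module" +
  assumes smult_mult_left:
      "\<lbrakk>c \<in> carrier F; x \<in> carrier A; y \<in> carrier A\<rbrakk> \<Longrightarrow>
        (c \<odot>\<^bsub>A\<^esub> x) \<otimes>\<^bsub>A\<^esub> y = c \<odot>\<^bsub>A\<^esub> (x \<otimes>\<^bsub>A\<^esub> y)"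
    and smult_mult_right:
      "\<lbrakk>c \<in> carrier F; x \<in> carrier A; y \<in> carrier A\<rbrakk> \<Longrightarrow>
        x \<otimes>\<^bsub>A\<^esub> (c \<odot>\<^bsub>A\<^esub> y) = c \<odot>\<^bsub>A\<^esub> (x \<otimes>\<^bsub>A\<^esub> y)"

text \<open>
  For a right module \<open>M\<close>, the term \<open>a \<odot>\<^bsub>M\<^esub> x\<close> denotes \<open>x \<cdot> a\<close>. The library's
  \<^const>\<open>Module.submodule\<close> and \<^const>\<open>module_hom\<close> do not mention the multiplication of the ring,
  so they apply to right modules over noncommutative rings unchanged. An \<open>F\<close>-scalar \<open>c\<close> acts on
  an \<open>A\<close>-module through \<open>c \<odot>\<^bsub>A\<^esub> \<one>\<^bsub>A\<^esub>\<close>. The multiplicative fields of a record representing a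
  module are irrelevant.
\<close>

locale right_module = A: ring A + M: abelian_group M
  for A :: "('a, 'k) ring_scheme" and M :: "('a, 'm) module" (structure) +
  assumes act_closed: "\<lbrakk>a \<in> carrier A; x \<in> carrier M\<rbrakk> \<Longrightarrow> a \<odot> x \<in> carrier M"
    and act_add_scalar:
      "\<lbrakk>a \<in> carrier A; b \<in> carrier A; x \<in> carrier M\<rbrakk> \<Longrightarrow> (a \<oplus>\<^bsub>A\<^esub> b) \<odot> x = a \<odot> x \<oplus> b \<odot> x"
    and act_add:
      "\<lbrakk>a \<in> carrier A; x \<in> carrier M; y \<in> carrier M\<rbrakk> \<Longrightarrow> a \<odot> (x \<oplus> y) = a \<odot> x \<oplus> a \<odot> y"
    and act_mult:
      "\<lbrakk>a \<in> carrier A; b \<in> carrier A; x \<in> carrier M\<rbrakk> \<Longrightarrow> (a \<otimes>\<^bsub>A\<^esub> b) \<odot> x = b \<odot> (a \<odot> x)"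
    and act_one: "x \<in> carrier M \<Longrightarrow> \<one>\<^bsub>A\<^esub> \<odot> x = x"

definition regular_module :: "('a, 'k) ring_scheme \<Rightarrow> ('a, 'a) module" where
  "regular_module A =
    \<lparr>carrier = carrier A, monoid.mult = monoid.mult A, one = one A, zero = zero A, add = add A,
     smult = (\<lambda>a x. x \<otimes>\<^bsub>A\<^esub> a)\<rparr>"

text \<open>The quotient by a submodule, in the style of the library's quotient rings. The construction serves both
  for right \<open>A\<close>-modules and for \<open>F\<close>-vector spaces.\<close>

definition quot_module :: "('r, 'm) module \<Rightarrow> 'm set \<Rightarrow> ('r, 'm set) module" where
  "quot_module M N =
    \<lparr>carrier = a_rcosets\<^bsub>M\<^esub> N, monoid.mult = (\<lambda>X Y. N), one = N, zero = N, add = set_add M,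
     smult = (\<lambda>r X. \<Union>x\<in>X. N +>\<^bsub>M\<^esub> (r \<odot>\<^bsub>M\<^esub> x))\<rparr>"

definition module_iso :: "('a, 'k) ring_scheme \<Rightarrow> ('a, 'm) module \<Rightarrow> ('a, 'n) module \<Rightarrow> bool" where
  "module_iso A M N \<longleftrightarrow> (\<exists>f \<in> module_hom A M N. bij_betw f (carrier M) (carrier N))"

definition simple_module :: "('a, 'k) ring_scheme \<Rightarrow> ('a, 'm) module \<Rightarrow> bool" where
  "simple_module A M \<longleftrightarrow> right_module A M \<and> carrier M \<noteq> {\<zero>\<^bsub>M\<^esub>} \<and>
    (\<forall>N. Module.submodule N A M \<longrightarrow> N = {\<zero>\<^bsub>M\<^esub>} \<or> N = carrier M)"

text \<open>
  Every simple right \<open>A\<close>-module is isomorphic to a quotient of the regular module by a maximal right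
  ideal, hence to a module whose elements have type \<^typ>\<open>'a set\<close>. Quantifying over the
  simple modules of this type therefore quantifies over all isomorphism classes of simple modules
  (lemma \<open>simple_module_small\<close> below).
\<close>

definition num_simples :: "('a, 'k) ring_scheme \<Rightarrow> nat" (\<open>\<ell>\<close>) where
  "\<ell> A = card ({T :: ('a, 'a set) module. simple_module A T} //
    {(T, T'). simple_module A T \<and> simple_module A T' \<and> module_iso A T T'})"

definition splitting_field :: "('f, 'k) ring_scheme \<Rightarrow> ('f, 'a) module \<Rightarrow> bool" where
  "splitting_field F A \<longleftrightarrow> (\<forall>T :: ('a, 'a set) module. simple_module A T \<longrightarrow>
    (\<forall>f \<in> module_hom A T T. \<exists>c \<in> carrier F. \<forall>x \<in> carrier T. f x = (c \<odot>\<^bsub>A\<^esub> \<one>\<^bsub>A\<^esub>) \<odot>\<^bsub>T\<^esub> x))"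


section \<open>Commutator subspace and Jacobson radical\<close>

definition codim :: "('f, 'k) ring_scheme \<Rightarrow> ('f, 'v) module \<Rightarrow> 'v set \<Rightarrow> nat" where
  "codim F V W = vectorspace.dim F (quot_module V W)"

definition commutator_space :: "('f, 'k) ring_scheme \<Rightarrow> ('f, 'a) module \<Rightarrow> 'a set" where
  "commutator_space F A = module.span F A
    {x \<otimes>\<^bsub>A\<^esub> y \<ominus>\<^bsub>A\<^esub> y \<otimes>\<^bsub>A\<^esub> x | x y. x \<in> carrier A \<and> y \<in> carrier A}"

definition maximal_right_ideal :: "('a, 'k) ring_scheme \<Rightarrow> 'a set \<Rightarrow> bool" where
  "maximal_right_ideal A I \<longleftrightarrow> Module.submodule I A (regular_module A) \<and> I \<noteq> carrier A \<and>
    (\<forall>J. Module.submodule J A (regular_module A) \<and> I \<subseteq> J \<longrightarrow> J = I \<or> J = carrier A)"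

definition jacobson_radical :: "('a, 'k) ring_scheme \<Rightarrow> 'a set" where
  "jacobson_radical A = carrier A \<inter> \<Inter>{I. maximal_right_ideal A I}"

text \<open>In \<^term>\<open>ideals_set A\<close> the product is the product of ideals and the unit is \<open>A\<close> itself.\<close>

definition KR :: "('f, 'k) ring_scheme \<Rightarrow> ('f, 'a) module \<Rightarrow> nat \<Rightarrow> 'a set" where
  "KR F A n = commutator_space F A <+>\<^bsub>A\<^esub> (jacobson_radical A [^]\<^bsub>ideals_set A\<^esub> n)"


section \<open>Ext\<close>

definition free_module :: "('a, 'k) ring_scheme \<Rightarrow> 'x set \<Rightarrow> ('a, 'x \<Rightarrow> 'a) module" where
  "free_module A X =
    \<lparr>carrier = {g \<in> X \<rightarrow>\<^sub>E carrier A. finite {x \<in> X. g x \<noteq> \<zero>\<^bsub>A\<^esub>}},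
     monoid.mult = (\<lambda>g h. \<lambda>x\<in>X. \<zero>\<^bsub>A\<^esub>), one = (\<lambda>x\<in>X. \<zero>\<^bsub>A\<^esub>), zero = (\<lambda>x\<in>X. \<zero>\<^bsub>A\<^esub>),
     add = (\<lambda>g h. \<lambda>x\<in>X. g x \<oplus>\<^bsub>A\<^esub> h x),
     smult = (\<lambda>a g. \<lambda>x\<in>X. g x \<otimes>\<^bsub>A\<^esub> a)\<rparr>"

text \<open>The canonical epimorphism onto \<open>M\<close> from the free module on the set \<open>M\<close>, and its kernel.\<close>

definition free_eval :: "('a, 'k) ring_scheme \<Rightarrow> ('a, 'm) module \<Rightarrow> ('m \<Rightarrow> 'a) \<Rightarrow> 'm" where
  "free_eval A M g = (\<Oplus>\<^bsub>M\<^esub>x \<in> {x \<in> carrier M. g x \<noteq> \<zero>\<^bsub>A\<^esub>}. g x \<odot>\<^bsub>M\<^esub> x)"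

definition syzygy :: "('a, 'k) ring_scheme \<Rightarrow> ('a, 'm) module \<Rightarrow> ('a, 'm \<Rightarrow> 'a) module" where
  "syzygy A M = (free_module A (carrier M))
    \<lparr>carrier := a_kernel (free_module A (carrier M)) M (free_eval A M)\<rparr>"

definition hom_space ::
    "('f, 'a) module \<Rightarrow> ('a, 'm) module \<Rightarrow> ('a, 'n) module \<Rightarrow> ('f, 'm \<Rightarrow> 'n) module" where
  "hom_space A M N =
    \<lparr>carrier = module_hom A M N \<inter> extensional (carrier M),
     monoid.mult = (\<lambda>f g. \<lambda>x\<in>carrier M. \<zero>\<^bsub>N\<^esub>), one = (\<lambda>x\<in>carrier M. \<zero>\<^bsub>N\<^esub>),
     zero = (\<lambda>x\<in>carrier M. \<zero>\<^bsub>N\<^esub>),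
     add = (\<lambda>f g. \<lambda>x\<in>carrier M. f x \<oplus>\<^bsub>N\<^esub> g x),
     smult = (\<lambda>c f. \<lambda>x\<in>carrier M. (c \<odot>\<^bsub>A\<^esub> \<one>\<^bsub>A\<^esub>) \<odot>\<^bsub>N\<^esub> f x)\<rparr>"

text \<open>
  \<open>Ext\<^sup>1\<close> as a derived functor: the first cohomology of the complex obtained by
  applying \<open>Hom\<^sub>A(-, N)\<close> to the first terms
  \<open>P2 \<rightarrow> P1 \<rightarrow> P0\<close> of the canonical free resolution of \<open>M\<close>, in which each \<open>P\<close> is
  free on the underlying set of the preceding kernel.
\<close>

definition Ext1 ::
    "('f, 'a) module \<Rightarrow> ('a, 'm) module \<Rightarrow> ('a, 'n) module \<Rightarrow>
      ('f, ((('m \<Rightarrow> 'a) \<Rightarrow> 'a) \<Rightarrow> 'n) set) module" where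
  "Ext1 A M N =
    (let Z0 = syzygy A M; Z1 = syzygy A Z0;
         P0 = free_module A (carrier M);
         P1 = free_module A (carrier Z0); d1 = free_eval A Z0;
         P2 = free_module A (carrier Z1); d2 = free_eval A Z1;
         cocycles = {f \<in> carrier (hom_space A P1 N). \<forall>g \<in> carrier P2. f (d2 g) = \<zero>\<^bsub>N\<^esub>};
         coboundaries = (\<lambda>h. \<lambda>g\<in>carrier P1. h (d1 g)) ` carrier (hom_space A P0 N)
     in quot_module ((hom_space A P1 N)\<lparr>carrier := cocycles\<rparr>) coboundaries)"


section \<open>Projective covers and the Cartan matrix\<close>

text \<open>
  A definition in HOL has to fix the types of the modules \<open>M\<close> and \<open>N\<close> in the lifting property. The
  ones chosen suffice: they allow \<open>M\<close> to be the free module on the set \<open>P\<close> and \<open>N\<close> to be \<open>P\<close>, so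
  that \<open>P\<close> is a direct summand of a free module and lifts against epimorphisms of modules of
  arbitrary types (lemma \<open>projective_lift\<close> below).
\<close>

definition projective_module :: "('a, 'k) ring_scheme \<Rightarrow> ('a, 'p) module \<Rightarrow> bool" where
  "projective_module A P \<longleftrightarrow> right_module A P \<and>
    (\<forall>(M :: ('a, 'p \<Rightarrow> 'a) module) (N :: ('a, 'p) module) g f.
      right_module A M \<and> right_module A N \<and>
      g \<in> module_hom A M N \<and> g ` carrier M = carrier N \<and> f \<in> module_hom A P N \<longrightarrow>
      (\<exists>h \<in> module_hom A P M. \<forall>x \<in> carrier P. g (h x) = f x))"

definition projective_cover ::
    "('a, 'k) ring_scheme \<Rightarrow> ('a, 'p) module \<Rightarrow> ('p \<Rightarrow> 'm) \<Rightarrow> ('a, 'm) module \<Rightarrow> bool" where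
  "projective_cover A P p M \<longleftrightarrow> projective_module A P \<and> right_module A M \<and>
    p \<in> module_hom A P M \<and> p ` carrier P = carrier M \<and>
    (\<forall>U. Module.submodule U A P \<and> U <+>\<^bsub>P\<^esub> a_kernel P M p = carrier P \<longrightarrow> U = carrier P)"

text \<open>
  The projective cover of a simple module \<open>M\<close> over a finite-dimensional algebra exists, is unique
  up to isomorphism, and can be realised on a right ideal \<open>eA\<close>, hence on the type \<^typ>\<open>'a\<close>.
\<close>

definition proj_cover :: "('a, 'k) ring_scheme \<Rightarrow> ('a, 'm) module \<Rightarrow> ('a, 'a) module" where
  "proj_cover A M = (SOME P. \<exists>p. projective_cover A P p M)"

definition comp_factor :: "('a, 'm) module \<Rightarrow> (nat \<Rightarrow> 'm set) \<Rightarrow> nat \<Rightarrow> ('a, 'm set) module" where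
  "comp_factor M N k = quot_module (M\<lparr>carrier := N (Suc k)\<rparr>) (N k)"

definition composition_series ::
    "('a, 'k) ring_scheme \<Rightarrow> ('a, 'm) module \<Rightarrow> nat \<Rightarrow> (nat \<Rightarrow> 'm set) \<Rightarrow> bool" where
  "composition_series A M n N \<longleftrightarrow> right_module A M \<and> N 0 = {\<zero>\<^bsub>M\<^esub>} \<and> N n = carrier M \<and>
    (\<forall>k\<le>n. Module.submodule (N k) A M) \<and>
    (\<forall>k<n. N k \<subseteq> N (Suc k) \<and> simple_module A (comp_factor M N k))"

text \<open>By the Jordan-Hoelder theorem the number chosen does not depend on the composition series.\<close>

definition comp_multiplicity ::
    "('a, 'k) ring_scheme \<Rightarrow> ('a, 'p) module \<Rightarrow> ('a, 'm) module \<Rightarrow> nat" where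
  "comp_multiplicity A M S = (SOME m. \<exists>n N. composition_series A M n N \<and>
    m = card {k. k < n \<and> module_iso A (comp_factor M N k) S})"

definition cartan_matrix :: "('a, 'k) ring_scheme \<Rightarrow> (nat \<Rightarrow> ('a, 'm) module) \<Rightarrow> nat mat" where
  "cartan_matrix A S =
    mat (\<ell> A) (\<ell> A) (\<lambda>(i, j). comp_multiplicity A (proj_cover A (S i)) (S j))"

definition mat_trace :: "'a::comm_monoid_add mat \<Rightarrow> 'a" where
  "mat_trace C = (\<Sum>i<dim_row C. C $$ (i, i))"


section \<open>Independence of the types fixed in the definitions\<close>

context right_module begin

lemma act_zero_scalar: "x \<in> carrier M \<Longrightarrow> \<zero>\<^bsub>A\<^esub> \<odot> x = \<zero>"
  using act_add_scalar[of "\<zero>\<^bsub>A\<^esub>" "\<zero>\<^bsub>A\<^esub>" x] act_closed[of "\<zero>\<^bsub>A\<^esub>" x]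
  by (metis A.add.r_one A.zero_closed M.add.r_cancel_one')

lemma act_zero: "a \<in> carrier A \<Longrightarrow> a \<odot> \<zero> = \<zero>"
  using act_add[of a \<zero> \<zero>] act_closed[of a \<zero>]
  by (metis M.add.r_one M.zero_closed M.add.r_cancel_one')

lemma act_finsum:
  assumes "finite B" "a \<in> carrier A" "u \<in> B \<rightarrow> carrier M"
  shows "a \<odot> (\<Oplus>x\<in>B. u x) = (\<Oplus>x\<in>B. a \<odot> u x)"
  using assms by (induction B) (auto simp: act_zero act_add act_closed Pi_iff M.finsum_closed)

definition "lin_ext X u g = (\<Oplus>x \<in> {x \<in> X. g x \<noteq> \<zero>\<^bsub>A\<^esub>}. g x \<odot> u x)"

lemma lin_ext_eq:
  assumes "g \<in> carrier (free_module A X)" "u \<in> X \<rightarrow> carrier M"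
    "finite B" "B \<subseteq> X" "{x \<in> X. g x \<noteq> \<zero>\<^bsub>A\<^esub>} \<subseteq> B"
  shows "lin_ext X u g = (\<Oplus>x \<in> B. g x \<odot> u x)"
  unfolding lin_ext_def using assms
  by (intro M.add.finprod_mono_neutral_cong_left)
     (auto simp: free_module_def act_zero_scalar PiE_iff Pi_iff act_closed subset_iff)

lemma lin_ext_hom:
  assumes u: "u \<in> X \<rightarrow> carrier M"
  shows "lin_ext X u \<in> module_hom A (free_module A X) M"
proof -
  let ?F = "free_module A X"
  let ?s = "\<lambda>g. {x \<in> X. g x \<noteq> \<zero>\<^bsub>A\<^esub>}"
  have cl: "lin_ext X u g \<in> carrier M" if "g \<in> carrier ?F" for g
    unfolding lin_ext_def using that u
    by (intro M.finsum_closed) (auto simp: free_module_def PiE_iff Pi_iff act_closed)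
  have fin: "finite (?s g)" if "g \<in> carrier ?F" for g using that by (auto simp: free_module_def)
  have vals: "g x \<in> carrier A" if "g \<in> carrier ?F" "x \<in> X" for g x using that by (auto simp: free_module_def PiE_iff)
  have add: "lin_ext X u (g \<oplus>\<^bsub>?F\<^esub> h) = lin_ext X u g \<oplus> lin_ext X u h" if g: "g \<in> carrier ?F" and h: "h \<in> carrier ?F" for g h
  proof -
    let ?B = "?s g \<union> ?s h"
    have B: "finite ?B" "?B \<subseteq> X" using fin g h by auto
    have gh: "g \<oplus>\<^bsub>?F\<^esub> h \<in> carrier ?F"
      using g h vals B by (auto simp: free_module_def intro!: finite_subset[OF _ B(1)])
    have "lin_ext X u (g \<oplus>\<^bsub>?F\<^esub> h) = (\<Oplus>x \<in> ?B. (g \<oplus>\<^bsub>?F\<^esub> h) x \<odot> u x)"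
      using vals[OF g] vals[OF h] by (intro lin_ext_eq gh u B) (auto simp: free_module_def)
    also have "\<dots> = (\<Oplus>x \<in> ?B. g x \<odot> u x \<oplus> h x \<odot> u x)"
      using u B vals[OF g] vals[OF h]
      by (intro M.finsum_cong') (auto simp: free_module_def act_add_scalar Pi_iff act_closed)
    also have "\<dots> = (\<Oplus>x \<in> ?B. g x \<odot> u x) \<oplus> (\<Oplus>x \<in> ?B. h x \<odot> u x)"
      using u B vals[OF g] vals[OF h] by (intro M.finsum_addf) (auto simp: act_closed Pi_iff)
    also have "\<dots> = lin_ext X u g \<oplus> lin_ext X u h"
      using lin_ext_eq[OF g u B] lin_ext_eq[OF h u B] by simp
    finally show ?thesis .
  qed
  have sm: "lin_ext X u (a \<odot>\<^bsub>?F\<^esub> g) = a \<odot> lin_ext X u g" if a: "a \<in> carrier A" and g: "g \<in> carrier ?F" for a g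
  proof -
    have B: "finite (?s g)" "?s g \<subseteq> X" using fin g by auto
    have ag: "a \<odot>\<^bsub>?F\<^esub> g \<in> carrier ?F"
      using g a vals B by (auto simp: free_module_def intro!: finite_subset[OF _ B(1)])
    have "lin_ext X u (a \<odot>\<^bsub>?F\<^esub> g) = (\<Oplus>x \<in> ?s g. (a \<odot>\<^bsub>?F\<^esub> g) x \<odot> u x)"
      using vals[OF g] a by (intro lin_ext_eq ag u B) (auto simp: free_module_def)
    also have "\<dots> = (\<Oplus>x \<in> ?s g. a \<odot> (g x \<odot> u x))"
      using u B a vals[OF g]
      by (intro M.finsum_cong') (auto simp: free_module_def act_mult Pi_iff act_closed)
    also have "\<dots> = a \<odot> lin_ext X u g"
      unfolding lin_ext_def using B a u vals[OF g] by (intro act_finsum[symmetric]) (auto simp: act_closed Pi_iff)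
    finally show ?thesis .
  qed
  show ?thesis unfolding module_hom_def using cl add sm by auto
qed

lemma lin_ext_delta:
  assumes u: "u \<in> X \<rightarrow> carrier M" and x: "x \<in> X"
  defines "d \<equiv> (\<lambda>y\<in>X. if y = x then \<one>\<^bsub>A\<^esub> else \<zero>\<^bsub>A\<^esub>)"
  shows "d \<in> carrier (free_module A X)" "lin_ext X u d = u x"
proof -
  show d: "d \<in> carrier (free_module A X)"
    by (auto simp: d_def free_module_def intro!: finite_subset[of _ "{x}"] split: if_splits)
  have "lin_ext X u d = (\<Oplus>y \<in> {x}. d y \<odot> u y)"
    using x by (intro lin_ext_eq d u) (auto simp: d_def)
  also have "\<dots> = u x" using x u by (auto simp: d_def act_closed act_one Pi_iff)
  finally show "lin_ext X u d = u x" .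
qed

end

lemma free_right_module:
  assumes "ring A" shows "right_module A (free_module A X)"
proof -
  interpret A: ring A by fact
  let ?F = "free_module A X"
  have sub: "finite {x\<in>X. h x \<noteq> \<zero>\<^bsub>A\<^esub>}" if "finite {x\<in>X. f x \<noteq> \<zero>\<^bsub>A\<^esub>}" "finite {x\<in>X. g x \<noteq> \<zero>\<^bsub>A\<^esub>}"
    "\<And>x. x \<in> X \<Longrightarrow> f x = \<zero>\<^bsub>A\<^esub> \<Longrightarrow> g x = \<zero>\<^bsub>A\<^esub> \<Longrightarrow> h x = \<zero>\<^bsub>A\<^esub>" for f g h
    by (rule finite_subset[of _ "{x\<in>X. f x \<noteq> \<zero>\<^bsub>A\<^esub>} \<union> {x\<in>X. g x \<noteq> \<zero>\<^bsub>A\<^esub>}"]) (use that in auto)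
  have F: "g \<in> carrier ?F \<longleftrightarrow>
      g \<in> extensional X \<and> (\<forall>x\<in>X. g x \<in> carrier A) \<and> finite {x\<in>X. g x \<noteq> \<zero>\<^bsub>A\<^esub>}" for g
    by (auto simp: free_module_def PiE_iff)
  have ops: "x \<in> X \<Longrightarrow> (g \<oplus>\<^bsub>?F\<^esub> h) x = g x \<oplus>\<^bsub>A\<^esub> h x" "x \<in> X \<Longrightarrow> (a \<odot>\<^bsub>?F\<^esub> g) x = g x \<otimes>\<^bsub>A\<^esub> a"
    "x \<in> X \<Longrightarrow> \<zero>\<^bsub>?F\<^esub> x = \<zero>\<^bsub>A\<^esub>" for g h a x
    by (simp_all add: free_module_def)
  have ext: "g \<oplus>\<^bsub>?F\<^esub> h \<in> extensional X" "a \<odot>\<^bsub>?F\<^esub> g \<in> extensional X" "\<zero>\<^bsub>?F\<^esub> \<in> extensional X" for g h a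
    by (simp_all add: free_module_def)
  have val: "g x \<in> carrier A" if "g \<in> carrier ?F" "x \<in> X" for g x using that F by blast
  have exg: "g \<in> extensional X" and fin: "finite {x\<in>X. g x \<noteq> \<zero>\<^bsub>A\<^esub>}" if "g \<in> carrier ?F" for g
    using that F by blast+
  have zero: "\<zero>\<^bsub>?F\<^esub> \<in> carrier ?F" unfolding F by (simp add: ops ext cong: conj_cong)
  have add: "g \<oplus>\<^bsub>?F\<^esub> h \<in> carrier ?F" if "g \<in> carrier ?F" "h \<in> carrier ?F" for g h
  proof -
    have "finite {x\<in>X. (g \<oplus>\<^bsub>?F\<^esub> h) x \<noteq> \<zero>\<^bsub>A\<^esub>}"
      by (rule sub[OF fin[OF that(1)] fin[OF that(2)]]) (simp add: ops)
    with that show ?thesis unfolding F[of "g \<oplus>\<^bsub>?F\<^esub> h"] by (simp add: ops ext val)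
  qed
  have smult: "a \<odot>\<^bsub>?F\<^esub> g \<in> carrier ?F" if "a \<in> carrier A" "g \<in> carrier ?F" for a g
  proof -
    have "finite {x\<in>X. (a \<odot>\<^bsub>?F\<^esub> g) x \<noteq> \<zero>\<^bsub>A\<^esub>}"
      by (rule sub[OF fin[OF that(2)] fin[OF that(2)]]) (simp add: ops that)
    with that show ?thesis unfolding F[of "a \<odot>\<^bsub>?F\<^esub> g"] by (simp add: ops ext val)
  qed
  have "abelian_group ?F"
  proof (rule abelian_groupI)
    fix g assume g: "g \<in> carrier ?F"
    let ?n = "\<lambda>x\<in>X. \<ominus>\<^bsub>A\<^esub> g x"
    have "finite {x\<in>X. ?n x \<noteq> \<zero>\<^bsub>A\<^esub>}" by (rule sub[OF fin[OF g] fin[OF g]]) simp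
    with g have "?n \<in> carrier ?F" unfolding F[of ?n] by (simp add: val)
    moreover have "?n \<oplus>\<^bsub>?F\<^esub> g = \<zero>\<^bsub>?F\<^esub>"
      by (rule extensionalityI[of _ X]) (simp_all add: ext ops A.l_neg val[OF g])
    ultimately show "\<exists>y\<in>carrier ?F. y \<oplus>\<^bsub>?F\<^esub> g = \<zero>\<^bsub>?F\<^esub>" by blast
    show "\<zero>\<^bsub>?F\<^esub> \<oplus>\<^bsub>?F\<^esub> g = g"
      by (rule extensionalityI[of _ X]) (simp_all add: ext ops exg[OF g] val[OF g])
  next
    fix g h assume g: "g \<in> carrier ?F" "h \<in> carrier ?F"
    show "g \<oplus>\<^bsub>?F\<^esub> h = h \<oplus>\<^bsub>?F\<^esub> g"
      by (rule extensionalityI[of _ X]) (simp_all add: ext ops val[OF g(1)] val[OF g(2)] A.a_comm)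
    fix k assume k: "k \<in> carrier ?F"
    show "g \<oplus>\<^bsub>?F\<^esub> h \<oplus>\<^bsub>?F\<^esub> k = g \<oplus>\<^bsub>?F\<^esub> (h \<oplus>\<^bsub>?F\<^esub> k)"
      by (rule extensionalityI[of _ X])
        (simp_all add: ext ops val[OF g(1)] val[OF g(2)] val[OF k] A.a_assoc)
  qed (fact add zero)+
  then show ?thesis
  proof (intro right_module.intro right_module_axioms.intro assms)
    fix g assume g: "g \<in> carrier ?F"
    show "\<one>\<^bsub>A\<^esub> \<odot>\<^bsub>?F\<^esub> g = g"
      by (rule extensionalityI[of _ X]) (simp_all add: ext ops exg[OF g] val[OF g])
    fix a assume a: "a \<in> carrier A"
    show "a \<odot>\<^bsub>?F\<^esub> g \<in> carrier ?F" by (rule smult[OF a g])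
    fix b assume b: "b \<in> carrier A"
    show "(a \<oplus>\<^bsub>A\<^esub> b) \<odot>\<^bsub>?F\<^esub> g = a \<odot>\<^bsub>?F\<^esub> g \<oplus>\<^bsub>?F\<^esub> b \<odot>\<^bsub>?F\<^esub> g"
      by (rule extensionalityI[of _ X]) (simp_all add: ext ops val[OF g] a b A.r_distr)
    show "(a \<otimes>\<^bsub>A\<^esub> b) \<odot>\<^bsub>?F\<^esub> g = b \<odot>\<^bsub>?F\<^esub> (a \<odot>\<^bsub>?F\<^esub> g)"
      by (rule extensionalityI[of _ X]) (simp_all add: ext ops val[OF g] a b A.m_assoc)
  next
    fix a g h assume a: "a \<in> carrier A" and g: "g \<in> carrier ?F" "h \<in> carrier ?F"
    show "a \<odot>\<^bsub>?F\<^esub> (g \<oplus>\<^bsub>?F\<^esub> h) = a \<odot>\<^bsub>?F\<^esub> g \<oplus>\<^bsub>?F\<^esub> a \<odot>\<^bsub>?F\<^esub> h"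
      by (rule extensionalityI[of _ X]) (simp_all add: ext ops val[OF g(1)] val[OF g(2)] a A.l_distr)
  qed
qed

lemma free_eval_eq: "right_module A M \<Longrightarrow> free_eval A M = right_module.lin_ext A M (carrier M) (\<lambda>x. x)"
  by (auto simp: fun_eq_iff free_eval_def right_module.lin_ext_def)

lemma free_eval_surj:
  assumes "right_module A M"
  shows "free_eval A M \<in> module_hom A (free_module A (carrier M)) M"
    "free_eval A M ` carrier (free_module A (carrier M)) = carrier M"
proof -
  interpret right_module A M by fact
  have u: "(\<lambda>x. x) \<in> carrier M \<rightarrow> carrier M" by auto
  show h: "free_eval A M \<in> module_hom A (free_module A (carrier M)) M"
    using lin_ext_hom[OF u] by (simp add: free_eval_eq[OF assms])
  show "free_eval A M ` carrier (free_module A (carrier M)) = carrier M"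
  proof
    show "free_eval A M ` carrier (free_module A (carrier M)) \<subseteq> carrier M"
      using h unfolding module_hom_def by blast
    show "carrier M \<subseteq> free_eval A M ` carrier (free_module A (carrier M))"
    proof
      fix x assume "x \<in> carrier M"
      from lin_ext_delta[OF u this] show "x \<in> free_eval A M ` carrier (free_module A (carrier M))"
        unfolding free_eval_eq[OF assms] by (metis imageI)
    qed
  qed
qed

lemma hom_finsum:
  assumes "right_module A M" "right_module A N" and g: "g \<in> module_hom A M N"
    and "finite B" "v \<in> B \<rightarrow> carrier M"
  shows "g (\<Oplus>\<^bsub>M\<^esub>x\<in>B. v x) = (\<Oplus>\<^bsub>N\<^esub>x\<in>B. g (v x))"
proof -
  interpret M: right_module A M by fact
  interpret N: right_module A N by fact
  have "g \<zero>\<^bsub>M\<^esub> \<oplus>\<^bsub>N\<^esub> g \<zero>\<^bsub>M\<^esub> = g (\<zero>\<^bsub>M\<^esub> \<oplus>\<^bsub>M\<^esub> \<zero>\<^bsub>M\<^esub>)" "g \<zero>\<^bsub>M\<^esub> \<in> carrier N"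
    using g M.M.zero_closed unfolding module_hom_def by (blast intro: sym)+
  then have "g \<zero>\<^bsub>M\<^esub> = \<zero>\<^bsub>N\<^esub>" by (simp add: N.M.add.l_cancel_one)
  with assms(4,5) g show ?thesis
    by (induction B) (auto simp: module_hom_def Pi_iff M.M.finsum_closed)
qed

lemma projective_lift:
  fixes M :: "('a, 'm) module" and N :: "('a, 'n) module"
  assumes P: "projective_module A P" and M: "right_module A M" and N: "right_module A N"
    and g: "g \<in> module_hom A M N" "g ` carrier M = carrier N" and f: "f \<in> module_hom A P N"
  shows "\<exists>h \<in> module_hom A P M. \<forall>x \<in> carrier P. g (h x) = f x"
proof -
  have Pm: "right_module A P" using P by (simp add: projective_module_def)
  interpret P: right_module A P by fact
  interpret M: right_module A M by fact
  interpret N: right_module A N by fact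
  let ?F = "free_module A (carrier P)"
  have F: "right_module A ?F" by (rule free_right_module) (rule P.A.ring_axioms)
  have "(\<lambda>x. x) \<in> module_hom A P P" by (auto simp: module_hom_def)
  with P F Pm free_eval_surj[OF Pm]
  obtain s where s: "s \<in> module_hom A P ?F" "\<forall>x\<in>carrier P. free_eval A P (s x) = x"
    unfolding projective_module_def by meson
  define u where "u x = (SOME y. y \<in> carrier M \<and> g y = f x)" for x
  have u: "u x \<in> carrier M \<and> g (u x) = f x" if "x \<in> carrier P" for x
  proof -
    have "f x \<in> g ` carrier M" unfolding g(2) using f that by (auto simp: module_hom_def)
    then have "\<exists>y. y \<in> carrier M \<and> g y = f x" by auto
    then show ?thesis unfolding u_def by (rule someI_ex)
  qed
  then have u': "u \<in> carrier P \<rightarrow> carrier M" by auto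
  define h where "h x = M.lin_ext (carrier P) u (s x)" for x
  have "h \<in> module_hom A P M"
  proof -
    let ?k = "M.lin_ext (carrier P) u"
    have k: "\<And>x. x \<in> carrier ?F \<Longrightarrow> ?k x \<in> carrier M"
      "\<And>x y. x \<in> carrier ?F \<Longrightarrow> y \<in> carrier ?F \<Longrightarrow> ?k (x \<oplus>\<^bsub>?F\<^esub> y) = ?k x \<oplus>\<^bsub>M\<^esub> ?k y"
      "\<And>a x. a \<in> carrier A \<Longrightarrow> x \<in> carrier ?F \<Longrightarrow> ?k (a \<odot>\<^bsub>?F\<^esub> x) = a \<odot>\<^bsub>M\<^esub> ?k x"
      using M.lin_ext_hom[OF u'] unfolding module_hom_def by blast+
    have s': "\<And>x. x \<in> carrier P \<Longrightarrow> s x \<in> carrier ?F"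
      "\<And>x y. x \<in> carrier P \<Longrightarrow> y \<in> carrier P \<Longrightarrow> s (x \<oplus>\<^bsub>P\<^esub> y) = s x \<oplus>\<^bsub>?F\<^esub> s y"
      "\<And>a x. a \<in> carrier A \<Longrightarrow> x \<in> carrier P \<Longrightarrow> s (a \<odot>\<^bsub>P\<^esub> x) = a \<odot>\<^bsub>?F\<^esub> s x"
      using s(1) unfolding module_hom_def by blast+
    show ?thesis unfolding module_hom_def h_def by (auto simp: k s')
  qed
  moreover have "g (h x) = f x" if x: "x \<in> carrier P" for x
  proof -
    have sx: "s x \<in> carrier ?F" using s(1) x by (auto simp: module_hom_def)
    let ?B = "{y \<in> carrier P. s x y \<noteq> \<zero>\<^bsub>A\<^esub>}"
    have B: "finite ?B" "\<And>y. y \<in> ?B \<Longrightarrow> s x y \<in> carrier A" using sx by (auto simp: free_module_def PiE_iff)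
    have "g (h x) = (\<Oplus>\<^bsub>N\<^esub>y\<in>?B. g (s x y \<odot>\<^bsub>M\<^esub> u y))"
      unfolding h_def M.lin_ext_def using B u by (intro hom_finsum[OF M N g(1)]) (auto simp: M.act_closed)
    also have "\<dots> = (\<Oplus>\<^bsub>N\<^esub>y\<in>?B. f (s x y \<odot>\<^bsub>P\<^esub> y))"
      using B u f g by (intro N.M.finsum_cong') (auto simp: module_hom_def P.act_closed Pi_iff N.act_closed)
    also have "\<dots> = f (free_eval A P (s x))"
      unfolding free_eval_def using B by (intro hom_finsum[OF Pm N f, symmetric]) (auto simp: P.act_closed)
    finally show ?thesis using s(2) x by simp
  qed
  ultimately show ?thesis by blast
qed

lemma simple_module_transport:
  fixes M :: "('a, 'm) module" (structure) and f :: "'m \<Rightarrow> 'n"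
  assumes M: "simple_module A M" and f: "inj_on f (carrier M)"
  shows "\<exists>T :: ('a, 'n) module. simple_module A T \<and> module_iso A M T"
proof -
  have Mm: "right_module A M" using M by (simp add: simple_module_def)
  interpret right_module A M by fact
  let ?g = "the_inv_into (carrier M) f"
  define T :: "('a, 'n) module" where
    "T = \<lparr>carrier = f ` carrier M, monoid.mult = (\<lambda>x y. x), one = f \<zero>, zero = f \<zero>,
      add = (\<lambda>x y. f (?g x \<oplus> ?g y)), smult = (\<lambda>a x. f (a \<odot> ?g x))\<rparr>"
  have gf: "?g (f x) = x" if "x \<in> carrier M" for x using that f by (simp add: the_inv_into_f_f)
  have T [simp]: "carrier T = f ` carrier M" "\<zero>\<^bsub>T\<^esub> = f \<zero>"
    "\<And>x y. x \<in> carrier M \<Longrightarrow> y \<in> carrier M \<Longrightarrow> f x \<oplus>\<^bsub>T\<^esub> f y = f (x \<oplus> y)"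
    "\<And>a x. x \<in> carrier M \<Longrightarrow> a \<odot>\<^bsub>T\<^esub> f x = f (a \<odot> x)"
    by (auto simp: T_def gf)
  have ag: "abelian_group T"
  proof (rule abelian_groupI)
    fix x assume "x \<in> carrier T"
    then obtain m where m: "m \<in> carrier M" "x = f m" by auto
    show "\<exists>y\<in>carrier T. y \<oplus>\<^bsub>T\<^esub> x = \<zero>\<^bsub>T\<^esub>" using m by (intro bexI[of _ "f (\<ominus> m)"]) (auto simp: M.l_neg)
  qed (auto simp: M.a_ac)
  have Tm: "right_module A T"
    by (intro right_module.intro right_module_axioms.intro ag A.ring_axioms)
       (auto simp: act_closed act_add act_add_scalar act_mult act_one)
  then interpret T: right_module A T .
  have iso: "f \<in> module_hom A M T" by (auto simp: module_hom_def)
  have sub: "Module.submodule {x \<in> carrier M. f x \<in> N} A M" if N: "Module.submodule N A T" for N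
  proof -
    interpret N: Module.submodule N A T by fact
    have inv: "inv\<^bsub>add_monoid T\<^esub> (f m) = f (\<ominus> m)" if "m \<in> carrier M" for m
      unfolding a_inv_def[symmetric, of T] using that by (intro T.M.minus_equality) (auto simp: M.l_neg)
    show ?thesis
    proof (intro Module.submodule.intro subgroup.intro submodule_axioms.intro)
      show "x \<otimes>\<^bsub>add_monoid M\<^esub> y \<in> {x \<in> carrier M. f x \<in> N}"
        if "x \<in> {x \<in> carrier M. f x \<in> N}" "y \<in> {x \<in> carrier M. f x \<in> N}" for x y
        using that N.m_closed[of "f x" "f y"] by simp
      show "\<one>\<^bsub>add_monoid M\<^esub> \<in> {x \<in> carrier M. f x \<in> N}"
        using N.one_closed by simp
      show "inv\<^bsub>add_monoid M\<^esub> x \<in> {x \<in> carrier M. f x \<in> N}" if "x \<in> {x \<in> carrier M. f x \<in> N}" for x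
      proof -
        from that have x: "x \<in> carrier M" "f x \<in> N" by auto
        have "f (\<ominus> x) \<in> N" using N.m_inv_closed[OF x(2)] unfolding inv[OF x(1)] .
        then show ?thesis unfolding a_inv_def[symmetric, of M] using x by simp
      qed
      show "a \<odot> x \<in> {x \<in> carrier M. f x \<in> N}"
        if "a \<in> carrier A" "x \<in> {x \<in> carrier M. f x \<in> N}" for a x
        using that N.smult_closed[of a "f x"] by (simp add: act_closed)
    qed auto
  qed
  have "simple_module A T"
    unfolding simple_module_def
  proof (intro conjI allI impI Tm)
    show "carrier T \<noteq> {\<zero>\<^bsub>T\<^esub>}"
    proof
      assume "carrier T = {\<zero>\<^bsub>T\<^esub>}"
      then have "f ` carrier M = f ` {\<zero>}" by simp
      then have "carrier M = {\<zero>}"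
        by (subst (asm) inj_on_image_eq_iff[OF f]) (use M.zero_closed in auto)
      with M show False by (simp add: simple_module_def)
    qed
    fix N assume N: "Module.submodule N A T"
    then interpret N: Module.submodule N A T .
    have NT: "N \<subseteq> carrier T" using N.subset by simp
    then have eq: "N = f ` {x \<in> carrier M. f x \<in> N}" by auto
    from sub[OF N] M have "{x \<in> carrier M. f x \<in> N} = {\<zero>} \<or> {x \<in> carrier M. f x \<in> N} = carrier M"
      by (auto simp: simple_module_def)
    then show "N = {\<zero>\<^bsub>T\<^esub>} \<or> N = carrier T"
    proof
      assume "{x \<in> carrier M. f x \<in> N} = {\<zero>}"
      then show ?thesis by (intro disjI1, subst eq) simp
    next
      assume "{x \<in> carrier M. f x \<in> N} = carrier M"
      then show ?thesis by (intro disjI2, subst eq) simp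
    qed
  qed
  moreover have "module_iso A M T"
    unfolding module_iso_def using iso f by (intro bexI[of _ f]) (auto simp: bij_betw_def)
  ultimately show ?thesis by blast
qed

lemma simple_module_small:
  fixes M :: "('a, 'm) module" (structure)
  assumes M: "simple_module A M"
  shows "\<exists>T :: ('a, 'a set) module. simple_module A T \<and> module_iso A M T"
proof -
  have Mm: "right_module A M" using M by (simp add: simple_module_def)
  interpret right_module A M by fact
  obtain x where x: "x \<in> carrier M" "x \<noteq> \<zero>"
    using M M.zero_closed by (fastforce simp: simple_module_def)
  let ?N = "(\<lambda>a. a \<odot> x) ` carrier A"
  have neg: "\<ominus> (a \<odot> x) = (\<ominus>\<^bsub>A\<^esub> a) \<odot> x" if "a \<in> carrier A" for a
  proof (rule M.minus_equality)
    show "(\<ominus>\<^bsub>A\<^esub> a) \<odot> x \<oplus> a \<odot> x = \<zero>"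
      using that x by (simp flip: act_add_scalar add: A.l_neg act_zero_scalar)
  qed (use that x in \<open>auto simp: act_closed\<close>)
  have "Module.submodule ?N A M"
  proof (intro Module.submodule.intro subgroup.intro submodule_axioms.intro)
    show "\<one>\<^bsub>add_monoid M\<^esub> \<in> ?N" using x act_zero_scalar by (auto intro!: image_eqI[of _ _ "\<zero>\<^bsub>A\<^esub>"])
    show "y \<otimes>\<^bsub>add_monoid M\<^esub> z \<in> ?N" if "y \<in> ?N" "z \<in> ?N" for y z
      using that x by (auto simp flip: act_add_scalar)
    show "inv\<^bsub>add_monoid M\<^esub> y \<in> ?N" if "y \<in> ?N" for y
      using that neg by (auto simp flip: a_inv_def)
    show "a \<odot> y \<in> ?N" if "a \<in> carrier A" "y \<in> ?N" for a y
      using that x by (auto simp flip: act_mult)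
  qed (use x in \<open>auto simp: act_closed\<close>)
  moreover have "x \<in> ?N" using act_one[OF x(1)] by (metis A.one_closed imageI)
  ultimately have N: "?N = carrier M" using M x by (auto simp: simple_module_def)
  have "inj_on (\<lambda>m. {a \<in> carrier A. a \<odot> x = m}) (carrier M)"
    unfolding N[symmetric] by (auto simp: inj_on_def set_eq_iff)
  then show ?thesis using simple_module_transport[OF M] by blast
qed

end

(*
  Choose for every simple module S_i an idempotent e_i such that e_i A is minimal among the right
  ideals not annihilating S_i. Then e_i A is a projective cover of S_i, e_i annihilates S_j for
  j distinct from i, e_i A e_j lies in J = Rad A for i distinct from j, and e_i A e_i = F e_i + e_i J e_i
  because F splits A. No maximal right ideal contains the sum of the A e_i A, so
  1 = sum u_k v_k with u_k in A e_(iota k) and v_k in e_(iota k) A.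

  The maps T_i(x) = sum of v_k x u_k over iota k = i send A to e_i A e_i. They satisfy
  T_i(xy) = T_i(yx) modulo J^2, restrict to the identity on e_i A e_i and to 0 on e_j A e_j modulo J^2,
  and x - sum_i T_i(x) is a sum of commutators. Hence A/(K(A) + N) is the direct sum of the
  e_i A e_i / e_i N e_i for N = J and N = J^2, which gives (i) and
  codim KR^2(A) = l(A) + sum_i dim e_i J e_i / e_i J^2 e_i; moreover A/K(A) is spanned by the
  e_i A e_i, and dim e_i A e_i is at most the multiplicity of S_i in a projective cover of S_i.

  Finally Ext^1(S_i, S_i) is Hom(e_i J, S_i), and restriction to e_i J e_i identifies the latter with
  the dual of e_i J e_i / e_i J^2 e_i.
*)

theory Submission
  imports Defs
begin

section \<open>Submodules and quotients of right modules\<close>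

text \<open>Since \<open>A\<close> need not be basic, it is larger than the sum of its corners
  \<open>e_i A e_i\<close>. The expression of the identity through \<open>u_k\<close> and
  \<open>v_k\<close> presents \<open>x\<close> as a block matrix with entries
  \<open>v_k x u_m\<close>, and \<open>T_i\<close> is the trace of its \<open>i\<close>-th diagonal
  block. The square of the radical is what the argument controls for two reasons: the entries of a
  diagonal block commute modulo \<open>J^2\<close>, each being a scalar plus a radical element, and
  a product that passes through a foreign block has both factors in \<open>J\<close>. The
  definitions raise two obstacles. \<open>Ext\<close> is taken from a free resolution on underlying
  sets; maps in both directions between its first term and \<open>e_i A\<close> reduce it to
  \<open>e_i J\<close>. Projective covers and multiplicities are fixed by a choice; the upper bound
  therefore rests on properties shared by every projective cover and every composition series.
  Codimensions are read off from vectors together with dual functionals, so that upper and lower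
  bounds come from the same data.\<close>

lemma (in abelian_group) minus_eq_zero_iff:
  assumes "x \<in> carrier G" "y \<in> carrier G" shows "x \<ominus> y = \<zero> \<longleftrightarrow> x = y"
proof
  assume "x \<ominus> y = \<zero>"
  then have "\<ominus> (\<ominus> y) = x" using assms by (intro minus_equality) (auto simp: a_minus_def)
  then show "x = y" using assms by (simp add: minus_minus)
qed (use assms in \<open>simp add: a_minus_def r_neg\<close>)

lemma (in right_module) submodule_iff:
  "Module.submodule N A M \<longleftrightarrow> N \<subseteq> carrier M \<and> \<zero> \<in> N \<and> (\<forall>x\<in>N. \<forall>y\<in>N. x \<oplus> y \<in> N) \<and>
    (\<forall>a\<in>carrier A. \<forall>x\<in>N. a \<odot> x \<in> N)"
proof
  assume "Module.submodule N A M"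
  then interpret N: Module.submodule N A M .
  show "N \<subseteq> carrier M \<and> \<zero> \<in> N \<and> (\<forall>x\<in>N. \<forall>y\<in>N. x \<oplus> y \<in> N) \<and> (\<forall>a\<in>carrier A. \<forall>x\<in>N. a \<odot> x \<in> N)"
    using N.subset N.one_closed N.m_closed N.smult_closed by auto
next
  assume N: "N \<subseteq> carrier M \<and> \<zero> \<in> N \<and> (\<forall>x\<in>N. \<forall>y\<in>N. x \<oplus> y \<in> N) \<and> (\<forall>a\<in>carrier A. \<forall>x\<in>N. a \<odot> x \<in> N)"
  \<comment> \<open>Negation is the action of \<open>\<ominus> \<one>\<close>, so stability under
    the action yields inverses.\<close>
  have "\<ominus> x = (\<ominus>\<^bsub>A\<^esub> \<one>\<^bsub>A\<^esub>) \<odot> x" if "x \<in> carrier M" for x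
  proof (rule M.minus_equality)
    have "(\<ominus>\<^bsub>A\<^esub> \<one>\<^bsub>A\<^esub>) \<odot> x \<oplus> \<one>\<^bsub>A\<^esub> \<odot> x = \<zero>"
      using that by (subst act_add_scalar[symmetric]) (auto simp: A.l_neg act_zero_scalar)
    then show "(\<ominus>\<^bsub>A\<^esub> \<one>\<^bsub>A\<^esub>) \<odot> x \<oplus> x = \<zero>" using that by (simp add: act_one)
  qed (use that act_closed in auto)
  then have "inv\<^bsub>add_monoid M\<^esub> x \<in> N" if "x \<in> N" for x
    using that N A.a_inv_closed[OF A.one_closed] unfolding a_inv_def[of M] by auto
  with N show "Module.submodule N A M"
    by (intro Module.submodule.intro subgroup.intro submodule_axioms.intro) auto
qed

context right_module begin

lemma act_neg_scalar: "\<lbrakk>a \<in> carrier A; x \<in> carrier M\<rbrakk> \<Longrightarrow> (\<ominus>\<^bsub>A\<^esub> a) \<odot> x = \<ominus> (a \<odot> x)"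
  by (rule M.minus_equality[symmetric]) (auto simp flip: act_add_scalar simp: A.l_neg act_zero_scalar act_closed)

lemma act_neg: "\<lbrakk>a \<in> carrier A; x \<in> carrier M\<rbrakk> \<Longrightarrow> a \<odot> (\<ominus> x) = \<ominus> (a \<odot> x)"
  by (rule M.minus_equality[symmetric]) (auto simp flip: act_add simp: M.l_neg act_zero act_closed)

lemma act_minus: "\<lbrakk>a \<in> carrier A; x \<in> carrier M; y \<in> carrier M\<rbrakk> \<Longrightarrow> a \<odot> (x \<ominus> y) = a \<odot> x \<ominus> a \<odot> y"
  by (simp add: a_minus_def act_add act_neg)

lemma act_minus_scalar:
  "\<lbrakk>a \<in> carrier A; b \<in> carrier A; x \<in> carrier M\<rbrakk> \<Longrightarrow> (a \<ominus>\<^bsub>A\<^esub> b) \<odot> x = a \<odot> x \<ominus> b \<odot> x"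
  by (simp add: a_minus_def act_add_scalar act_neg_scalar)

lemma act_finsum_scalar:
  assumes "finite B" "x \<in> carrier M" "u \<in> B \<rightarrow> carrier A"
  shows "(\<Oplus>\<^bsub>A\<^esub>b\<in>B. u b) \<odot> x = (\<Oplus>b\<in>B. u b \<odot> x)"
  using assms by (induction B) (auto simp: act_zero_scalar act_add_scalar act_closed Pi_iff A.finsum_closed)

context
  fixes N assumes N: "Module.submodule N A M"
begin

lemma submodule_subset: "N \<subseteq> carrier M" and submodule_zero: "\<zero> \<in> N"
  and submodule_add: "\<lbrakk>x \<in> N; y \<in> N\<rbrakk> \<Longrightarrow> x \<oplus> y \<in> N"
  and submodule_act: "\<lbrakk>a \<in> carrier A; x \<in> N\<rbrakk> \<Longrightarrow> a \<odot> x \<in> N"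
  using N by (auto simp: submodule_iff)

lemma submodule_neg: "x \<in> N \<Longrightarrow> \<ominus> x \<in> N"
  using submodule_act[of "\<ominus>\<^bsub>A\<^esub> \<one>\<^bsub>A\<^esub>" x] submodule_subset
  by (auto simp: act_neg_scalar act_one subset_iff)

lemma submodule_minus: "\<lbrakk>x \<in> N; y \<in> N\<rbrakk> \<Longrightarrow> x \<ominus> y \<in> N"
  by (simp add: a_minus_def submodule_add submodule_neg)

lemma submodule_minus_cancel: "\<lbrakk>x \<in> carrier M; x \<ominus> y \<in> N; y \<in> N\<rbrakk> \<Longrightarrow> x \<in> N"
  using submodule_add[of "x \<ominus> y" y] submodule_subset
  by (auto simp: a_minus_def M.a_assoc M.l_neg subset_iff)

lemma submodule_finsum: "\<lbrakk>finite B; u \<in> B \<rightarrow> N\<rbrakk> \<Longrightarrow> (\<Oplus>b\<in>B. u b) \<in> N"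
proof (induction B rule: finite_induct)
  case (insert x F)
  then have "u \<in> F \<rightarrow> carrier M" "u x \<in> carrier M" using submodule_subset by (auto simp: Pi_iff)
  with insert show ?case by (auto intro: submodule_add)
qed (auto simp: submodule_zero)

lemma submodule_right_module: "right_module A (M\<lparr>carrier := N\<rparr>)"
proof (intro right_module.intro right_module_axioms.intro A.ring_axioms)
  have sub: "x \<in> carrier M" if "x \<in> N" for x using that submodule_subset by auto
  show "abelian_group (M\<lparr>carrier := N\<rparr>)"
  proof (rule abelian_groupI)
    show "\<exists>y\<in>carrier (M\<lparr>carrier := N\<rparr>). y \<oplus>\<^bsub>M\<lparr>carrier := N\<rparr>\<^esub> x = \<zero>\<^bsub>M\<lparr>carrier := N\<rparr>\<^esub>"
      if "x \<in> carrier (M\<lparr>carrier := N\<rparr>)" for x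
      using that by (intro bexI[of _ "\<ominus> x"]) (auto simp: sub M.l_neg submodule_neg)
  qed (auto simp: sub M.a_ac intro: submodule_add submodule_zero)
qed (use submodule_subset in \<open>auto intro: submodule_act simp: act_add act_add_scalar act_mult act_one subset_iff\<close>)

lemma submodule_abelian_subgroup: "abelian_subgroup N M"
  using N M.abelian_group_axioms by (intro abelian_subgroupI3 additive_subgroupI) (auto simp: Module.submodule_def)

interpretation S: abelian_subgroup N M by (rule submodule_abelian_subgroup)

lemma coset_eq_iff:
  assumes "x \<in> carrier M" "y \<in> carrier M" shows "N +> x = N +> y \<longleftrightarrow> x \<ominus> y \<in> N"
proof
  assume "N +> x = N +> y"
  then have "x \<in> N +> y" using S.a_rcos_self[OF assms(1)] by simp
  then obtain n where n: "n \<in> N" "x = n \<oplus> y" by (auto simp: a_r_coset_def')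
  then have "x \<ominus> y = n" using submodule_subset assms by (auto simp: a_minus_def M.a_assoc M.r_neg subset_iff)
  with n show "x \<ominus> y \<in> N" by simp
next
  assume "x \<ominus> y \<in> N"
  then have "(x \<ominus> y) \<oplus> y \<in> N +> y" by (auto simp: a_r_coset_def')
  then have "x \<in> N +> y" using assms by (simp add: a_minus_def M.a_assoc M.l_neg)
  then show "N +> x = N +> y" using assms(2) S.a_subgroup by (rule M.a_repr_independence[symmetric])
qed

lemma coset_eq_zero_iff: "x \<in> carrier M \<Longrightarrow> N +> x = \<zero>\<^bsub>quot_module M N\<^esub> \<longleftrightarrow> x \<in> N"
proof -
  assume x: "x \<in> carrier M"
  have "x \<ominus> \<zero> = x" using x by (metis M.add.inv_one M.minus_eq M.r_zero a_inv_def monoid.select_convs(2))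
  then show ?thesis using coset_eq_iff[of x \<zero>] submodule_subset x by (simp add: quot_module_def)
qed

lemma quot_carrier: "carrier (quot_module M N) = (\<lambda>x. N +> x) ` carrier M"
  by (auto simp: quot_module_def A_RCOSETS_def')

lemma quot_add:
  "\<lbrakk>x \<in> carrier M; y \<in> carrier M\<rbrakk> \<Longrightarrow> (N +> x) \<oplus>\<^bsub>quot_module M N\<^esub> (N +> y) = N +> (x \<oplus> y)"
  by (simp add: quot_module_def S.a_rcos_sum)

text \<open>The action on the quotient is defined as a union over all representatives. Two
  representatives differ by an element of \<open>N\<close>, and \<open>N\<close> is stable under
  \<open>a\<close>, so the cosets in that union coincide.\<close>

lemma quot_act:
  assumes "a \<in> carrier A" "x \<in> carrier M"
  shows "a \<odot>\<^bsub>quot_module M N\<^esub> (N +> x) = N +> (a \<odot> x)"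
proof -
  have "N +> (a \<odot> y) = N +> (a \<odot> x)" if "y \<in> N +> x" for y
  proof -
    have y: "y \<in> carrier M" using that assms(2) submodule_subset by (auto simp: a_r_coset_def' subset_iff)
    have "N +> y = N +> x" by (rule M.a_repr_independence[symmetric, OF that assms(2) S.a_subgroup])
    then have "a \<odot> (y \<ominus> x) \<in> N" using y assms by (simp add: submodule_act coset_eq_iff)
    then show ?thesis using y assms by (simp add: coset_eq_iff act_closed act_minus)
  qed
  moreover have "x \<in> N +> x" using assms(2) by (rule S.a_rcos_self)
  ultimately have "(\<Union>y\<in>N +> x. N +> (a \<odot> y)) = N +> (a \<odot> x)" by blast
  then show ?thesis by (simp add: quot_module_def)
qed

lemma quot_right_module: "right_module A (quot_module M N)"
proof -
  let ?Q = "quot_module M N"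
  have z: "\<zero>\<^bsub>?Q\<^esub> = N +> \<zero>" using submodule_subset by (simp add: quot_module_def)
  have "abelian_group ?Q"
  proof (rule abelian_groupI)
    fix X assume "X \<in> carrier ?Q"
    then obtain x where x: "x \<in> carrier M" "X = N +> x" by (auto simp: quot_carrier)
    then show "\<exists>y\<in>carrier ?Q. y \<oplus>\<^bsub>?Q\<^esub> X = \<zero>\<^bsub>?Q\<^esub>"
      by (intro bexI[of _ "N +> (\<ominus> x)"]) (auto simp: quot_add quot_carrier z M.l_neg)
  qed (auto simp: quot_carrier quot_add z M.a_ac)
  then show ?thesis
    by (intro right_module.intro right_module_axioms.intro A.ring_axioms)
      (auto simp: quot_carrier quot_add quot_act act_closed act_add act_add_scalar act_mult act_one)
qed

end

end

lemma module_homD: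
  assumes "f \<in> module_hom A M N"
  shows "x \<in> carrier M \<Longrightarrow> f x \<in> carrier N"
    "\<lbrakk>x \<in> carrier M; y \<in> carrier M\<rbrakk> \<Longrightarrow> f (x \<oplus>\<^bsub>M\<^esub> y) = f x \<oplus>\<^bsub>N\<^esub> f y"
    "\<lbrakk>a \<in> carrier A; x \<in> carrier M\<rbrakk> \<Longrightarrow> f (a \<odot>\<^bsub>M\<^esub> x) = a \<odot>\<^bsub>N\<^esub> f x"
  using assms unfolding module_hom_def by blast+

lemma module_homI:
  assumes "\<And>x. x \<in> carrier M \<Longrightarrow> f x \<in> carrier N"
    "\<And>x y. \<lbrakk>x \<in> carrier M; y \<in> carrier M\<rbrakk> \<Longrightarrow> f (x \<oplus>\<^bsub>M\<^esub> y) = f x \<oplus>\<^bsub>N\<^esub> f y"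
    "\<And>a x. \<lbrakk>a \<in> carrier A; x \<in> carrier M\<rbrakk> \<Longrightarrow> f (a \<odot>\<^bsub>M\<^esub> x) = a \<odot>\<^bsub>N\<^esub> f x"
  shows "f \<in> module_hom A M N"
  using assms unfolding module_hom_def by blast

lemma module_hom_zero:
  assumes "right_module A M" "right_module A N" "f \<in> module_hom A M N"
  shows "f \<zero>\<^bsub>M\<^esub> = \<zero>\<^bsub>N\<^esub>"
proof -
  interpret M: right_module A M by fact
  interpret N: right_module A N by fact
  have "f (\<zero>\<^bsub>A\<^esub> \<odot>\<^bsub>M\<^esub> \<zero>\<^bsub>M\<^esub>) = \<zero>\<^bsub>A\<^esub> \<odot>\<^bsub>N\<^esub> f \<zero>\<^bsub>M\<^esub>" by (intro module_homD(3)[OF assms(3)]) auto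
  then show ?thesis using module_homD(1)[OF assms(3)] by (simp add: M.act_zero N.act_zero_scalar)
qed

lemma module_hom_neg:
  assumes "right_module A M" "right_module A N" "f \<in> module_hom A M N" "x \<in> carrier M"
  shows "f (\<ominus>\<^bsub>M\<^esub> x) = \<ominus>\<^bsub>N\<^esub> f x"
proof -
  interpret M: right_module A M by fact
  interpret N: right_module A N by fact
  note f = module_homD[OF assms(3)]
  have "f (\<ominus>\<^bsub>M\<^esub> x) \<oplus>\<^bsub>N\<^esub> f x = \<zero>\<^bsub>N\<^esub>"
    using assms(4) by (simp add: f(2)[symmetric] M.M.l_neg module_hom_zero[OF assms(1-3)])
  then show ?thesis using f(1) assms(4) by (metis M.M.a_inv_closed N.M.minus_equality)
qed

lemma module_hom_minus:
  assumes "right_module A M" "right_module A N" "f \<in> module_hom A M N" "x \<in> carrier M" "y \<in> carrier M"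
  shows "f (x \<ominus>\<^bsub>M\<^esub> y) = f x \<ominus>\<^bsub>N\<^esub> f y"
proof -
  interpret M: right_module A M by fact
  show ?thesis
    unfolding a_minus_def using assms by (simp add: module_homD(2)[OF assms(3)] module_hom_neg[OF assms(1-3)])
qed

lemma submodule_vimage:
  assumes M: "right_module A M" and N: "right_module A N" and f: "f \<in> module_hom A M N" and W: "Module.submodule W A N"
  shows "Module.submodule {x \<in> carrier M. f x \<in> W} A M"
proof -
  interpret M: right_module A M by fact
  interpret N: right_module A N by fact
  show ?thesis
    using module_hom_zero[OF M N f] module_homD[OF f] N.submodule_zero[OF W] N.submodule_add[OF W] N.submodule_act[OF W]
    by (auto simp: M.submodule_iff M.act_closed)
qed

lemma submodule_kernel:
  assumes M: "right_module A M" and N: "right_module A N" and f: "f \<in> module_hom A M N"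
  shows "Module.submodule {x \<in> carrier M. f x = \<zero>\<^bsub>N\<^esub>} A M"
proof -
  interpret N: right_module A N by fact
  have "Module.submodule {\<zero>\<^bsub>N\<^esub>} A N" by (simp add: N.submodule_iff N.act_zero)
  from submodule_vimage[OF M N f this] show ?thesis by simp
qed

lemma submodule_image:
  assumes M: "right_module A M" and N: "right_module A N" and f: "f \<in> module_hom A M N" and W: "Module.submodule W A M"
  shows "Module.submodule (f ` W) A N"
proof -
  interpret M: right_module A M by fact
  interpret N: right_module A N by fact
  note W = M.submodule_subset[OF W] M.submodule_zero[OF W] M.submodule_add[OF W] M.submodule_act[OF W]
  have "\<zero>\<^bsub>N\<^esub> \<in> f ` W" using W module_hom_zero[OF M N f] by (metis imageI)
  moreover have "f x \<oplus>\<^bsub>N\<^esub> f y \<in> f ` W" if "x \<in> W" "y \<in> W" for x y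
    using W that module_homD(2)[OF f, of x y] by (metis imageI subsetD)
  moreover have "a \<odot>\<^bsub>N\<^esub> f x \<in> f ` W" if "a \<in> carrier A" "x \<in> W" for a x
    using W that module_homD(3)[OF f, of a x] by (metis imageI subsetD)
  ultimately show ?thesis using W module_homD(1)[OF f] by (auto simp: N.submodule_iff)
qed

lemma coset_module_hom:
  assumes M: "right_module A M" and N: "Module.submodule N A M"
  shows "(\<lambda>x. N +>\<^bsub>M\<^esub> x) \<in> module_hom A M (quot_module M N)"
proof -
  interpret right_module A M by fact
  show ?thesis by (intro module_homI) (simp_all add: quot_carrier[OF N] quot_add[OF N] quot_act[OF N])
qed

lemma (in abelian_monoid) finsum_swap:
  assumes "finite B" "finite C" "\<And>b c. \<lbrakk>b \<in> B; c \<in> C\<rbrakk> \<Longrightarrow> f b c \<in> carrier G"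
  shows "(\<Oplus>b\<in>B. \<Oplus>c\<in>C. f b c) = (\<Oplus>c\<in>C. \<Oplus>b\<in>B. f b c)"
  using assms(1,3)
proof (induction B rule: finite_induct)
  case (insert x B)
  have "(\<Oplus>b\<in>insert x B. \<Oplus>c\<in>C. f b c) = (\<Oplus>c\<in>C. f x c) \<oplus> (\<Oplus>b\<in>B. \<Oplus>c\<in>C. f b c)"
    using insert by (intro finsum_insert) (auto intro!: finsum_closed)
  also have "\<dots> = (\<Oplus>c\<in>C. f x c \<oplus> (\<Oplus>b\<in>B. f b c))"
    using insert by (subst finsum_addf) (auto intro!: finsum_closed)
  also have "\<dots> = (\<Oplus>c\<in>C. \<Oplus>b\<in>insert x B. f b c)"
    using insert by (intro finsum_cong') (auto intro!: finsum_closed finsum_insert[symmetric])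
  finally show ?case .
qed simp

section \<open>Congruences modulo a submodule\<close>

context right_module begin

lemma submodule_minus_commute:
  assumes "Module.submodule N A M" "x \<in> carrier M" "y \<in> carrier M" "x \<ominus> y \<in> N" shows "y \<ominus> x \<in> N"
  using submodule_neg[OF assms(1,4)] assms(2,3)
  by (simp add: a_minus_def M.minus_add M.minus_minus M.a_comm)

lemma submodule_minus_trans:
  assumes "Module.submodule N A M" "x \<in> carrier M" "y \<in> carrier M" "z \<in> carrier M" "x \<ominus> y \<in> N" "y \<ominus> z \<in> N"
  shows "x \<ominus> z \<in> N"
  using submodule_add[OF assms(1,5,6)] assms(2-4) by (simp add: a_minus_def M.a_assoc M.r_neg1)

lemma submodule_add_cong:
  assumes "Module.submodule N A M" "x \<in> carrier M" "y \<in> carrier M" "x' \<in> carrier M" "y' \<in> carrier M"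
    "x \<ominus> x' \<in> N" "y \<ominus> y' \<in> N"
  shows "(x \<oplus> y) \<ominus> (x' \<oplus> y') \<in> N"
  using submodule_add[OF assms(1,6,7)] assms(2-5) by (simp add: a_minus_def M.a_ac M.minus_add)

lemma submodule_finsum_cong:
  assumes N: "Module.submodule N A M" and "finite B" "\<And>b. b \<in> B \<Longrightarrow> f b \<in> carrier M" "\<And>b. b \<in> B \<Longrightarrow> g b \<in> carrier M"
    and "\<And>b. b \<in> B \<Longrightarrow> f b \<ominus> g b \<in> N"
  shows "(\<Oplus>b\<in>B. f b) \<ominus> (\<Oplus>b\<in>B. g b) \<in> N"
  using assms(2-)
proof (induction B rule: finite_induct)
  case empty
  then show ?case using submodule_zero[OF N] by (simp add: a_minus_def M.r_neg)
next
  case (insert x B)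
  then show ?case by (simp add: submodule_add_cong[OF N] M.finsum_closed Pi_iff)
qed

text \<open>Restricts a sum over all summands of the identity to a single block, once the foreign
  terms are known to lie in the radical or in its square.\<close>

lemma submodule_finsum_subset:
  assumes N: "Module.submodule N A M" and C: "finite C" "B \<subseteq> C" and f: "\<And>b. b \<in> C \<Longrightarrow> f b \<in> carrier M"
    and "\<And>b. b \<in> C - B \<Longrightarrow> f b \<in> N"
  shows "(\<Oplus>b\<in>C. f b) \<ominus> (\<Oplus>b\<in>B. f b) \<in> N"
proof -
  have "(\<Oplus>b\<in>C. f b) = (\<Oplus>b\<in>B \<union> (C - B). f b)" using C by (simp add: Un_absorb1)
  also have "\<dots> = (\<Oplus>b\<in>B. f b) \<oplus> (\<Oplus>b\<in>C - B. f b)"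
    using C f by (intro M.finsum_Un_disjoint) (auto intro: finite_subset)
  finally have "(\<Oplus>b\<in>C. f b) \<ominus> (\<Oplus>b\<in>B. f b) = (\<Oplus>b\<in>C - B. f b)"
    using C f by (simp add: a_minus_def M.finsum_closed Pi_iff M.a_comm M.r_neg1 M.r_neg2 subset_iff)
  then show ?thesis using submodule_finsum[OF N, of "C - B" f] C(1) assms(5) by auto
qed

end

text \<open>Stated for maps that are merely additive on \<open>N\<close>: in the application
  \<open>N\<close> is an \<open>F\<close>-subspace while the values lie in an
  \<open>A\<close>-module, so source and target are not modules over one ring.\<close>

lemma (in right_module) additive_finsum:
  assumes N: "Module.submodule N A M" and H: "abelian_monoid H" and cl: "\<And>x. x \<in> N \<Longrightarrow> f x \<in> carrier H"
    and add: "\<And>x y. \<lbrakk>x \<in> N; y \<in> N\<rbrakk> \<Longrightarrow> f (x \<oplus> y) = f x \<oplus>\<^bsub>H\<^esub> f y" and zero: "f \<zero> = \<zero>\<^bsub>H\<^esub>"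
    and B: "finite B" "\<And>b. b \<in> B \<Longrightarrow> y b \<in> N"
  shows "f (\<Oplus>b\<in>B. y b) = (\<Oplus>\<^bsub>H\<^esub>b\<in>B. f (y b))"
proof -
  interpret H: abelian_monoid H by fact
  show ?thesis
    using B
  proof (induction B rule: finite_induct)
    case (insert b B)
    then have "(\<Oplus>b\<in>B. y b) \<in> N" by (intro submodule_finsum[OF N]) auto
    moreover have "y b \<in> carrier M" "y \<in> B \<rightarrow> carrier M" using insert submodule_subset[OF N] by auto
    ultimately show ?case using insert cl by (simp add: add Pi_iff)
  qed (simp add: zero)
qed

text \<open>The homomorphism theorem for the surjection \<open>d\<close>. It lets a cocycle on a
  free module descend to the syzygy that the free module covers.\<close>

lemma module_hom_factor:
  assumes P: "right_module A P" and Z: "right_module A Z" and N: "right_module A N"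
    and d: "d \<in> module_hom A P Z" "d ` carrier P = carrier Z" and f: "f \<in> module_hom A P N"
    and ker: "\<And>y. \<lbrakk>y \<in> carrier P; d y = \<zero>\<^bsub>Z\<^esub>\<rbrakk> \<Longrightarrow> f y = \<zero>\<^bsub>N\<^esub>"
  shows "\<exists>g \<in> module_hom A Z N. \<forall>y \<in> carrier P. g (d y) = f y"
proof -
  interpret P: right_module A P by fact
  interpret Z: right_module A Z by fact
  interpret N: right_module A N by fact
  note hd = module_homD[OF d(1)] and hf = module_homD[OF f]
  \<comment> \<open>An arbitrary preimage is chosen; two of them differ by an element of the kernel
    of \<open>d\<close>, where \<open>f\<close> vanishes.\<close>
  define g where "g z = f (SOME y. y \<in> carrier P \<and> d y = z)" for z
  have g: "g (d y) = f y" if y: "y \<in> carrier P" for y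
  proof -
    define y' where "y' = (SOME y'. y' \<in> carrier P \<and> d y' = d y)"
    have y': "y' \<in> carrier P" "d y' = d y"
      using someI[of "\<lambda>y'. y' \<in> carrier P \<and> d y' = d y" y] y unfolding y'_def by blast+
    then have "d (y' \<ominus>\<^bsub>P\<^esub> y) = \<zero>\<^bsub>Z\<^esub>"
      using y hd(1) module_hom_minus[OF P Z d(1)] by (simp add: Z.M.minus_eq_zero_iff)
    then have "f y' \<ominus>\<^bsub>N\<^esub> f y = \<zero>\<^bsub>N\<^esub>"
      using y y'(1) ker module_hom_minus[OF P N f, symmetric] by simp
    then show ?thesis using y y'(1) hf(1) by (simp add: N.M.minus_eq_zero_iff g_def y'_def)
  qed
  have "g \<in> module_hom A Z N"
  proof (rule module_homI)
    fix z assume "z \<in> carrier Z"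
    then have "z \<in> d ` carrier P" by (simp only: d(2))
    then obtain y where y: "y \<in> carrier P" "z = d y" by blast
    then show "g z \<in> carrier N" using g hf(1) by simp
    show "g (a \<odot>\<^bsub>Z\<^esub> z) = a \<odot>\<^bsub>N\<^esub> g z" if a: "a \<in> carrier A" for a
      using a y g[of "a \<odot>\<^bsub>P\<^esub> y"] g hf(3) hd(3) by (simp add: P.act_closed)
    fix z' assume "z' \<in> carrier Z"
    then have "z' \<in> d ` carrier P" by (simp only: d(2))
    then obtain y' where y': "y' \<in> carrier P" "z' = d y'" by blast
    show "g (z \<oplus>\<^bsub>Z\<^esub> z') = g z \<oplus>\<^bsub>N\<^esub> g z'"
      using y y' g[of "y \<oplus>\<^bsub>P\<^esub> y'"] g hf(2) hd(2) by simp
  qed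
  with g show ?thesis by blast
qed

lemma (in right_module) sum_submodule:
  assumes N: "Module.submodule N A M" and N': "Module.submodule N' A M"
  shows "Module.submodule (N <+>\<^bsub>M\<^esub> N') A M"
proof -
  note N = submodule_subset[OF N] submodule_zero[OF N] submodule_add[OF N] submodule_act[OF N]
  note N' = submodule_subset[OF N'] submodule_zero[OF N'] submodule_add[OF N'] submodule_act[OF N']
  have S: "x \<in> N <+>\<^bsub>M\<^esub> N' \<longleftrightarrow> (\<exists>y\<in>N. \<exists>z\<in>N'. x = y \<oplus> z)" for x by (auto simp: set_add_def')
  show ?thesis
    unfolding submodule_iff
  proof (intro conjI ballI)
    show "N <+>\<^bsub>M\<^esub> N' \<subseteq> carrier M" using N(1) N'(1) by (auto simp: S subset_iff)
    show "\<zero> \<in> N <+>\<^bsub>M\<^esub> N'" using N(2) N'(2) by (force simp: S)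
    fix x assume "x \<in> N <+>\<^bsub>M\<^esub> N'"
    then obtain y z where x: "y \<in> N" "z \<in> N'" "x = y \<oplus> z" by (auto simp: S)
    have c: "y \<in> carrier M" "z \<in> carrier M" using x N(1) N'(1) by auto
    show "a \<odot> x \<in> N <+>\<^bsub>M\<^esub> N'" if a: "a \<in> carrier A" for a
      using act_add[OF a c] x N(4)[OF a] N'(4)[OF a] by (auto simp: S)
    fix x' assume "x' \<in> N <+>\<^bsub>M\<^esub> N'"
    then obtain y' z' where x': "y' \<in> N" "z' \<in> N'" "x' = y' \<oplus> z'" by (auto simp: S)
    have c': "y' \<in> carrier M" "z' \<in> carrier M" using x' N(1) N'(1) by auto
    have "x \<oplus> x' = (y \<oplus> y') \<oplus> (z \<oplus> z')" unfolding x(3) x'(3) using c c' by (simp add: M.a_ac)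
    then show "x \<oplus> x' \<in> N <+>\<^bsub>M\<^esub> N'" using N(3)[OF x(1) x'(1)] N'(3)[OF x(2) x'(2)] unfolding S by blast
  qed
qed

lemma (in right_module) submodule_of_submodule:
  assumes N: "Module.submodule N A M"
  shows "Module.submodule Y A (M\<lparr>carrier := N\<rparr>) \<longleftrightarrow> Module.submodule Y A M \<and> Y \<subseteq> N"
  using right_module.submodule_iff[OF submodule_right_module[OF N], of Y] submodule_subset[OF N] submodule_iff[of Y]
  by auto

text \<open>Restricting the carrier keeps the addition, but an inverse is described relative to the
  carrier. That the inclusion is a homomorphism gives the equality.\<close>

lemma (in right_module) submodule_minus_eq:
  assumes N: "Module.submodule N A M" and "x \<in> N" "y \<in> N"
  shows "x \<ominus>\<^bsub>M\<lparr>carrier := N\<rparr>\<^esub> y = x \<ominus> y"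
proof -
  have "(\<lambda>x. x) \<in> module_hom A (M\<lparr>carrier := N\<rparr>) M"
    using submodule_subset[OF N] by (intro module_homI) auto
  from module_hom_minus[OF submodule_right_module[OF N] right_module_axioms this] assms(2,3) show ?thesis by simp
qed

section \<open>Codimension and dual families\<close>

lemma regular_module_simps [simp]:
  "carrier (regular_module A) = carrier A" "zero (regular_module A) = zero A"
  "add (regular_module A) = add A" "x \<odot>\<^bsub>regular_module A\<^esub> y = y \<otimes>\<^bsub>A\<^esub> x"
  by (simp_all add: regular_module_def)

lemma regular_module_ops [simp]:
  "\<ominus>\<^bsub>regular_module A\<^esub> x = \<ominus>\<^bsub>A\<^esub> x" "x \<ominus>\<^bsub>regular_module A\<^esub> y = x \<ominus>\<^bsub>A\<^esub> y"
  "finsum (regular_module A) f B = finsum A f B"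
  by (simp_all add: a_minus_def a_inv_def m_inv_def finsum_def finprod_def)

lemma regular_right_module:
  assumes "ring A" shows "right_module A (regular_module A)"
proof -
  interpret A: ring A by fact
  show ?thesis
    by (intro right_module.intro right_module_axioms.intro abelian_groupI assms)
      (auto simp: A.a_ac A.l_distr A.r_distr A.m_assoc intro: bexI[of _ "\<ominus>\<^bsub>A\<^esub> _"] A.l_neg)
qed

text \<open>Commutativity of \<open>F\<close> absorbs the reversed order in \<open>act_mult\<close>.
  The results on submodules and quotients of right modules thereby apply to vector spaces.\<close>

lemma vectorspace_right_module:
  assumes "vectorspace F V" shows "right_module F V"
proof -
  interpret vectorspace F V by fact
  show ?thesis
    by (intro right_module.intro right_module_axioms.intro R.ring_axioms M.abelian_group_axioms)
      (auto simp: smult_l_distr smult_r_distr smult_assoc1[symmetric] R.m_comm)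
qed

lemma right_module_vectorspace:
  assumes "field F" "right_module F V" shows "vectorspace F V"
proof -
  interpret F: field F by fact
  interpret right_module F V by fact
  show ?thesis
    by (intro vectorspace.intro moduleI F.cring_axioms assms M.abelian_group_axioms)
      (auto simp: act_closed act_add act_add_scalar act_mult[symmetric] act_one F.m_comm)
qed

section \<open>Spans and a rank function on subspaces\<close>

context vectorspace begin

text \<open>Spans are submodules in the first sense, while the results on quotients are stated for
  the second.\<close>

lemma lc_submodule_iff: "LinearCombinations.submodule K W V \<longleftrightarrow> Module.submodule W K V"
proof
  assume W: "LinearCombinations.submodule K W V"
  show "Module.submodule W K V"
  proof (rule submoduleI)
    show "\<ominus>\<^bsub>V\<^esub> a \<in> W" if "a \<in> W" for a
      using LinearCombinations.submodule.smult_closed[OF W, of "\<ominus>\<^bsub>K\<^esub> \<one>\<^bsub>K\<^esub>" a] that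
        LinearCombinations.submodule.subset[OF W] by (auto simp: smult_l_minus subset_iff)
  qed (use LinearCombinations.submodule.subset[OF W] LinearCombinations.submodule.m_closed[OF W]
      LinearCombinations.submodule.zero_closed[OF W] LinearCombinations.submodule.smult_closed[OF W] in auto)
next
  assume W: "Module.submodule W K V"
  then have "\<zero>\<^bsub>V\<^esub> \<in> W" using subgroup.one_closed[OF Module.submodule.axioms(1)[OF W]] by simp
  with submoduleE[OF W] show "LinearCombinations.submodule K W V"
    by (intro LinearCombinations.submodule.intro module_axioms) auto
qed

lemma span_submodule: "S \<subseteq> carrier V \<Longrightarrow> Module.submodule (span S) K V"
  using span_is_submodule lc_submodule_iff by simp

lemma span_least: "S \<subseteq> W \<Longrightarrow> Module.submodule W K V \<Longrightarrow> span S \<subseteq> W"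
  using span_is_subset lc_submodule_iff by simp

text \<open>The rank of a set is the largest size of an independent subset. A strictly larger
  subspace contains a vector outside the span of such a subset, so the subset can be enlarged. The
  chain conditions below draw on boundedness and strict monotonicity alone.\<close>

lemma rank_exists:
  assumes "fin_dim"
  obtains r :: "'c set \<Rightarrow> nat" where "\<And>U. r U \<le> dim"
    "\<And>U U'. Module.submodule U K V \<Longrightarrow> Module.submodule U' K V \<Longrightarrow> U \<subset> U' \<Longrightarrow> r U < r U'"
proof
  define L where "L U = {card I | I. I \<subseteq> U \<inter> carrier V \<and> lin_indpt I}" for U
  define r where "r U = Max (L U)" for U
  have bound: "n \<le> dim" if "n \<in> L U" for n U using that li_le_dim(2)[OF assms] by (auto simp: L_def)
  then have fin: "finite (L U)" for U by (meson finite_nat_set_iff_bounded_le)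
  have ne: "L U \<noteq> {}" for U
  proof -
    have "lin_indpt {}" unfolding lin_dep_def by auto
    then show ?thesis unfolding L_def by blast
  qed
  have rin: "r U \<in> L U" for U unfolding r_def using fin ne by (rule Max_in)
  then show "r U \<le> dim" for U using bound by blast
  fix U U' assume U: "Module.submodule U K V" "Module.submodule U' K V" "U \<subset> U'"
  obtain I where I: "I \<subseteq> U \<inter> carrier V" "lin_indpt I" "r U = card I" using rin[of U] by (auto simp: L_def)
  obtain x where x: "x \<in> U'" "x \<notin> U" using U(3) by blast
  have xV: "x \<in> carrier V" using x(1) submoduleE(1)[OF U(2)] by blast
  have fI: "finite I" using li_le_dim(1)[OF assms] I by blast
  have "x \<notin> span I" using span_least[of I U] I(1) U(1) x(2) by blast
  then have "lin_indpt (I \<union> {x})"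
    using lin_dep_iff_in_span[of I x] I xV x(2) by blast
  then have "card (I \<union> {x}) \<in> L U'" unfolding L_def using I(1) x(1) xV U(3) by blast
  then have "card (I \<union> {x}) \<le> r U'" unfolding r_def using fin by (simp add: Max_ge)
  moreover have "card (I \<union> {x}) = Suc (card I)" using fI x(2) I(1) by (subst card_Un_disjoint) auto
  ultimately show "r U < r U'" using I(3) by simp
qed

end

text \<open>Vectors with biorthogonal functionals certify a codimension from both sides: the
  functionals make the vectors independent modulo their common kernel, and the vectors span modulo
  it.\<close>

definition dual_family ::
    "('f, 'k) ring_scheme \<Rightarrow> ('f, 'v) module \<Rightarrow> 'i set \<Rightarrow> ('i \<Rightarrow> 'v) \<Rightarrow> ('i \<Rightarrow> 'v \<Rightarrow> 'f) \<Rightarrow> bool" where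
  "dual_family F V I v c \<longleftrightarrow> (\<forall>i\<in>I. v i \<in> carrier V) \<and> (\<forall>i\<in>I. c i \<in> module_hom F V (regular_module F)) \<and>
    (\<forall>i\<in>I. \<forall>j\<in>I. c i (v j) = (if i = j then \<one>\<^bsub>F\<^esub> else \<zero>\<^bsub>F\<^esub>))"

lemma dual_familyD:
  assumes "dual_family F V I v c"
  shows "i \<in> I \<Longrightarrow> v i \<in> carrier V" "i \<in> I \<Longrightarrow> c i \<in> module_hom F V (regular_module F)"
    "i \<in> I \<Longrightarrow> j \<in> I \<Longrightarrow> c i (v j) = (if i = j then \<one>\<^bsub>F\<^esub> else \<zero>\<^bsub>F\<^esub>)"
  using assms unfolding dual_family_def by blast+

lemma dual_family_sum:
  fixes V :: "('f, 'v) module"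
  assumes V: "vectorspace F V" and d: "dual_family F V I v c" and I: "finite I" and i: "i \<in> I"
    and a: "a \<in> I \<rightarrow> carrier F"
  shows "c i (\<Oplus>\<^bsub>V\<^esub>j\<in>I. a j \<odot>\<^bsub>V\<^esub> v j) = a i"
proof -
  interpret vectorspace F V by fact
  note d = dual_familyD[OF d]
  have c: "\<And>x. x \<in> carrier V \<Longrightarrow> c i x \<in> carrier F" using module_homD(1)[OF d(2)[OF i]] by simp
  have "c i (\<Oplus>\<^bsub>V\<^esub>j\<in>I. a j \<odot>\<^bsub>V\<^esub> v j) = (\<Oplus>\<^bsub>regular_module F\<^esub>j\<in>I. c i (a j \<odot>\<^bsub>V\<^esub> v j))"
    using a d by (intro hom_finsum[OF vectorspace_right_module[OF V] regular_right_module d(2)] i I) (auto simp: R.ring_axioms)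
  also have "\<dots> = (\<Oplus>\<^bsub>F\<^esub>j\<in>I. c i (a j \<odot>\<^bsub>V\<^esub> v j))" by simp
  also have "\<dots> = (\<Oplus>\<^bsub>F\<^esub>j\<in>I. if i = j then a j else \<zero>\<^bsub>F\<^esub>)"
    using a d(1) module_homD(3)[OF d(2)[OF i]] d(3)[OF i]
    by (intro R.finsum_cong') (auto simp: Pi_iff)
  also have "\<dots> = a i" using R.add.finprod_singleton[OF i I, of a] a by (simp add: finsum_def)
  finally show ?thesis .
qed

context
  fixes F :: "('f, 'k) ring_scheme" and V :: "('f, 'v) module" and W
  assumes V: "vectorspace F V" and W: "Module.submodule W F V"
begin

interpretation V: vectorspace F V by (rule V)
interpretation VR: right_module F V by (rule vectorspace_right_module[OF V])

lemma quot_vectorspace: "vectorspace F (quot_module V W)"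
  by (rule right_module_vectorspace[OF V.field_axioms VR.quot_right_module[OF W]])

interpretation Q: vectorspace F "quot_module V W" by (rule quot_vectorspace)

lemma codim_le_card:
  assumes Y: "finite Y" "Y \<subseteq> carrier V" and sp: "\<And>x. x \<in> carrier V \<Longrightarrow> \<exists>y\<in>V.span Y. x \<ominus>\<^bsub>V\<^esub> y \<in> W"
  shows "Q.fin_dim" "codim F V W \<le> card Y"
proof -
  let ?q = "\<lambda>x. W +>\<^bsub>V\<^esub> x" and ?Q = "quot_module V W"
  note q = coset_module_hom[OF VR.right_module_axioms W]
  have qY: "?q ` Y \<subseteq> carrier ?Q" using Y(2) by (auto simp: VR.quot_carrier[OF W])
  note sub = submodule_vimage[OF VR.right_module_axioms VR.quot_right_module[OF W] q Q.span_submodule[OF qY]]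
  have "V.span Y \<subseteq> {x \<in> carrier V. ?q x \<in> Q.span (?q ` Y)}"
    using Y(2) Q.in_own_span[OF qY] by (intro V.span_least[OF _ sub]) auto
  moreover have "\<exists>y\<in>V.span Y. ?q x = ?q y" if "x \<in> carrier V" for x
    using sp[OF that] that V.span_closed[OF Y(2)] VR.coset_eq_iff[OF W] by blast
  ultimately have gen: "Q.gen_set (?q ` Y)"
    using Q.span_is_subset2[OF qY] unfolding VR.quot_carrier[OF W] by fastforce
  then show "Q.fin_dim" using Y(1) qY unfolding Q.fin_dim_def by blast
  have "codim F V W \<le> card (?q ` Y)" unfolding codim_def using Y(1) qY gen by (intro Q.gen_ge_dim) auto
  also have "\<dots> \<le> card Y" using Y(1) by (rule card_image_le)
  finally show "codim F V W \<le> card Y" .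
qed

text \<open>If a combination of the \<open>v i\<close> lies in \<open>W\<close>, the functionals,
  which vanish on \<open>W\<close>, return its coefficients as zero. Hence the cosets of the
  \<open>v i\<close> are independent.\<close>

lemma card_le_codim:
  assumes I: "finite I" and d: "dual_family F V I v c" and van: "\<And>i x. i \<in> I \<Longrightarrow> x \<in> W \<Longrightarrow> c i x = \<zero>\<^bsub>F\<^esub>"
    and fd: "Q.fin_dim"
  shows "card I \<le> codim F V W"
proof -
  let ?q = "\<lambda>x. W +>\<^bsub>V\<^esub> x" and ?Q = "quot_module V W"
  note q = coset_module_hom[OF VR.right_module_axioms W]
  note dd = dual_familyD[OF d]
  have rel: "\<forall>i\<in>I. a i = \<zero>\<^bsub>F\<^esub>" if a: "a \<in> I \<rightarrow> carrier F" and z: "(\<Oplus>\<^bsub>?Q\<^esub>i\<in>I. a i \<odot>\<^bsub>?Q\<^esub> ?q (v i)) = \<zero>\<^bsub>?Q\<^esub>" for a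
  proof -
    let ?x = "\<Oplus>\<^bsub>V\<^esub>i\<in>I. a i \<odot>\<^bsub>V\<^esub> v i"
    have "?q ?x = (\<Oplus>\<^bsub>?Q\<^esub>i\<in>I. ?q (a i \<odot>\<^bsub>V\<^esub> v i))"
      using a dd(1) by (intro hom_finsum[OF VR.right_module_axioms VR.quot_right_module[OF W] q I]) auto
    also have "\<dots> = (\<Oplus>\<^bsub>?Q\<^esub>i\<in>I. a i \<odot>\<^bsub>?Q\<^esub> ?q (v i))"
      using a dd(1) by (intro Q.M.finsum_cong') (auto simp: VR.quot_act[OF W] VR.quot_carrier[OF W] Pi_iff)
    finally have "?q ?x = \<zero>\<^bsub>?Q\<^esub>" using z by simp
    moreover have "?x \<in> carrier V" using a dd(1) by (intro V.M.finsum_closed) auto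
    ultimately have "?x \<in> W" by (simp add: VR.coset_eq_zero_iff[OF W])
    then show ?thesis using van dual_family_sum[OF V d I _ a] by metis
  qed
  \<comment> \<open>Independence is a property of the set of cosets, so distinct indices must give
    distinct cosets before they can be counted.\<close>
  have inj: "inj_on (\<lambda>i. ?q (v i)) I"
  proof (rule inj_onI)
    fix i j assume ij: "i \<in> I" "j \<in> I" "?q (v i) = ?q (v j)"
    then have "v i \<ominus>\<^bsub>V\<^esub> v j \<in> W" using VR.coset_eq_iff[OF W] dd(1) by simp
    then have "c i (v i \<ominus>\<^bsub>V\<^esub> v j) = \<zero>\<^bsub>F\<^esub>" using van ij by simp
    moreover have "c i (v i \<ominus>\<^bsub>V\<^esub> v j) = c i (v i) \<ominus>\<^bsub>F\<^esub> c i (v j)"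
      using module_hom_minus[OF VR.right_module_axioms regular_right_module[OF V.R.ring_axioms] dd(2)[OF ij(1)], of "v i" "v j"] dd(1) ij
      by simp
    ultimately show "i = j" using dd(3)[of i i] dd(3)[of i j] ij V.zero_not_one
      by (auto split: if_splits simp: a_minus_def V.R.minus_zero)
  qed
  have "Q.lin_indpt ((\<lambda>i. ?q (v i)) ` I)"
  proof (rule Q.finite_lin_indpt2)
    fix a assume a: "a \<in> (\<lambda>i. ?q (v i)) ` I \<rightarrow> carrier F" "Q.lincomb a ((\<lambda>i. ?q (v i)) ` I) = \<zero>\<^bsub>?Q\<^esub>"
    have "Q.lincomb a ((\<lambda>i. ?q (v i)) ` I) = (\<Oplus>\<^bsub>?Q\<^esub>i\<in>I. a (?q (v i)) \<odot>\<^bsub>?Q\<^esub> ?q (v i))"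
      unfolding Q.lincomb_def
    proof (rule Q.M.finsum_reindex[OF _ inj])
      have "?q (v i) \<in> carrier ?Q" if "i \<in> I" for i using that dd(1) by (auto simp: VR.quot_carrier[OF W])
      then show "(\<lambda>v. a v \<odot>\<^bsub>?Q\<^esub> v) \<in> (\<lambda>i. ?q (v i)) ` I \<rightarrow> carrier ?Q" using a(1) by (auto simp: Pi_iff)
    qed
    then have "\<forall>i\<in>I. a (?q (v i)) = \<zero>\<^bsub>F\<^esub>" using a by (intro rel) (auto simp: Pi_iff)
    then show "\<forall>x\<in>(\<lambda>i. ?q (v i)) ` I. a x = \<zero>\<^bsub>F\<^esub>" by blast
  qed (use I dd(1) in \<open>auto simp: VR.quot_carrier[OF W]\<close>)
  then have "card ((\<lambda>i. ?q (v i)) ` I) \<le> Q.dim"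
    using dd(1) by (intro Q.li_le_dim fd) (auto simp: VR.quot_carrier[OF W])
  then show ?thesis by (simp add: codim_def card_image[OF inj])
qed

end

lemma dual_family_kernel_submodule:
  fixes V :: "('f, 'v) module"
  assumes V: "vectorspace F V" and d: "\<And>i. i \<in> I \<Longrightarrow> c i \<in> module_hom F V (regular_module F)"
  shows "Module.submodule {x \<in> carrier V. \<forall>i\<in>I. c i x = \<zero>\<^bsub>F\<^esub>} F V"
proof -
  interpret V: vectorspace F V by (rule V)
  interpret VR: right_module F V by (rule vectorspace_right_module[OF V])
  note h = submodule_kernel[OF VR.right_module_axioms regular_right_module[OF V.R.ring_axioms] d]
  show ?thesis unfolding VR.submodule_iff
    using VR.submodule_zero[OF h] VR.submodule_add[OF h] VR.submodule_act[OF h] by (auto simp: VR.act_closed)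
qed

lemma codim_dual_family:
  fixes V :: "('f, 'v) module"
  assumes V: "vectorspace F V" and I: "finite I" and d: "dual_family F V I v c"
  shows "codim F V {x \<in> carrier V. \<forall>i\<in>I. c i x = \<zero>\<^bsub>F\<^esub>} = card I"
proof -
  interpret V: vectorspace F V by (rule V)
  interpret VR: right_module F V by (rule vectorspace_right_module[OF V])
  let ?W = "{x \<in> carrier V. \<forall>i\<in>I. c i x = \<zero>\<^bsub>F\<^esub>}"
  note dd = dual_familyD[OF d]
  have W: "Module.submodule ?W F V" by (rule dual_family_kernel_submodule[OF V dd(2)])
  have vI: "v ` I \<subseteq> carrier V" using dd(1) by auto
  have sp: "\<exists>y\<in>V.span (v ` I). x \<ominus>\<^bsub>V\<^esub> y \<in> ?W" if x: "x \<in> carrier V" for x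
  proof
    \<comment> \<open>The combination with coefficients \<open>c i x\<close> takes the same values
      as \<open>x\<close> under all the functionals.\<close>
    let ?y = "\<Oplus>\<^bsub>V\<^esub>i\<in>I. c i x \<odot>\<^bsub>V\<^esub> v i"
    have cx: "(\<lambda>i. c i x) \<in> I \<rightarrow> carrier F" using module_homD(1)[OF dd(2) x] by auto
    have y: "?y \<in> carrier V" using cx dd(1) by (intro V.M.finsum_closed) auto
    show "?y \<in> V.span (v ` I)"
      using V.in_own_span[OF vI] cx
      by (intro VR.submodule_finsum[OF V.span_submodule[OF vI] I]) (auto intro!: VR.submodule_act[OF V.span_submodule[OF vI]])
    have "c i (x \<ominus>\<^bsub>V\<^esub> ?y) = c i x \<ominus>\<^bsub>F\<^esub> c i ?y" if "i \<in> I" for i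
      using module_hom_minus[OF VR.right_module_axioms regular_right_module[OF V.R.ring_axioms] dd(2)[OF that] x y]
      by simp
    then have "c i (x \<ominus>\<^bsub>V\<^esub> ?y) = \<zero>\<^bsub>F\<^esub>" if "i \<in> I" for i
      using that dual_family_sum[OF V d I that cx] module_homD(1)[OF dd(2)[OF that] x]
      by (simp add: a_minus_def V.R.r_neg)
    then show "x \<ominus>\<^bsub>V\<^esub> ?y \<in> ?W" using x y by simp
  qed
  have "codim F V ?W \<le> card (v ` I)" using codim_le_card(2)[OF V W _ vI sp] I by simp
  also have "\<dots> \<le> card I" using I by (rule card_image_le)
  finally show ?thesis
    using card_le_codim[OF V W I d _ codim_le_card(1)[OF V W _ vI sp]] I by simp
qed


text \<open>The indexing set is a maximal subset of \<open>U\<close> that is linearly independent modulo \<open>W\<close>.\<close>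

lemma dual_family_exists:
  fixes V :: "('f, 'v) module"
  assumes V: "vectorspace F V" and fd: "vectorspace.fin_dim F V"
    and U: "Module.submodule U F V" and W: "Module.submodule W F V"
  obtains I c where "finite I" "I \<subseteq> U" "dual_family F (V\<lparr>carrier := U\<rparr>) I (\<lambda>i. i) c"
    "\<And>x. x \<in> U \<Longrightarrow> x \<in> W \<longleftrightarrow> (\<forall>i\<in>I. c i x = \<zero>\<^bsub>F\<^esub>)"
proof -
  interpret V: vectorspace F V by (rule V)
  interpret VR: right_module F V by (rule vectorspace_right_module[OF V])
  note Usub = VR.submodule_subset[OF U] and Wsub = VR.submodule_subset[OF W]
  \<comment> \<open>Independence modulo \<open>W\<close>. It implies ordinary independence, which
    bounds the size of \<open>I\<close> and makes a maximal choice possible.\<close>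
  define indep where "indep I \<longleftrightarrow> finite I \<and> I \<subseteq> U \<and>
    (\<forall>a \<in> I \<rightarrow> carrier F. V.lincomb a I \<in> W \<longrightarrow> (\<forall>i\<in>I. a i = \<zero>\<^bsub>F\<^esub>))" for I
  have "card I \<le> V.dim" if "indep I" for I
  proof (rule V.li_le_dim(2)[OF fd])
    show "I \<subseteq> carrier V" using that Usub by (auto simp: indep_def)
    then show "V.lin_indpt I"
      using that VR.submodule_zero[OF W] by (intro V.finite_lin_indpt2) (auto simp: indep_def)
  qed
  moreover have "indep {}" by (auto simp: indep_def)
  ultimately have "\<exists>I. finite I \<and> maximal I indep"
    by (intro maximal_exists[where B = "{}" and N = V.dim]) (auto simp: indep_def)
  then obtain I where I: "indep I" "\<And>J. indep J \<Longrightarrow> I \<subseteq> J \<Longrightarrow> J = I" by (auto simp: maximal_def)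
  then have fin: "finite I" and IU: "I \<subseteq> U" and IV: "I \<subseteq> carrier V" using Usub by (auto simp: indep_def)
  have lc: "V.lincomb a I \<in> carrier V" if "a \<in> I \<rightarrow> carrier F" for a using that IV by (rule_tac V.lincomb_closed)
  have uniq: "a i = b i" if a: "a \<in> I \<rightarrow> carrier F" and b: "b \<in> I \<rightarrow> carrier F" and x: "x \<in> carrier V"
    and i: "i \<in> I" and d: "x \<ominus>\<^bsub>V\<^esub> V.lincomb a I \<in> W" "x \<ominus>\<^bsub>V\<^esub> V.lincomb b I \<in> W" for a b x i
  proof -
    have "V.lincomb (\<lambda>i. b i \<ominus>\<^bsub>F\<^esub> a i) I = V.lincomb b I \<ominus>\<^bsub>V\<^esub> V.lincomb a I"
      using a b IV fin by (intro V.lincomb_diff) auto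
    also have "\<dots> = (x \<ominus>\<^bsub>V\<^esub> V.lincomb a I) \<ominus>\<^bsub>V\<^esub> (x \<ominus>\<^bsub>V\<^esub> V.lincomb b I)"
      using x lc[OF a] lc[OF b]
      by (simp add: a_minus_def V.M.minus_add V.M.minus_minus V.M.a_ac V.M.r_neg2)
    finally have "V.lincomb (\<lambda>i. b i \<ominus>\<^bsub>F\<^esub> a i) I \<in> W" using VR.submodule_minus[OF W d] by simp
    moreover have "(\<lambda>i. b i \<ominus>\<^bsub>F\<^esub> a i) \<in> I \<rightarrow> carrier F" using a b by auto
    ultimately have "b i \<ominus>\<^bsub>F\<^esub> a i = \<zero>\<^bsub>F\<^esub>" using I(1) i unfolding indep_def by blast
    then show ?thesis using a b i by (auto simp: Pi_iff)
  qed
  have ex: "\<exists>a \<in> I \<rightarrow> carrier F. x \<ominus>\<^bsub>V\<^esub> V.lincomb a I \<in> W" if x: "x \<in> U" for x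
  proof (cases "x \<in> I")
    case True
    let ?a = "\<lambda>i. if i = x then \<one>\<^bsub>F\<^esub> else \<zero>\<^bsub>F\<^esub>"
    have "V.lincomb ?a I = (\<Oplus>\<^bsub>V\<^esub>i\<in>I. if x = i then i else \<zero>\<^bsub>V\<^esub>)"
      unfolding V.lincomb_def using IV by (intro V.M.finsum_cong') auto
    also have "\<dots> = x" using V.M.add.finprod_singleton[OF True fin, of "\<lambda>i. i"] IV by (auto simp: finsum_def)
    finally have "x \<ominus>\<^bsub>V\<^esub> V.lincomb ?a I \<in> W"
      using x Usub VR.submodule_zero[OF W] by (auto simp: a_minus_def V.M.r_neg subset_iff)
    then show ?thesis by (intro bexI[of _ ?a]) auto
  next
    case False
    have xV: "x \<in> carrier V" using x Usub by auto
    \<comment> \<open>Maximality yields a relation modulo \<open>W\<close> on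
      \<open>insert x I\<close>. The coefficient of \<open>x\<close> is nonzero because
      \<open>I\<close> is independent modulo \<open>W\<close>, so the relation can be solved for
      \<open>x\<close>.\<close>
    have "\<not> indep (insert x I)" using I(2)[of "insert x I"] False by auto
    then obtain a i where a: "a \<in> insert x I \<rightarrow> carrier F" and aW: "V.lincomb a (insert x I) \<in> W"
      and i: "i \<in> insert x I" "a i \<noteq> \<zero>\<^bsub>F\<^esub>"
      using fin IU x unfolding indep_def by auto
    have aI: "a \<in> I \<rightarrow> carrier F" and ax: "a x \<in> carrier F" using a by auto
    have lci: "V.lincomb a (insert x I) = a x \<odot>\<^bsub>V\<^esub> x \<oplus>\<^bsub>V\<^esub> V.lincomb a I"
      using fin False a IV xV unfolding V.lincomb_def by (subst V.M.finsum_insert) auto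
    have ax0: "a x \<noteq> \<zero>\<^bsub>F\<^esub>"
    proof
      assume "a x = \<zero>\<^bsub>F\<^esub>"
      with lci aW lc[OF aI] xV have "V.lincomb a I \<in> W" by simp
      with I(1) aI have "\<forall>i\<in>I. a i = \<zero>\<^bsub>F\<^esub>" by (auto simp: indep_def)
      with i \<open>a x = \<zero>\<^bsub>F\<^esub>\<close> show False by auto
    qed
    then have inv: "inv\<^bsub>F\<^esub> (a x) \<in> carrier F" "inv\<^bsub>F\<^esub> (a x) \<otimes>\<^bsub>F\<^esub> a x = \<one>\<^bsub>F\<^esub>"
      using ax V.field_Units by (auto simp: V.R.Units_l_inv)
    let ?b = "\<lambda>i. (\<ominus>\<^bsub>F\<^esub> (inv\<^bsub>F\<^esub> (a x))) \<otimes>\<^bsub>F\<^esub> a i"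
    have b: "?b \<in> I \<rightarrow> carrier F" using aI inv by auto
    have "V.lincomb ?b I = (\<ominus>\<^bsub>F\<^esub> (inv\<^bsub>F\<^esub> (a x))) \<odot>\<^bsub>V\<^esub> V.lincomb a I"
      using IV aI inv by (intro V.lincomb_smult) auto
    then have "x \<ominus>\<^bsub>V\<^esub> V.lincomb ?b I = inv\<^bsub>F\<^esub> (a x) \<odot>\<^bsub>V\<^esub> (a x \<odot>\<^bsub>V\<^esub> x \<oplus>\<^bsub>V\<^esub> V.lincomb a I)"
      using inv lc[OF aI] ax xV
      by (simp add: V.smult_r_distr V.smult_assoc1[symmetric] V.smult_l_minus a_minus_def V.M.minus_minus)
    also have "\<dots> \<in> W" using VR.submodule_act[OF W inv(1)] aW lci by simp
    finally show ?thesis using b by blast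
  qed
  \<comment> \<open>Coordinates of \<open>x\<close> modulo \<open>W\<close> are chosen, but
    \<open>uniq\<close> determines them on \<open>I\<close>. Linearity then follows by exhibiting
    coordinates of sums and multiples.\<close>
  define co where "co x = (SOME a. a \<in> I \<rightarrow> carrier F \<and> x \<ominus>\<^bsub>V\<^esub> V.lincomb a I \<in> W)" for x
  have co: "co x \<in> I \<rightarrow> carrier F" "x \<ominus>\<^bsub>V\<^esub> V.lincomb (co x) I \<in> W" if "x \<in> U" for x
    using someI_ex[OF ex[OF that, unfolded Bex_def]] unfolding co_def by blast+
  have coI: "co x i = a i" if "x \<in> U" "a \<in> I \<rightarrow> carrier F" "x \<ominus>\<^bsub>V\<^esub> V.lincomb a I \<in> W" "i \<in> I" for x a i
    using uniq[OF co(1)[OF that(1)] that(2) _ that(4) co(2)[OF that(1)] that(3)] Usub that(1) by blast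
  define c where "c i x = co x i" for i x
  note UO = VR.submodule_add[OF U] VR.submodule_act[OF U]
  have hom: "c i \<in> module_hom F (V\<lparr>carrier := U\<rparr>) (regular_module F)" if i: "i \<in> I" for i
  proof (rule module_homI; simp)
    fix x assume x: "x \<in> U"
    then have xV: "x \<in> carrier V" using Usub by auto
    show "c i x \<in> carrier F" using co(1)[OF x] i by (auto simp: c_def)
    { fix y assume y: "y \<in> U"
      then have yV: "y \<in> carrier V" using Usub by auto
      have "V.lincomb (\<lambda>i. co x i \<oplus>\<^bsub>F\<^esub> co y i) I = V.lincomb (co x) I \<oplus>\<^bsub>V\<^esub> V.lincomb (co y) I"
        using co(1) x y IV fin by (intro V.lincomb_sum) auto
      then have "(x \<oplus>\<^bsub>V\<^esub> y) \<ominus>\<^bsub>V\<^esub> V.lincomb (\<lambda>i. co x i \<oplus>\<^bsub>F\<^esub> co y i) I =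
          (x \<ominus>\<^bsub>V\<^esub> V.lincomb (co x) I) \<oplus>\<^bsub>V\<^esub> (y \<ominus>\<^bsub>V\<^esub> V.lincomb (co y) I)"
        using xV yV lc co(1) x y by (simp add: a_minus_def V.M.minus_add V.M.a_ac)
      also have "\<dots> \<in> W" using co(2) x y VR.submodule_add[OF W] by simp
      finally show "c i (x \<oplus>\<^bsub>V\<^esub> y) = c i x \<oplus>\<^bsub>F\<^esub> c i y"
        unfolding c_def using co(1) x y i by (intro coI) (auto simp: UO) }
    fix a assume a: "a \<in> carrier F"
    have "V.lincomb (\<lambda>i. a \<otimes>\<^bsub>F\<^esub> co x i) I = a \<odot>\<^bsub>V\<^esub> V.lincomb (co x) I"
      using co(1) x a IV by (intro V.lincomb_smult) auto
    then have "(a \<odot>\<^bsub>V\<^esub> x) \<ominus>\<^bsub>V\<^esub> V.lincomb (\<lambda>i. a \<otimes>\<^bsub>F\<^esub> co x i) I = a \<odot>\<^bsub>V\<^esub> (x \<ominus>\<^bsub>V\<^esub> V.lincomb (co x) I)"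
      using xV lc co(1) x a by (simp add: VR.act_minus)
    also have "\<dots> \<in> W" using co(2) x a VR.submodule_act[OF W] by simp
    finally have "c i (a \<odot>\<^bsub>V\<^esub> x) = a \<otimes>\<^bsub>F\<^esub> c i x"
      unfolding c_def using co(1) x i a by (intro coI) (auto simp: UO)
    then show "c i (a \<odot>\<^bsub>V\<^esub> x) = c i x \<otimes>\<^bsub>F\<^esub> a" using a \<open>c i x \<in> carrier F\<close> by (simp add: V.R.m_comm)
  qed
  have dual: "c i j = (if i = j then \<one>\<^bsub>F\<^esub> else \<zero>\<^bsub>F\<^esub>)" if ij: "i \<in> I" "j \<in> I" for i j
  proof -
    let ?a = "\<lambda>i. if i = j then \<one>\<^bsub>F\<^esub> else \<zero>\<^bsub>F\<^esub>"
    have "V.lincomb ?a I = (\<Oplus>\<^bsub>V\<^esub>i\<in>I. if j = i then i else \<zero>\<^bsub>V\<^esub>)"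
      unfolding V.lincomb_def using IV by (intro V.M.finsum_cong') auto
    also have "\<dots> = j" using V.M.add.finprod_singleton[OF ij(2) fin, of "\<lambda>i. i"] IV by (auto simp: finsum_def)
    finally have "j \<ominus>\<^bsub>V\<^esub> V.lincomb ?a I \<in> W"
      using ij IV VR.submodule_zero[OF W] by (auto simp: a_minus_def V.M.r_neg subset_iff)
    then show ?thesis unfolding c_def using ij IU by (subst coI[of _ ?a]) auto
  qed
  show thesis
  proof
    show "finite I" "I \<subseteq> U" by fact+
    show "dual_family F (V\<lparr>carrier := U\<rparr>) I (\<lambda>i. i) c" unfolding dual_family_def using IU hom dual by auto
    fix x assume x: "x \<in> U"
    then have xV: "x \<in> carrier V" using Usub by auto
    have z: "V.lincomb (\<lambda>_. \<zero>\<^bsub>F\<^esub>) I = \<zero>\<^bsub>V\<^esub>"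
    proof -
      have "V.lincomb (\<lambda>_. \<zero>\<^bsub>F\<^esub>) I = (\<Oplus>\<^bsub>V\<^esub>i\<in>I. \<zero>\<^bsub>V\<^esub>)"
        unfolding V.lincomb_def using IV by (intro V.M.finsum_cong') auto
      then show ?thesis by simp
    qed
    have x0: "x \<ominus>\<^bsub>V\<^esub> \<zero>\<^bsub>V\<^esub> = x" using xV by (simp add: a_minus_def)
    show "x \<in> W \<longleftrightarrow> (\<forall>i\<in>I. c i x = \<zero>\<^bsub>F\<^esub>)"
    proof
      assume "x \<in> W"
      then show "\<forall>i\<in>I. c i x = \<zero>\<^bsub>F\<^esub>" unfolding c_def using coI[OF x, of "\<lambda>_. \<zero>\<^bsub>F\<^esub>"] z x0 by simp
    next
      assume "\<forall>i\<in>I. c i x = \<zero>\<^bsub>F\<^esub>"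
      then have "V.lincomb (co x) I = V.lincomb (\<lambda>_. \<zero>\<^bsub>F\<^esub>) I"
        unfolding V.lincomb_def c_def using IV by (intro V.M.finsum_cong') auto
      then show "x \<in> W" using co(2)[OF x] z x0 by simp
    qed
  qed
qed

text \<open>Functionals that cut out \<open>W'\<close> vanish on the smaller \<open>W\<close>, so
  the vectors dual to them remain independent modulo \<open>W\<close>.\<close>

lemma codim_antimono:
  fixes V :: "('f, 'v) module"
  assumes V: "vectorspace F V" and fd: "vectorspace.fin_dim F V"
    and W: "Module.submodule W F V" and W': "Module.submodule W' F V" and sub: "W \<subseteq> W'"
  shows "codim F V W' \<le> codim F V W"
proof -
  interpret V: vectorspace F V by (rule V)
  interpret VR: right_module F V by (rule vectorspace_right_module[OF V])
  have "Module.submodule (carrier V) F V" by (simp add: VR.submodule_iff)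
  then obtain I c where I: "finite I" "I \<subseteq> carrier V" "dual_family F V I (\<lambda>i. i) c"
    "\<And>x. x \<in> carrier V \<Longrightarrow> x \<in> W' \<longleftrightarrow> (\<forall>i\<in>I. c i x = \<zero>\<^bsub>F\<^esub>)"
    using dual_family_exists[OF V fd _ W', of "carrier V"] by auto
  have "W' = {x \<in> carrier V. \<forall>i\<in>I. c i x = \<zero>\<^bsub>F\<^esub>}" using I(4) VR.submodule_subset[OF W'] by blast
  then have "codim F V W' = card I" using codim_dual_family[OF V I(1,3)] by simp
  also have "\<dots> \<le> codim F V W"
  proof (rule card_le_codim[OF V W I(1,3)])
    show "c i x = \<zero>\<^bsub>F\<^esub>" if "i \<in> I" "x \<in> W" for i x
      using that I(4) sub VR.submodule_subset[OF W] by blast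
    obtain Y where Y: "finite Y" "Y \<subseteq> carrier V" "V.span Y = carrier V" using fd V.fin_dim_def by auto
    have "\<exists>y\<in>V.span Y. x \<ominus>\<^bsub>V\<^esub> y \<in> W" if "x \<in> carrier V" for x
      using that Y(3) VR.submodule_zero[OF W] by (intro bexI[of _ x]) (auto simp: a_minus_def V.M.r_neg)
    then show "vectorspace.fin_dim F (quot_module V W)" using codim_le_card(1)[OF V W Y(1,2)] by simp
  qed
  finally show ?thesis .
qed

text \<open>Subtracting from \<open>x\<close> the combination of the \<open>v i\<close> with
  coefficients \<open>c i x\<close> leaves an element of the common kernel.\<close>

lemma dual_family_generates:
  fixes V :: "('f, 'v) module"
  assumes V: "vectorspace F V" and I: "finite I" and d: "dual_family F V I v c"
    and U: "Module.submodule U F V" and ker: "\<And>x. \<lbrakk>x \<in> carrier V; \<forall>i\<in>I. c i x = \<zero>\<^bsub>F\<^esub>\<rbrakk> \<Longrightarrow> x \<in> U"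
    and v: "\<And>i. i \<in> I \<Longrightarrow> v i \<in> U" and x: "x \<in> carrier V"
  shows "x \<in> U"
proof -
  interpret V: vectorspace F V by (rule V)
  interpret VR: right_module F V by (rule vectorspace_right_module[OF V])
  note dd = dual_familyD[OF d]
  let ?y = "\<Oplus>\<^bsub>V\<^esub>i\<in>I. c i x \<odot>\<^bsub>V\<^esub> v i"
  have cx: "(\<lambda>i. c i x) \<in> I \<rightarrow> carrier F" using module_homD(1)[OF dd(2) x] by auto
  have y: "?y \<in> U" using cx v by (intro VR.submodule_finsum[OF U I]) (auto intro!: VR.submodule_act[OF U])
  then have yV: "?y \<in> carrier V" using VR.submodule_subset[OF U] by blast
  have "c i (x \<ominus>\<^bsub>V\<^esub> ?y) = \<zero>\<^bsub>F\<^esub>" if "i \<in> I" for i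
    using module_hom_minus[OF VR.right_module_axioms regular_right_module[OF V.R.ring_axioms] dd(2)[OF that] x yV]
      dual_family_sum[OF V d I that cx] module_homD(1)[OF dd(2)[OF that] x] by (simp add: a_minus_def V.R.r_neg)
  then have "x \<ominus>\<^bsub>V\<^esub> ?y \<in> U" using x yV by (intro ker) auto
  then show ?thesis by (rule VR.submodule_minus_cancel[OF U x _ y])
qed

section \<open>Simple modules and the Jacobson radical\<close>

lemma module_iso_inverse:
  assumes M: "right_module A M" and f: "f \<in> module_hom A M N" "bij_betw f (carrier M) (carrier N)"
  shows "the_inv_into (carrier M) f \<in> module_hom A N M"
proof -
  interpret M: right_module A M by fact
  have inj: "inj_on f (carrier M)" and im: "f ` carrier M = carrier N" using f(2) by (auto simp: bij_betw_def)
  note h = module_homD[OF f(1)]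
  have inv: "the_inv_into (carrier M) f (f x) = x" if "x \<in> carrier M" for x
    using that inj by (simp add: the_inv_into_f_f)
  show ?thesis
  proof (rule module_homI)
    fix x assume "x \<in> carrier N"
    then obtain x' where x: "x' \<in> carrier M" "x = f x'" using im by auto
    then show "the_inv_into (carrier M) f x \<in> carrier M" by (simp add: inv)
    show "the_inv_into (carrier M) f (a \<odot>\<^bsub>N\<^esub> x) = a \<odot>\<^bsub>M\<^esub> the_inv_into (carrier M) f x" if "a \<in> carrier A" for a
      using that x by (simp add: h(3)[symmetric] inv M.act_closed)
    fix y assume "y \<in> carrier N"
    then obtain y' where y: "y' \<in> carrier M" "y = f y'" using im by auto
    show "the_inv_into (carrier M) f (x \<oplus>\<^bsub>N\<^esub> y) =
        the_inv_into (carrier M) f x \<oplus>\<^bsub>M\<^esub> the_inv_into (carrier M) f y"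
      using x y by (simp add: h(2)[symmetric] inv)
  qed
qed

lemma module_hom_comp:
  assumes "f \<in> module_hom A L M" "g \<in> module_hom A M N"
  shows "(\<lambda>x. g (f x)) \<in> module_hom A L N"
  using assms by (intro module_homI) (simp_all add: module_homD[OF assms(1)] module_homD[OF assms(2)])

lemma (in right_module) act_hom: "x \<in> carrier M \<Longrightarrow> (\<lambda>a. a \<odot> x) \<in> module_hom A (regular_module A) M"
  by (intro module_homI) (simp_all add: act_closed act_add_scalar act_mult)

lemma simple_moduleD:
  assumes "simple_module A M"
  shows "right_module A M" "carrier M \<noteq> {\<zero>\<^bsub>M\<^esub>}"
    "Module.submodule N A M \<Longrightarrow> N = {\<zero>\<^bsub>M\<^esub>} \<or> N = carrier M"
  using assms unfolding simple_module_def by blast+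

lemma simple_module_image:
  assumes M: "simple_module A M" and R: "Module.submodule R A (regular_module A)"
    and "x \<in> carrier M" "r \<in> R" "r \<odot>\<^bsub>M\<^esub> x \<noteq> \<zero>\<^bsub>M\<^esub>"
  shows "(\<lambda>a. a \<odot>\<^bsub>M\<^esub> x) ` R = carrier M"
proof -
  interpret right_module A M by (rule simple_moduleD(1)[OF M])
  have "Module.submodule ((\<lambda>a. a \<odot>\<^bsub>M\<^esub> x) ` R) A M"
    using submodule_image[OF regular_right_module[OF A.ring_axioms] right_module_axioms act_hom[OF assms(3)] R] .
  with simple_moduleD(3)[OF M this] assms(4,5) show ?thesis by blast
qed

lemma (in ring) right_ideal_carrier: "Module.submodule (carrier R) R (regular_module R)"
  using right_module.submodule_iff[OF regular_right_module[OF ring_axioms]] by simp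

lemma simple_module_cyclic:
  assumes M: "simple_module A M" and x: "x \<in> carrier M" "x \<noteq> \<zero>\<^bsub>M\<^esub>"
  shows "(\<lambda>a. a \<odot>\<^bsub>M\<^esub> x) ` carrier A = carrier M"
proof -
  interpret right_module A M by (rule simple_moduleD(1)[OF M])
  show ?thesis using simple_module_image[OF M A.right_ideal_carrier x(1) A.one_closed] x by (simp add: act_one)
qed

text \<open>Sending \<open>x a\<close> to \<open>y a\<close> is well defined once every annihilator
  of \<open>x\<close> annihilates \<open>y\<close>. Maps between simple modules are produced in this
  way below.\<close>

lemma cyclic_module_hom:
  assumes M: "right_module A M" and N: "right_module A N" and x: "x \<in> carrier M" and y: "y \<in> carrier N"
    and gen: "(\<lambda>a. a \<odot>\<^bsub>M\<^esub> x) ` carrier A = carrier M"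
    and ann: "\<And>a. \<lbrakk>a \<in> carrier A; a \<odot>\<^bsub>M\<^esub> x = \<zero>\<^bsub>M\<^esub>\<rbrakk> \<Longrightarrow> a \<odot>\<^bsub>N\<^esub> y = \<zero>\<^bsub>N\<^esub>"
  shows "\<exists>f \<in> module_hom A M N. \<forall>a \<in> carrier A. f (a \<odot>\<^bsub>M\<^esub> x) = a \<odot>\<^bsub>N\<^esub> y"
proof -
  interpret M: right_module A M by fact
  interpret N: right_module A N by fact
  define f where "f z = (SOME a. a \<in> carrier A \<and> a \<odot>\<^bsub>M\<^esub> x = z) \<odot>\<^bsub>N\<^esub> y" for z
  have f: "f (a \<odot>\<^bsub>M\<^esub> x) = a \<odot>\<^bsub>N\<^esub> y" if a: "a \<in> carrier A" for a
  proof -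
    define b where "b = (SOME b. b \<in> carrier A \<and> b \<odot>\<^bsub>M\<^esub> x = a \<odot>\<^bsub>M\<^esub> x)"
    have b: "b \<in> carrier A" "b \<odot>\<^bsub>M\<^esub> x = a \<odot>\<^bsub>M\<^esub> x"
      using someI[of "\<lambda>b. b \<in> carrier A \<and> b \<odot>\<^bsub>M\<^esub> x = a \<odot>\<^bsub>M\<^esub> x" a] a unfolding b_def by blast+
    then have "(b \<ominus>\<^bsub>A\<^esub> a) \<odot>\<^bsub>M\<^esub> x = \<zero>\<^bsub>M\<^esub>"
      using a x by (simp add: M.act_minus_scalar M.M.minus_eq_zero_iff M.act_closed)
    then have "(b \<ominus>\<^bsub>A\<^esub> a) \<odot>\<^bsub>N\<^esub> y = \<zero>\<^bsub>N\<^esub>" using a b by (intro ann) auto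
    then have "b \<odot>\<^bsub>N\<^esub> y = a \<odot>\<^bsub>N\<^esub> y"
      using a b y by (simp add: N.act_minus_scalar N.M.minus_eq_zero_iff N.act_closed)
    then show ?thesis unfolding f_def b_def .
  qed
  have "f \<in> module_hom A M N"
  proof (rule module_homI)
    fix z assume "z \<in> carrier M"
    then obtain a where a: "a \<in> carrier A" "z = a \<odot>\<^bsub>M\<^esub> x" using gen by auto
    then show "f z \<in> carrier N" using y by (simp add: f N.act_closed)
    show "f (b \<odot>\<^bsub>M\<^esub> z) = b \<odot>\<^bsub>N\<^esub> f z" if "b \<in> carrier A" for b
      using a that f[of "a \<otimes>\<^bsub>A\<^esub> b"] x y by (simp add: f M.act_mult N.act_mult)
    fix z' assume "z' \<in> carrier M"
    then obtain a' where a': "a' \<in> carrier A" "z' = a' \<odot>\<^bsub>M\<^esub> x" using gen by auto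
    show "f (z \<oplus>\<^bsub>M\<^esub> z') = f z \<oplus>\<^bsub>N\<^esub> f z'"
      using a a' f[of "a \<oplus>\<^bsub>A\<^esub> a'"] x y by (simp add: f M.act_add_scalar N.act_add_scalar)
  qed
  with f show ?thesis by blast
qed

text \<open>Schur's lemma: kernel and image are submodules of simple modules, and one nonzero value
  decides which.\<close>

lemma schur_iso:
  assumes M: "simple_module A M" and N: "simple_module A N" and f: "f \<in> module_hom A M N"
    and x: "x \<in> carrier M" "f x \<noteq> \<zero>\<^bsub>N\<^esub>"
  shows "module_iso A M N"
proof -
  interpret M: right_module A M by (rule simple_moduleD(1)[OF M])
  interpret N: right_module A N by (rule simple_moduleD(1)[OF N])
  have "Module.submodule (carrier M) A M" by (simp add: M.submodule_iff M.act_closed)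
  from simple_moduleD(3)[OF N submodule_image[OF M.right_module_axioms N.right_module_axioms f this]] x
  have surj: "f ` carrier M = carrier N" by blast
  from simple_moduleD(3)[OF M submodule_kernel[OF M.right_module_axioms N.right_module_axioms f]] x
  have ker: "{z \<in> carrier M. f z = \<zero>\<^bsub>N\<^esub>} = {\<zero>\<^bsub>M\<^esub>}" by blast
  have "inj_on f (carrier M)"
  proof (rule inj_onI)
    fix y z assume yz: "y \<in> carrier M" "z \<in> carrier M" "f y = f z"
    then have "f (y \<ominus>\<^bsub>M\<^esub> z) = \<zero>\<^bsub>N\<^esub>"
      using module_hom_minus[OF M.right_module_axioms N.right_module_axioms f] module_homD(1)[OF f]
      by (simp add: a_minus_def N.M.r_neg)
    then have "y \<ominus>\<^bsub>M\<^esub> z \<in> {z \<in> carrier M. f z = \<zero>\<^bsub>N\<^esub>}" using yz by simp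
    then show "y = z" using yz ker M.M.minus_eq_zero_iff by simp
  qed
  with surj f show ?thesis unfolding module_iso_def bij_betw_def by blast
qed

text \<open>Correspondence of submodules: a submodule of the quotient is the image of its preimage,
  and the preimage contains \<open>N\<close>.\<close>

lemma quot_module_simple:
  assumes M: "right_module A M" and N: "Module.submodule N A M" "N \<noteq> carrier M"
    and max: "\<And>Y. \<lbrakk>Module.submodule Y A M; N \<subseteq> Y\<rbrakk> \<Longrightarrow> Y = N \<or> Y = carrier M"
  shows "simple_module A (quot_module M N)"
  unfolding simple_module_def
proof (intro conjI allI impI)
  interpret right_module A M by fact
  note q = coset_module_hom[OF M N(1)] and c = quot_carrier[OF N(1)]
  let ?Q = "quot_module M N"
  show Q: "right_module A ?Q" by (rule quot_right_module[OF N(1)])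
  obtain x where "x \<in> carrier M" "x \<notin> N" using N submodule_subset by blast
  then show "carrier ?Q \<noteq> {\<zero>\<^bsub>?Q\<^esub>}" using c coset_eq_zero_iff[OF N(1), of x] by auto
  fix X assume X: "Module.submodule X A ?Q"
  let ?Y = "{x \<in> carrier M. N +>\<^bsub>M\<^esub> x \<in> X}"
  have XY: "X = (\<lambda>x. N +>\<^bsub>M\<^esub> x) ` ?Y" using right_module.submodule_subset[OF Q X] c by auto
  have zero: "N +>\<^bsub>M\<^esub> x = \<zero>\<^bsub>?Q\<^esub>" if "x \<in> N" for x
    using that submodule_subset[OF N(1)] coset_eq_zero_iff[OF N(1)] by blast
  have "N \<subseteq> ?Y" using submodule_subset[OF N(1)] zero right_module.submodule_zero[OF Q X] by auto
  with max[OF submodule_vimage[OF M Q q X]] consider "?Y = N" | "?Y = carrier M" by blast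
  then show "X = {\<zero>\<^bsub>?Q\<^esub>} \<or> X = carrier ?Q"
  proof cases
    case 1
    then have "X \<subseteq> {\<zero>\<^bsub>?Q\<^esub>}" using XY zero by (metis (no_types, lifting) image_subsetI singletonI)
    then show ?thesis using right_module.submodule_zero[OF Q X] by blast
  qed (use XY c in simp)
qed

lemma annihilator_maximal:
  assumes M: "simple_module A M" and x: "x \<in> carrier M" "x \<noteq> \<zero>\<^bsub>M\<^esub>"
  shows "maximal_right_ideal A {a \<in> carrier A. a \<odot>\<^bsub>M\<^esub> x = \<zero>\<^bsub>M\<^esub>}"
  unfolding maximal_right_ideal_def
proof (intro conjI allI impI)
  interpret right_module A M by (rule simple_moduleD(1)[OF M])
  interpret R: right_module A "regular_module A" by (rule regular_right_module[OF A.ring_axioms])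
  let ?I = "{a \<in> carrier A. a \<odot>\<^bsub>M\<^esub> x = \<zero>\<^bsub>M\<^esub>}"
  show I: "Module.submodule ?I A (regular_module A)"
    using submodule_kernel[OF R.right_module_axioms right_module_axioms act_hom[OF x(1)]] by simp
  have "\<one>\<^bsub>A\<^esub> \<notin> ?I" using act_one[OF x(1)] x(2) by simp
  then show "?I \<noteq> carrier A" using A.one_closed by blast
  fix L assume L: "Module.submodule L A (regular_module A) \<and> ?I \<subseteq> L"
  show "L = ?I \<or> L = carrier A"
  proof (cases "\<exists>r\<in>L. r \<odot>\<^bsub>M\<^esub> x \<noteq> \<zero>\<^bsub>M\<^esub>")
    case True
    \<comment> \<open>An element of \<open>L\<close> that does not annihilate \<open>x\<close> makes
      \<open>x L\<close> the whole module. Every \<open>x a\<close> is then some \<open>x b\<close>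
      with \<open>b\<close> in \<open>L\<close>, and \<open>a - b\<close> annihilates
      \<open>x\<close>, hence lies in \<open>L\<close>.\<close>
    then have im: "(\<lambda>a. a \<odot>\<^bsub>M\<^esub> x) ` L = carrier M" using simple_module_image[OF M _ x(1)] L by blast
    have "a \<in> L" if a: "a \<in> carrier A" for a
    proof -
      have "a \<odot>\<^bsub>M\<^esub> x \<in> (\<lambda>a. a \<odot>\<^bsub>M\<^esub> x) ` L" unfolding im using a x by (simp add: act_closed)
      then obtain b where b: "b \<in> L" "a \<odot>\<^bsub>M\<^esub> x = b \<odot>\<^bsub>M\<^esub> x" by auto
      have bA: "b \<in> carrier A" using b R.submodule_subset[of L] L by auto
      have "a \<ominus>\<^bsub>A\<^esub> b \<in> ?I" using a b bA x by (simp add: act_minus_scalar M.minus_eq_zero_iff act_closed)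
      then show ?thesis using R.submodule_minus_cancel[of L a b] L a b by auto
    qed
    then show ?thesis using R.submodule_subset[of L] L by auto
  next
    case False
    then show ?thesis using R.submodule_subset[of L] L by auto
  qed
qed

lemma jacobson_annihilates:
  assumes "simple_module A M" "x \<in> carrier M" "a \<in> jacobson_radical A"
  shows "a \<odot>\<^bsub>M\<^esub> x = \<zero>\<^bsub>M\<^esub>"
proof (cases "x = \<zero>\<^bsub>M\<^esub>")
  case True
  interpret right_module A M by (rule simple_moduleD(1)[OF assms(1)])
  show ?thesis using True assms(3) by (simp add: act_zero jacobson_radical_def)
next
  case False
  from annihilator_maximal[OF assms(1,2) this] assms(3) show ?thesis by (auto simp: jacobson_radical_def)
qed

section \<open>Radical and idempotents of a split algebra\<close>

locale split_algebra = assoc_algebra F A for F :: "('f, 'k) ring_scheme" and A :: "('f, 'a) module" (structure) +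
  fixes S :: "nat \<Rightarrow> ('a, 'm) module"
  assumes fin: "fin_dim"
    and simple: "\<And>i. i < \<ell> A \<Longrightarrow> simple_module A (S i)"
    and noniso: "\<And>i j. i < \<ell> A \<Longrightarrow> j < \<ell> A \<Longrightarrow> i \<noteq> j \<Longrightarrow> \<not> module_iso A (S i) (S j)"
    and complete: "\<And>T :: ('a, 'a set) module. simple_module A T \<Longrightarrow> \<exists>i<\<ell> A. module_iso A T (S i)"
    and split: "splitting_field F A"
begin

sublocale reg: right_module A "regular_module A" by (rule regular_right_module[OF A.ring_axioms])

abbreviation J where "J \<equiv> jacobson_radical A"

abbreviation right_ideal where "right_ideal I \<equiv> Module.submodule I A (regular_module A)"

lemma S_module: "i < \<ell> A \<Longrightarrow> right_module A (S i)"
  using simple_moduleD(1)[OF simple] .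

text \<open>A maximal right ideal \<open>I\<close> is the annihilator of the coset of
  \<open>\<one>\<close> in \<open>A/I\<close>, a simple module isomorphic to some
  \<open>S i\<close>. In this description closure under left multiplication becomes evident.\<close>

lemma jacobson_eq: "J = {a \<in> carrier A. \<forall>i<\<ell> A. \<forall>s \<in> carrier (S i). a \<odot>\<^bsub>S i\<^esub> s = \<zero>\<^bsub>S i\<^esub>}"
proof (intro Set.equalityI subsetI)
  fix a assume "a \<in> J"
  then show "a \<in> {a \<in> carrier A. \<forall>i<\<ell> A. \<forall>s \<in> carrier (S i). a \<odot>\<^bsub>S i\<^esub> s = \<zero>\<^bsub>S i\<^esub>}"
    using jacobson_annihilates[OF simple] by (auto simp: jacobson_radical_def)
next
  fix a assume a: "a \<in> {a \<in> carrier A. \<forall>i<\<ell> A. \<forall>s \<in> carrier (S i). a \<odot>\<^bsub>S i\<^esub> s = \<zero>\<^bsub>S i\<^esub>}"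
  have "a \<in> I" if I: "maximal_right_ideal A I" for I
  proof -
    have rI: "right_ideal I" using I by (simp add: maximal_right_ideal_def)
    let ?T = "quot_module (regular_module A) I"
    have "simple_module A ?T"
      using I by (intro quot_module_simple reg.right_module_axioms) (auto simp: maximal_right_ideal_def)
    from complete[OF this] obtain i f where i: "i < \<ell> A" and f: "f \<in> module_hom A ?T (S i)" "bij_betw f (carrier ?T) (carrier (S i))"
      by (auto simp: module_iso_def)
    note rT = reg.quot_right_module[OF rI]
    interpret T: right_module A ?T by (rule rT)
    let ?x = "I +>\<^bsub>regular_module A\<^esub> \<one>"
    have x: "?x \<in> carrier ?T" by (simp add: reg.quot_carrier[OF rI])
    then have "a \<odot>\<^bsub>?T\<^esub> ?x \<in> carrier ?T" "f (a \<odot>\<^bsub>?T\<^esub> ?x) = \<zero>\<^bsub>S i\<^esub>"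
      using a i module_homD(1,3)[OF f(1)] by (auto simp: T.act_closed)
    moreover have "f \<zero>\<^bsub>?T\<^esub> = \<zero>\<^bsub>S i\<^esub>" by (rule module_hom_zero[OF rT S_module[OF i] f(1)])
    ultimately have "a \<odot>\<^bsub>?T\<^esub> ?x = \<zero>\<^bsub>?T\<^esub>" using f(2) T.M.zero_closed by (metis bij_betw_imp_inj_on inj_onD)
    then show "a \<in> I" using a by (simp add: reg.quot_act[OF rI] reg.coset_eq_zero_iff[OF rI])
  qed
  with a show "a \<in> J" by (auto simp: jacobson_radical_def)
qed

lemma J_subset: "J \<subseteq> carrier A" by (auto simp: jacobson_radical_def)

lemma J_ideal: "ideal J A"
proof (rule idealI[OF A.ring_axioms])
  have sub: "Module.submodule J A (regular_module A)"
    unfolding reg.submodule_iff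
  proof (intro conjI ballI)
    show "\<zero>\<^bsub>regular_module A\<^esub> \<in> J"
      using right_module.act_zero_scalar[OF S_module] by (auto simp: jacobson_eq)
    fix x assume x: "x \<in> J"
    show "x \<oplus>\<^bsub>regular_module A\<^esub> y \<in> J" if "y \<in> J" for y
      using that x right_module.act_add_scalar[OF S_module]
        abelian_monoid.l_zero[OF abelian_group.axioms(1)[OF right_module.axioms(2)[OF S_module]]]
        abelian_monoid.zero_closed[OF abelian_group.axioms(1)[OF right_module.axioms(2)[OF S_module]]]
      by (auto simp: jacobson_eq)
    show "a \<odot>\<^bsub>regular_module A\<^esub> x \<in> J" if "a \<in> carrier A" for a
      using that x right_module.act_mult[OF S_module] right_module.act_zero[OF S_module]
      by (auto simp: jacobson_eq)
  qed (use J_subset in simp)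
  show "subgroup J (add_monoid A)"
    using Module.submodule.axioms(1)[OF sub] by (simp add: subgroup_def m_inv_def)
  fix a x assume a: "a \<in> J" and x: "x \<in> carrier A"
  show "a \<otimes> x \<in> J" using reg.submodule_act[OF sub x a] by simp
  show "x \<otimes> a \<in> J"
    using a x right_module.act_mult[OF S_module] right_module.act_closed[OF S_module] by (auto simp: jacobson_eq)
qed

text \<open>The scalar \<open>c\<close> acts as right multiplication by
  \<open>c \<odot> \<one>\<close>.\<close>

lemma right_ideal_subspace: "right_ideal I \<Longrightarrow> Module.submodule I F A"
proof -
  assume I: "right_ideal I"
  interpret VR: right_module F A by (rule vectorspace_right_module[OF vectorspace_axioms])
  have "c \<odot> x \<in> I" if "c \<in> carrier F" "x \<in> I" for c x
  proof -
    have "x \<in> carrier A" using that(2) reg.submodule_subset[OF I] by auto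
    with that reg.submodule_act[OF I _ that(2), of "c \<odot> \<one>"] show ?thesis by (simp add: smult_mult_right)
  qed
  then show ?thesis
    unfolding VR.submodule_iff
    using reg.submodule_subset[OF I] reg.submodule_zero[OF I] reg.submodule_add[OF I] by simp
qed

text \<open>Finite dimension enters through the rank: a right ideal of least rank with property
  \<open>P\<close> is minimal among those with \<open>P\<close>.\<close>

lemma minimal_right_ideal:
  assumes "right_ideal R0" "P R0"
  obtains R where "right_ideal R" "P R" "\<And>R'. \<lbrakk>right_ideal R'; P R'; R' \<subseteq> R\<rbrakk> \<Longrightarrow> R' = R"
proof -
  obtain r :: "'a set \<Rightarrow> nat" where r: "\<And>U U'. Module.submodule U F A \<Longrightarrow> Module.submodule U' F A \<Longrightarrow> U \<subset> U' \<Longrightarrow> r U < r U'"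
    using rank_exists[OF fin] by metis
  obtain R where R: "right_ideal R \<and> P R" "\<And>R'. right_ideal R' \<and> P R' \<Longrightarrow> r R \<le> r R'"
    using ex_has_least_nat[of "\<lambda>R. right_ideal R \<and> P R" R0 r] assms by metis
  with r right_ideal_subspace show thesis by (intro that[of R]) (auto simp: psubset_eq not_le[symmetric])
qed

lemma maximal_right_ideal_ex:
  assumes "right_ideal R0" "P R0"
  obtains R where "right_ideal R" "P R" "\<And>R'. \<lbrakk>right_ideal R'; P R'; R \<subseteq> R'\<rbrakk> \<Longrightarrow> R' = R"
proof -
  obtain r :: "'a set \<Rightarrow> nat" where b: "\<And>U. r U \<le> dim"
    and r: "\<And>U U'. Module.submodule U F A \<Longrightarrow> Module.submodule U' F A \<Longrightarrow> U \<subset> U' \<Longrightarrow> r U < r U'"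
    using rank_exists[OF fin] by metis
  \<comment> \<open>Ranks are at most \<open>dim\<close>; \<open>Suc dim\<close> is the strict bound
    required for choosing a greatest value.\<close>
  obtain R where R: "right_ideal R \<and> P R" "\<And>R'. right_ideal R' \<and> P R' \<Longrightarrow> r R' \<le> r R"
    using ex_has_greatest_nat[of "\<lambda>R. right_ideal R \<and> P R" R0 r "Suc dim"] assms b by (metis le_imp_less_Suc)
  with r right_ideal_subspace show thesis by (intro that[of R]) (auto simp: psubset_eq not_le[symmetric])
qed

lemma left_mult_hom: "x \<in> carrier A \<Longrightarrow> (\<lambda>y. x \<otimes> y) \<in> module_hom A (regular_module A) (regular_module A)"
  by (intro module_homI) (simp_all add: A.r_distr A.m_assoc)

text \<open>Fitting's argument. The kernels on \<open>R\<close> of left multiplication by the powers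
  of \<open>r\<close> become stationary at some \<open>n\<close>. By surjectivity
  \<open>x = r^n y\<close>; from \<open>r x = 0\<close> it follows that \<open>y\<close> lies in the
  kernel of \<open>r^(n+1)\<close>, hence in that of \<open>r^n\<close>, so
  \<open>x = 0\<close>.\<close>

lemma left_mult_surj_imp_inj:
  assumes R: "right_ideal R" and r: "r \<in> carrier A" and surj: "(\<lambda>y. r \<otimes> y) ` R = R"
    and x: "x \<in> R" "r \<otimes> x = \<zero>"
  shows "x = \<zero>"
proof -
  define K where "K n = {y \<in> R. (r [^] n) \<otimes> y = \<zero>}" for n :: nat
  have Rsub: "R \<subseteq> carrier A" using reg.submodule_subset[OF R] by simp
  have pw: "r [^] n \<in> carrier A" for n :: nat using r by simp
  have K: "right_ideal (K n)" for n
  proof -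
    have "x \<in> carrier A" if "x \<in> R" for x using that Rsub by auto
    then show ?thesis
      using R pw unfolding K_def reg.submodule_iff by (auto simp: A.r_distr A.m_assoc[symmetric])
  qed
  obtain R' where R': "\<exists>n. R' = K n" "\<And>I. \<lbrakk>right_ideal I; \<exists>n. I = K n; R' \<subseteq> I\<rbrakk> \<Longrightarrow> I = R'"
    by (rule maximal_right_ideal_ex[OF K[of 0], of "\<lambda>I. \<exists>n. I = K n"]) blast+
  from R'(1) obtain n where "R' = K n" by blast
  then have n: "K m = K n" if "K n \<subseteq> K m" for m using R'(2)[OF K[of m]] that by blast
  have KS: "K n \<subseteq> K (Suc n)"
  proof
    fix y assume y: "y \<in> K n"
    then have "(r [^] Suc n) \<otimes> y = r \<otimes> ((r [^] n) \<otimes> y)"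
      using r Rsub by (subst A.nat_pow_Suc2) (auto simp: K_def A.m_assoc)
    then show "y \<in> K (Suc n)" using y r by (simp add: K_def)
  qed
  have surjn: "\<exists>y\<in>R. (r [^] m) \<otimes> y = z" if "z \<in> R" for m :: nat and z using that
  proof (induction m arbitrary: z)
    case 0 then show ?case using Rsub by (intro bexI[of _ z]) auto
  next
    case (Suc m)
    then obtain y where y: "y \<in> R" "r [^] m \<otimes> y = z" by blast
    then have "y \<in> (\<lambda>y. r \<otimes> y) ` R" by (simp only: surj)
    then obtain y' where y': "y' \<in> R" "y = r \<otimes> y'" by blast
    then show ?case using y r Rsub by (intro bexI[of _ y']) (auto simp: A.m_assoc subset_iff)
  qed
  from surjn[OF x(1)] obtain y where y: "y \<in> R" "(r [^] n) \<otimes> y = x" by blast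
  then have "(r [^] Suc n) \<otimes> y = r \<otimes> x" using r Rsub by (subst A.nat_pow_Suc2) (auto simp: A.m_assoc)
  then have "y \<in> K (Suc n)" using y x by (simp add: K_def)
  then have "y \<in> K n" using n[OF KS] by simp
  then show ?thesis using y by (simp add: K_def)
qed

text \<open>The right ideal \<open>eA\<close> is minimal among those that do not annihilate \<open>S i\<close>.\<close>

lemma idempotent_exists:
  assumes i: "i < \<ell> A"
  obtains e w where "e \<in> carrier A" "e \<otimes> e = e" "w \<in> carrier (S i)" "w \<noteq> \<zero>\<^bsub>S i\<^esub>" "e \<odot>\<^bsub>S i\<^esub> w = w"
    "\<And>U u s. \<lbrakk>right_ideal U; U \<subseteq> {x \<in> carrier A. e \<otimes> x = x}; e \<notin> U; u \<in> U; s \<in> carrier (S i)\<rbrakk> \<Longrightarrow> u \<odot>\<^bsub>S i\<^esub> s = \<zero>\<^bsub>S i\<^esub>"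
proof -
  interpret M: right_module A "S i" by (rule S_module[OF i])
  define P where "P R \<longleftrightarrow> (\<exists>r\<in>R. \<exists>s\<in>carrier (S i). r \<odot>\<^bsub>S i\<^esub> s \<noteq> \<zero>\<^bsub>S i\<^esub>)" for R
  obtain s0 where "s0 \<in> carrier (S i)" "s0 \<noteq> \<zero>\<^bsub>S i\<^esub>"
    using simple_moduleD(2)[OF simple[OF i]] M.M.zero_closed by blast
  then have "P (carrier A)" unfolding P_def using M.act_one A.one_closed by metis
  then obtain R where R: "right_ideal R" "P R" and min: "\<And>R'. \<lbrakk>right_ideal R'; P R'; R' \<subseteq> R\<rbrakk> \<Longrightarrow> R' = R"
    using minimal_right_ideal[of "carrier A" P] A.right_ideal_carrier by metis
  have Rsub: "R \<subseteq> carrier A" using reg.submodule_subset[OF R(1)] by simp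
  obtain r0 s where s: "r0 \<in> R" "s \<in> carrier (S i)" "r0 \<odot>\<^bsub>S i\<^esub> s \<noteq> \<zero>\<^bsub>S i\<^esub>" using R(2) by (auto simp: P_def)
  have s0: "s \<noteq> \<zero>\<^bsub>S i\<^esub>" using s Rsub M.act_zero by auto
  obtain r where r: "r \<in> R" "r \<odot>\<^bsub>S i\<^esub> s = s"
    using simple_module_image[OF simple[OF i] R(1) s(2,1,3)] s(2) by (metis (no_types, lifting) imageE)
  have rA: "r \<in> carrier A" using r Rsub by auto
  \<comment> \<open>Since \<open>r\<close> fixes \<open>s\<close>, the right ideal
    \<open>r R\<close> does not annihilate \<open>S i\<close> either, and minimality gives
    \<open>r R = R\<close>.\<close>
  have "(r \<otimes> r) \<odot>\<^bsub>S i\<^esub> s = s" using rA s(2) r by (simp add: M.act_mult)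
  then have "P ((\<lambda>y. r \<otimes> y) ` R)" unfolding P_def using r s(2) s0 by (metis imageI)
  moreover have "right_ideal ((\<lambda>y. r \<otimes> y) ` R)"
    by (rule submodule_image[OF reg.right_module_axioms reg.right_module_axioms left_mult_hom[OF rA] R(1)])
  moreover have "(\<lambda>y. r \<otimes> y) ` R \<subseteq> R" using reg.submodule_act[OF R(1) _ r(1)] Rsub by auto
  ultimately have surj: "(\<lambda>y. r \<otimes> y) ` R = R" by (intro min)
  \<comment> \<open>As in Brauer's lemma: the preimage \<open>e\<close> of \<open>r\<close> under
    left multiplication by \<open>r\<close> satisfies \<open>r (e e - e) = 0\<close>, and
    injectivity on \<open>R\<close> makes \<open>e\<close> idempotent.\<close>
  then obtain e where e: "e \<in> R" "r \<otimes> e = r" using r(1) by (metis imageE)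
  have eA: "e \<in> carrier A" using e Rsub by auto
  have "r \<otimes> (e \<otimes> e \<ominus> e) = \<zero>"
    using rA eA e(2) by (simp add: a_minus_def A.r_distr A.r_minus A.m_assoc[symmetric] M.r_neg)
  moreover have "e \<otimes> e \<ominus> e \<in> R"
    using reg.submodule_minus[OF R(1)] reg.submodule_act[OF R(1) eA e(1)] e(1) by simp
  ultimately have "e \<otimes> e \<ominus> e = \<zero>" using left_mult_surj_imp_inj[OF R(1) rA surj] by blast
  then have ee: "e \<otimes> e = e" using eA by (simp add: M.minus_eq_zero_iff)
  have es: "e \<odot>\<^bsub>S i\<^esub> s = s" using r(2) e(2) rA eA s(2) M.act_mult by metis
  show thesis
  proof (rule that[OF eA ee s(2) s0 es])
    fix U u t assume U: "right_ideal U" "U \<subseteq> {x \<in> carrier A. e \<otimes> x = x}" "e \<notin> U" "u \<in> U" "t \<in> carrier (S i)"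
    \<comment> \<open>\<open>U\<close> lies in \<open>R\<close> because \<open>x = e x\<close> with
      \<open>e\<close> in \<open>R\<close>, and it differs from \<open>R\<close> because it misses
      \<open>e\<close>.\<close>
    have "x \<in> R" if "x \<in> U" for x
      using that U(2) reg.submodule_act[OF R(1), of x e] e(1) by auto
    then show "u \<odot>\<^bsub>S i\<^esub> t = \<zero>\<^bsub>S i\<^esub>" using min[of U] U e(1) unfolding P_def by blast
  qed
qed

text \<open>\<open>splitting_field\<close> speaks of simple modules whose elements have type
  \<open>'a set\<close>; conjugation with an isomorphism carries the condition over to
  \<open>S i\<close>.\<close>

lemma endomorphism_scalar:
  assumes i: "i < \<ell> A" and f: "f \<in> module_hom A (S i) (S i)"
  shows "\<exists>c \<in> carrier F. \<forall>x \<in> carrier (S i). f x = (c \<odot> \<one>) \<odot>\<^bsub>S i\<^esub> x"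
proof -
  interpret M: right_module A "S i" by (rule S_module[OF i])
  obtain T :: "('a, 'a set) module" and g where T: "simple_module A T"
    and g: "g \<in> module_hom A (S i) T" "bij_betw g (carrier (S i)) (carrier T)"
    using simple_module_small[OF simple[OF i]] by (auto simp: module_iso_def)
  let ?h = "the_inv_into (carrier (S i)) g"
  have h: "?h \<in> module_hom A T (S i)" by (rule module_iso_inverse[OF M.right_module_axioms g])
  have hg: "?h (g x) = x" if "x \<in> carrier (S i)" for x
    using that g(2) by (simp add: bij_betw_def the_inv_into_f_f)
  have "(\<lambda>x. g (f (?h x))) \<in> module_hom A T T" by (rule module_hom_comp[OF module_hom_comp[OF h f] g(1)])
  then obtain c where c: "c \<in> carrier F" "\<And>x. x \<in> carrier T \<Longrightarrow> g (f (?h x)) = (c \<odot> \<one>) \<odot>\<^bsub>T\<^esub> x"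
    using split T unfolding splitting_field_def by meson
  have "f x = (c \<odot> \<one>) \<odot>\<^bsub>S i\<^esub> x" if x: "x \<in> carrier (S i)" for x
  proof -
    have gx: "g x \<in> carrier T" using module_homD(1)[OF g(1)] x by simp
    have c1: "c \<odot> \<one> \<in> carrier A" using c(1) by simp
    have "g (f x) = g ((c \<odot> \<one>) \<odot>\<^bsub>S i\<^esub> x)" using c(2)[OF gx] hg[OF x] module_homD(3)[OF g(1) c1 x] by simp
    then show ?thesis
      using g(2) module_homD(1)[OF f x] M.act_closed[OF c1 x] by (metis bij_betw_imp_inj_on inj_onD)
  qed
  with c(1) show ?thesis by blast
qed

end

section \<open>Basic idempotents\<close>

text \<open>By \<open>e_minimal\<close> every proper submodule of \<open>e i A\<close> annihilates
  \<open>S i\<close>, so \<open>e i A\<close> is a local module. The vector \<open>w i\<close>,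
  fixed by \<open>e i\<close>, is a base point of \<open>S i\<close>: it generates the module and
  tests membership in the radical.\<close>

locale basic_idempotents = split_algebra F A S
  for F :: "('f, 'k) ring_scheme" and A :: "('f, 'a) module" (structure) and S :: "nat \<Rightarrow> ('a, 'm) module" +
  fixes e :: "nat \<Rightarrow> 'a" and w :: "nat \<Rightarrow> 'm"
  assumes e_closed: "i < \<ell> A \<Longrightarrow> e i \<in> carrier A"
    and e_idem: "i < \<ell> A \<Longrightarrow> e i \<otimes> e i = e i"
    and w_closed: "i < \<ell> A \<Longrightarrow> w i \<in> carrier (S i)"
    and w_nonzero: "i < \<ell> A \<Longrightarrow> w i \<noteq> \<zero>\<^bsub>S i\<^esub>"
    and e_w: "i < \<ell> A \<Longrightarrow> e i \<odot>\<^bsub>S i\<^esub> w i = w i"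
    and e_minimal: "\<lbrakk>i < \<ell> A; right_ideal U; U \<subseteq> {x \<in> carrier A. e i \<otimes> x = x}; e i \<notin> U; u \<in> U; s \<in> carrier (S i)\<rbrakk> \<Longrightarrow>
      u \<odot>\<^bsub>S i\<^esub> s = \<zero>\<^bsub>S i\<^esub>"
begin

text \<open>The elements of \<open>e i A\<close> that annihilate \<open>t\<close> form a right
  ideal. It misses \<open>e i\<close>, which fixes \<open>t\<close>, so by minimality it annihilates
  \<open>S i\<close>.\<close>

lemma annihilator_transfer:
  assumes i: "i < \<ell> A" and T: "right_module A T" and t: "t \<in> carrier T" "e i \<odot>\<^bsub>T\<^esub> t = t" "t \<noteq> \<zero>\<^bsub>T\<^esub>"
    and x: "x \<in> carrier A" "x \<odot>\<^bsub>T\<^esub> t = \<zero>\<^bsub>T\<^esub>" and s: "s \<in> carrier (S i)"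
  shows "(e i \<otimes> x) \<odot>\<^bsub>S i\<^esub> s = \<zero>\<^bsub>S i\<^esub>"
proof -
  interpret T: right_module A T by fact
  note e = e_closed[OF i]
  let ?U = "{u \<in> carrier A. e i \<otimes> u = u \<and> u \<odot>\<^bsub>T\<^esub> t = \<zero>\<^bsub>T\<^esub>}"
  have "right_ideal ?U"
    unfolding reg.submodule_iff
    using e t by (auto simp: A.r_distr A.m_assoc[symmetric] T.act_add_scalar T.act_mult T.act_zero T.act_zero_scalar)
  moreover have "e i \<otimes> x \<in> ?U" using e e_idem[OF i] x t by (simp add: A.m_assoc[symmetric] T.act_mult)
  moreover have "e i \<notin> ?U" using t by simp
  ultimately show ?thesis using e_minimal[OF i, of ?U] s by blast
qed

text \<open>Whatever annihilates the vector \<open>t e i\<close> of \<open>T\<close> annihilates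
  \<open>w i\<close> as well. The resulting map to \<open>S i\<close> is nonzero, and Schur's lemma
  applies.\<close>

lemma simple_iso_S:
  assumes i: "i < \<ell> A" and T: "simple_module A T" and t: "t \<in> carrier T" "e i \<odot>\<^bsub>T\<^esub> t \<noteq> \<zero>\<^bsub>T\<^esub>"
  shows "module_iso A T (S i)"
proof -
  interpret T: right_module A T by (rule simple_moduleD(1)[OF T])
  interpret Si: right_module A "S i" by (rule S_module[OF i])
  note e = e_closed[OF i] and w = w_closed[OF i]
  let ?t = "e i \<odot>\<^bsub>T\<^esub> t"
  have t': "?t \<in> carrier T" "e i \<odot>\<^bsub>T\<^esub> ?t = ?t"
    using t e e_idem[OF i] by (auto simp: T.act_closed T.act_mult[symmetric])
  have ann: "a \<odot>\<^bsub>S i\<^esub> w i = \<zero>\<^bsub>S i\<^esub>" if a: "a \<in> carrier A" "a \<odot>\<^bsub>T\<^esub> ?t = \<zero>\<^bsub>T\<^esub>" for a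
    using annihilator_transfer[OF i T.right_module_axioms t' t(2) a w] a e w e_w[OF i] by (simp add: Si.act_mult)
  obtain f where f: "f \<in> module_hom A T (S i)" "\<And>a. a \<in> carrier A \<Longrightarrow> f (a \<odot>\<^bsub>T\<^esub> ?t) = a \<odot>\<^bsub>S i\<^esub> w i"
    using cyclic_module_hom[OF T.right_module_axioms Si.right_module_axioms t'(1) w simple_module_cyclic[OF T t'(1) t(2)] ann]
    by blast
  have "f ?t = w i" using f(2)[OF A.one_closed] t' w by (simp add: T.act_one Si.act_one)
  then show ?thesis using schur_iso[OF T simple[OF i] f(1) t'(1)] w_nonzero[OF i] by simp
qed

lemma e_annihilates:
  assumes "i < \<ell> A" "j < \<ell> A" "i \<noteq> j" "s \<in> carrier (S j)"
  shows "e i \<odot>\<^bsub>S j\<^esub> s = \<zero>\<^bsub>S j\<^esub>"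
  using simple_iso_S[OF assms(1) simple[OF assms(2)] assms(4)] noniso[OF assms(2,1)] assms(3) by blast

text \<open>A single vector decides: on \<open>S i\<close> the vanishing spreads from
  \<open>w i\<close> by \<open>annihilator_transfer\<close>, and on every other \<open>S j\<close>
  already \<open>e i\<close> acts as zero.\<close>

lemma e_mult_in_J:
  assumes i: "i < \<ell> A" and x: "x \<in> carrier A" "x \<odot>\<^bsub>S i\<^esub> w i = \<zero>\<^bsub>S i\<^esub>"
  shows "e i \<otimes> x \<in> J"
proof -
  have "(e i \<otimes> x) \<odot>\<^bsub>S j\<^esub> s = \<zero>\<^bsub>S j\<^esub>" if j: "j < \<ell> A" and s: "s \<in> carrier (S j)" for j s
  proof (cases "j = i")
    case True
    then show ?thesis
      using annihilator_transfer[OF i S_module[OF i] w_closed[OF i] e_w[OF i] w_nonzero[OF i] x] s by simp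
  next
    case False
    interpret Sj: right_module A "S j" by (rule S_module[OF j])
    show ?thesis using e_annihilates[OF i j _ s] False x s e_closed[OF i] by (simp add: Sj.act_mult Sj.act_zero)
  qed
  then show ?thesis unfolding jacobson_eq using x e_closed[OF i] by simp
qed

lemma e_mult_e_in_J:
  assumes i: "i < \<ell> A" and j: "j < \<ell> A" and ne: "i \<noteq> j" and x: "x \<in> carrier A"
  shows "e i \<otimes> x \<otimes> e j \<in> J"
proof -
  interpret Si: right_module A "S i" by (rule S_module[OF i])
  have "(x \<otimes> e j) \<odot>\<^bsub>S i\<^esub> w i = \<zero>\<^bsub>S i\<^esub>"
    using e_annihilates[OF j i _ Si.act_closed[OF x w_closed[OF i]]] ne x e_closed[OF j] w_closed[OF i]
    by (simp add: Si.act_mult)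
  from e_mult_in_J[OF i _ this] show ?thesis using x e_closed i j by (simp add: A.m_assoc)
qed

lemma e_notin_J: "i < \<ell> A \<Longrightarrow> e i \<notin> J"
  using e_w w_nonzero w_closed by (fastforce simp: jacobson_eq)

text \<open>Let \<open>y = e x e\<close>. The map \<open>w a \<mapsto> w y a\<close> is a
  well-defined endomorphism of \<open>S i\<close>, since \<open>w a = 0\<close> puts
  \<open>e a\<close> into \<open>J\<close>. The splitting hypothesis makes it a scalar
  \<open>c\<close>; then \<open>y - c e\<close> annihilates \<open>w\<close> and hence lies in
  \<open>J\<close>.\<close>

lemma corner_scalar:
  assumes i: "i < \<ell> A" and x: "x \<in> carrier A"
  obtains c where "c \<in> carrier F" "e i \<otimes> x \<otimes> e i \<ominus> c \<odot> e i \<in> J"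
proof -
  interpret Si: right_module A "S i" by (rule S_module[OF i])
  note e = e_closed[OF i] and w = w_closed[OF i]
  let ?y = "e i \<otimes> x \<otimes> e i"
  have y: "?y \<in> carrier A" using e x by simp
  have ann: "a \<odot>\<^bsub>S i\<^esub> (?y \<odot>\<^bsub>S i\<^esub> w i) = \<zero>\<^bsub>S i\<^esub>" if a: "a \<in> carrier A" "a \<odot>\<^bsub>S i\<^esub> w i = \<zero>\<^bsub>S i\<^esub>" for a
  proof -
    have "e i \<otimes> x \<otimes> (e i \<otimes> a) \<in> J"
      using ideal.I_l_closed[OF J_ideal e_mult_in_J[OF i a]] e x by simp
    then have "(?y \<otimes> a) \<odot>\<^bsub>S i\<^esub> w i = \<zero>\<^bsub>S i\<^esub>"
      using jacobson_annihilates[OF simple[OF i] w] a e x by (simp add: A.m_assoc)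
    then show ?thesis using a(1) y w by (simp add: Si.act_mult)
  qed
  obtain f where f: "f \<in> module_hom A (S i) (S i)"
    "\<And>a. a \<in> carrier A \<Longrightarrow> f (a \<odot>\<^bsub>S i\<^esub> w i) = a \<odot>\<^bsub>S i\<^esub> (?y \<odot>\<^bsub>S i\<^esub> w i)"
    using cyclic_module_hom[OF Si.right_module_axioms Si.right_module_axioms w _ simple_module_cyclic[OF simple[OF i] w w_nonzero[OF i]] ann]
      Si.act_closed[OF y w] by blast
  obtain c where c: "c \<in> carrier F" "\<And>x. x \<in> carrier (S i) \<Longrightarrow> f x = (c \<odot> \<one>) \<odot>\<^bsub>S i\<^esub> x"
    using endomorphism_scalar[OF i f(1)] by blast
  have ce: "c \<odot> e i = e i \<otimes> (c \<odot> \<one>)" using c(1) e by (simp add: smult_mult_right)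
  have yw: "?y \<odot>\<^bsub>S i\<^esub> w i = (c \<odot> \<one>) \<odot>\<^bsub>S i\<^esub> w i"
    using f(2)[OF A.one_closed] c(2)[OF w] w y by (simp add: Si.act_one Si.act_closed)
  have "(?y \<ominus> c \<odot> e i) \<odot>\<^bsub>S i\<^esub> w i = \<zero>\<^bsub>S i\<^esub>"
    using c(1) y e w yw e_w[OF i] unfolding ce
    by (simp add: Si.act_minus_scalar Si.act_mult Si.M.minus_eq_zero_iff Si.act_closed)
  then have "e i \<otimes> (?y \<ominus> c \<odot> e i) \<in> J" using e_mult_in_J[OF i] y c(1) e by simp
  moreover have "e i \<otimes> (?y \<ominus> c \<odot> e i) = ?y \<ominus> c \<odot> e i"
    using e x c(1) e_idem[OF i]
    by (simp add: a_minus_def A.r_distr A.r_minus A.m_assoc[symmetric] smult_mult_right)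
  ultimately show thesis using that c(1) by simp
qed

text \<open>The vectors of a simple module fixed by \<open>e i\<close> form a space of dimension at
  most one: in \<open>t' = t a\<close> the element \<open>a\<close> may be replaced by
  \<open>e i a e i\<close>, which is a multiple of \<open>e i\<close> modulo \<open>J\<close>, and
  \<open>J\<close> annihilates \<open>T\<close>. This lets composition factors count
  dimensions.\<close>

lemma simple_corner_scalar:
  assumes i: "i < \<ell> A" and T: "simple_module A T" and t: "t \<in> carrier T" "t \<noteq> \<zero>\<^bsub>T\<^esub>" "e i \<odot>\<^bsub>T\<^esub> t = t"
    and t': "t' \<in> carrier T" "e i \<odot>\<^bsub>T\<^esub> t' = t'"
  obtains c where "c \<in> carrier F" "t' = (c \<odot> \<one>) \<odot>\<^bsub>T\<^esub> t"
proof -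
  interpret T: right_module A T by (rule simple_moduleD(1)[OF T])
  note e = e_closed[OF i]
  obtain a where a: "a \<in> carrier A" "t' = a \<odot>\<^bsub>T\<^esub> t"
    using simple_module_cyclic[OF T t(1,2)] t'(1) by (metis (no_types, lifting) imageE)
  obtain c where c: "c \<in> carrier F" "e i \<otimes> a \<otimes> e i \<ominus> c \<odot> e i \<in> J" using corner_scalar[OF i a(1)] .
  have ce: "c \<odot> e i = e i \<otimes> (c \<odot> \<one>)" using c(1) e by (simp add: smult_mult_right)
  have "t' = (e i \<otimes> a \<otimes> e i) \<odot>\<^bsub>T\<^esub> t" using a t t' e by (simp add: T.act_mult T.act_closed)
  moreover have "(e i \<otimes> a \<otimes> e i) \<odot>\<^bsub>T\<^esub> t = (c \<odot> e i) \<odot>\<^bsub>T\<^esub> t"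
    using jacobson_annihilates[OF T t(1) c(2)] e a c(1) t(1)
    by (simp add: T.act_minus_scalar T.M.minus_eq_zero_iff T.act_closed)
  ultimately show thesis using that[OF c(1)] c(1) e t unfolding ce by (simp add: T.act_mult)
qed

text \<open>The two-sided ideal generated by the \<open>e i\<close>. It is built one summand at a
  time so that induction yields a decomposition into explicit products.\<close>

inductive_set G :: "'a set" where
  zero: "\<zero> \<in> G"
| step: "\<lbrakk>x \<in> G; i < \<ell> A; a \<in> carrier A; b \<in> carrier A\<rbrakk> \<Longrightarrow> x \<oplus> a \<otimes> e i \<otimes> b \<in> G"

lemma G_subset: "G \<subseteq> carrier A"
proof
  show "x \<in> carrier A" if "x \<in> G" for x using that by induction (auto simp: e_closed)
qed

lemma G_right_ideal: "right_ideal G"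
  unfolding reg.submodule_iff regular_module_simps
proof (intro conjI ballI)
  show "x \<oplus> y \<in> G" if x: "x \<in> G" and "y \<in> G" for x y
    using that(2)
  proof induction
    case (step y i a b)
    then have "x \<oplus> (y \<oplus> a \<otimes> e i \<otimes> b) = (x \<oplus> y) \<oplus> a \<otimes> e i \<otimes> b"
      using x G_subset by (simp add: M.a_assoc e_closed subset_iff)
    with step show ?case by (simp add: G.step)
  qed (use x G_subset in \<open>auto simp: subset_iff\<close>)
  show "x \<otimes> c \<in> G" if c: "c \<in> carrier A" and "x \<in> G" for c x
    using that(2)
  proof induction
    case (step y i a b)
    then have "(y \<oplus> a \<otimes> e i \<otimes> b) \<otimes> c = y \<otimes> c \<oplus> a \<otimes> e i \<otimes> (b \<otimes> c)"
      using c G_subset by (simp add: A.l_distr A.m_assoc e_closed subset_iff)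
    with step c show ?case by (simp add: G.step)
  qed (use c G.zero in simp)
qed (use G_subset G.zero in auto)

text \<open>Otherwise \<open>G\<close> lies in a right ideal \<open>R\<close> maximal among those
  avoiding \<open>\<one>\<close>. The simple module \<open>A/R\<close> is isomorphic to some
  \<open>S i\<close>, on which \<open>e i\<close> is nonzero; yet \<open>e i\<close> annihilates
  \<open>A/R\<close>, because \<open>a e i\<close> lies in \<open>G\<close>.\<close>

lemma one_in_G: "\<one> \<in> G"
proof (rule ccontr)
  assume "\<one> \<notin> G"
  then obtain R where R: "right_ideal R" "G \<subseteq> R \<and> \<one> \<notin> R"
    and max: "\<And>R'. \<lbrakk>right_ideal R'; G \<subseteq> R' \<and> \<one> \<notin> R'; R \<subseteq> R'\<rbrakk> \<Longrightarrow> R' = R"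
    using maximal_right_ideal_ex[OF G_right_ideal, of "\<lambda>R. G \<subseteq> R \<and> \<one> \<notin> R"] by blast
  have full: "Y = carrier A" if "right_ideal Y" "\<one> \<in> Y" for Y
    using reg.submodule_act[OF that(1) _ that(2)] reg.submodule_subset[OF that(1)] by force
  let ?T = "quot_module (regular_module A) R"
  interpret T: right_module A ?T by (rule reg.quot_right_module[OF R(1)])
  have "simple_module A ?T"
    using R full max by (intro quot_module_simple reg.right_module_axioms) auto
  from complete[OF this] obtain i f where i: "i < \<ell> A" and f: "f \<in> module_hom A ?T (S i)" "bij_betw f (carrier ?T) (carrier (S i))"
    by (auto simp: module_iso_def)
  have kill: "e i \<odot>\<^bsub>?T\<^esub> t = \<zero>\<^bsub>?T\<^esub>" if t: "t \<in> carrier ?T" for t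
  proof -
    obtain a where a: "a \<in> carrier A" "t = R +>\<^bsub>regular_module A\<^esub> a"
      using t by (auto simp: reg.quot_carrier[OF R(1)])
    have "\<zero> \<oplus> a \<otimes> e i \<otimes> \<one> \<in> G" using G.step[OF G.zero i a(1) A.one_closed] .
    then have "a \<otimes> e i \<in> R" using R(2) a(1) e_closed[OF i] by auto
    then show ?thesis using a e_closed[OF i] by (simp add: reg.quot_act[OF R(1)] reg.coset_eq_zero_iff[OF R(1)])
  qed
  obtain t where t: "t \<in> carrier ?T" "f t = w i"
    using f(2) w_closed[OF i] unfolding bij_betw_def by (metis (no_types, lifting) imageE)
  have "e i \<odot>\<^bsub>S i\<^esub> w i = f (e i \<odot>\<^bsub>?T\<^esub> t)" using module_homD(3)[OF f(1) e_closed[OF i] t(1)] t(2) by simp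
  also have "\<dots> = \<zero>\<^bsub>S i\<^esub>"
    using kill[OF t(1)] module_hom_zero[OF T.right_module_axioms S_module[OF i] f(1)] by simp
  finally show False using e_w[OF i] w_nonzero[OF i] by simp
qed

lemma G_decomposition:
  assumes "x \<in> G"
  shows "\<exists>(n::nat) \<iota> u v. (\<forall>k<n. \<iota> k < \<ell> A \<and> u k \<in> carrier A \<and> v k \<in> carrier A \<and>
      u k \<otimes> e (\<iota> k) = u k \<and> e (\<iota> k) \<otimes> v k = v k) \<and> x = (\<Oplus>k\<in>{..<n}. u k \<otimes> v k)"
  using assms
proof induction
  case zero
  show ?case by (intro exI[of _ 0]) simp
next
  case (step x i a b)
  then obtain n \<iota> u v where d: "\<And>k. k < (n::nat) \<Longrightarrow> \<iota> k < \<ell> A \<and> u k \<in> carrier A \<and> v k \<in> carrier A \<and>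
      u k \<otimes> e (\<iota> k) = u k \<and> e (\<iota> k) \<otimes> v k = v k" "x = (\<Oplus>k\<in>{..<n}. u k \<otimes> v k)" by blast
  \<comment> \<open>The new summand \<open>a e b\<close> is split as \<open>(a e) (e b)\<close>, so
    that both factors absorb the idempotent.\<close>
  let ?u = "u(n := a \<otimes> e i)" and ?v = "v(n := e i \<otimes> b)"
  have ab: "a \<otimes> e i \<otimes> (e i \<otimes> b) = a \<otimes> e i \<otimes> b"
  proof -
    have "e i \<otimes> (e i \<otimes> b) = e i \<otimes> b"
      using step e_closed e_idem by (simp add: A.m_assoc[symmetric])
    then show ?thesis using step e_closed by (simp add: A.m_assoc)
  qed
  have "(\<Oplus>k\<in>{..<Suc n}. ?u k \<otimes> ?v k) = a \<otimes> e i \<otimes> b \<oplus> (\<Oplus>k\<in>{..<n}. ?u k \<otimes> ?v k)"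
    unfolding lessThan_Suc using d(1) step e_closed by (subst M.finsum_insert) (auto simp: ab)
  also have "(\<Oplus>k\<in>{..<n}. ?u k \<otimes> ?v k) = x"
    unfolding d(2) using d(1) by (intro M.finsum_cong') auto
  finally have "x \<oplus> a \<otimes> e i \<otimes> b = (\<Oplus>k\<in>{..<Suc n}. ?u k \<otimes> ?v k)"
    using step G_subset e_closed by (simp add: M.a_comm subset_iff)
  moreover have "a \<otimes> e i \<otimes> e i = a \<otimes> e i" "e i \<otimes> (e i \<otimes> b) = e i \<otimes> b"
    using step e_closed e_idem A.m_assoc[of a "e i" "e i"] A.m_assoc[of "e i" "e i" b] by simp_all
  ultimately show ?case
    using d(1) step e_closed
    by (intro exI[of _ "Suc n"] exI[of _ "\<iota>(n := i)"] exI[of _ ?u] exI[of _ ?v]) (auto simp: less_Suc_eq)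
qed

end

section \<open>The codimension of sums of the commutator space and an ideal\<close>

context split_algebra begin

sublocale VR: right_module F A by (rule vectorspace_right_module[OF vectorspace_axioms])

lemma ideal_right_ideal: "ideal N A \<Longrightarrow> right_ideal N"
  unfolding reg.submodule_iff
  using additive_subgroup.a_subset[OF ideal.axioms(1)] additive_subgroup.zero_closed[OF ideal.axioms(1)]
    additive_subgroup.a_closed[OF ideal.axioms(1)] ideal.I_r_closed by fastforce

lemma ideal_subspace: "ideal N A \<Longrightarrow> Module.submodule N F A"
  by (intro right_ideal_subspace ideal_right_ideal)

abbreviation J2 where "J2 \<equiv> ideal_prod A J J"

lemma J2_ideal: "ideal J2 A" by (rule A.ideal_prod_is_ideal[OF J_ideal J_ideal])

lemma J2_subset: "J2 \<subseteq> J" using A.ideal_prod_inter[OF J_ideal J_ideal] by blast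

lemma J_mult_J: "x \<in> J \<Longrightarrow> y \<in> J \<Longrightarrow> x \<otimes> y \<in> J2" by (rule ideal_prod.prod)

text \<open>Powers in \<open>ideals_set A\<close> start from the unit ideal \<open>A\<close>, so the
  first power unfolds to the product of \<open>A\<close> and \<open>J\<close>.\<close>

lemma J_ideal_prod: "ideal_prod A (carrier A) J = J"
proof
  show "ideal_prod A (carrier A) J \<subseteq> J" using A.ideal_prod_inter[OF A.oneideal J_ideal] by blast
  show "J \<subseteq> ideal_prod A (carrier A) J" using ideal_prod.prod[of \<one> "carrier A" _ J A] J_subset by fastforce
qed

lemma KR_1: "KR F A 1 = commutator_space F A <+>\<^bsub>A\<^esub> J"
  using J_ideal_prod by (simp add: KR_def nat_pow_def ideals_set_def)

lemma KR_2: "KR F A 2 = commutator_space F A <+>\<^bsub>A\<^esub> J2"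
  using J_ideal_prod by (simp add: KR_def nat_pow_def ideals_set_def numeral_2_eq_2)

lemma commutator_space_subspace: "Module.submodule (commutator_space F A) F A"
  unfolding commutator_space_def by (rule span_submodule) auto

lemma commutator_in_space: "x \<in> carrier A \<Longrightarrow> y \<in> carrier A \<Longrightarrow> x \<otimes> y \<ominus> y \<otimes> x \<in> commutator_space F A"
  unfolding commutator_space_def by (rule subsetD[OF in_own_span]) auto

end

section \<open>Corners and their trace maps\<close>

locale decomposition = basic_idempotents F A S e w
  for F :: "('f, 'k) ring_scheme" and A :: "('f, 'a) module" (structure) and S :: "nat \<Rightarrow> ('a, 'm) module" and e w +
  fixes n :: nat and \<iota> :: "nat \<Rightarrow> nat" and u v :: "nat \<Rightarrow> 'a"
  assumes iota: "k < n \<Longrightarrow> \<iota> k < \<ell> A"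
    and u_closed: "k < n \<Longrightarrow> u k \<in> carrier A" and v_closed: "k < n \<Longrightarrow> v k \<in> carrier A"
    and u_e: "k < n \<Longrightarrow> u k \<otimes> e (\<iota> k) = u k" and e_v: "k < n \<Longrightarrow> e (\<iota> k) \<otimes> v k = v k"
    and one_eq: "\<one> = (\<Oplus>k\<in>{..<n}. u k \<otimes> v k)"
begin

text \<open>The algebra \<open>e i A e i\<close>; for an idempotent it is the set of fixed points,
  which turns membership into equations.\<close>

definition "corner i = {x \<in> carrier A. e i \<otimes> x = x \<and> x \<otimes> e i = x}"

definition "K i = {k. k < n \<and> \<iota> k = i}"

text \<open>The matrix trace under the Morita equivalence of \<open>A\<close> with its basic algebra.\<close>

definition "Tr i x = (\<Oplus>k\<in>K i. v k \<otimes> x \<otimes> u k)"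

lemma K_finite [simp]: "finite (K i)" and K_less: "k \<in> K i \<Longrightarrow> k < n" and K_subset: "K i \<subseteq> {..<n}"
  and K_iota: "k \<in> K i \<Longrightarrow> \<iota> k = i"
  by (auto simp: K_def)

lemma cornerI: "\<lbrakk>x \<in> carrier A; e i \<otimes> x = x; x \<otimes> e i = x\<rbrakk> \<Longrightarrow> x \<in> corner i"
  by (simp add: corner_def)

lemma cornerD: "x \<in> corner i \<Longrightarrow> x \<in> carrier A" "x \<in> corner i \<Longrightarrow> e i \<otimes> x = x" "x \<in> corner i \<Longrightarrow> x \<otimes> e i = x"
  by (simp_all add: corner_def)

lemma corner_e: "i < \<ell> A \<Longrightarrow> e i \<in> corner i"
  by (simp add: corner_def e_closed e_idem)

lemma corner_subspace: "i < \<ell> A \<Longrightarrow> Module.submodule (corner i) F A"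
  unfolding VR.submodule_iff
  by (auto simp: corner_def e_closed A.l_distr A.r_distr smult_mult_left smult_mult_right)

lemma corner_add: "\<lbrakk>i < \<ell> A; x \<in> corner i; y \<in> corner i\<rbrakk> \<Longrightarrow> x \<oplus> y \<in> corner i"
  and corner_minus: "\<lbrakk>i < \<ell> A; x \<in> corner i; y \<in> corner i\<rbrakk> \<Longrightarrow> x \<ominus> y \<in> corner i"
  and corner_smult: "\<lbrakk>i < \<ell> A; c \<in> carrier F; x \<in> corner i\<rbrakk> \<Longrightarrow> c \<odot> x \<in> corner i"
  using VR.submodule_add[OF corner_subspace] VR.submodule_minus[OF corner_subspace] VR.submodule_act[OF corner_subspace]
  by auto

lemma corner_mult: "\<lbrakk>i < \<ell> A; x \<in> corner i; y \<in> corner i\<rbrakk> \<Longrightarrow> x \<otimes> y \<in> corner i"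
  using e_closed[of i] by (simp add: corner_def A.m_assoc[of x y] A.m_assoc[of "e i" x y, symmetric])

text \<open>Since \<open>u k\<close> ends in \<open>e (\<iota> k)\<close>, the product lies between
  two different idempotents. The next lemma is its mirror image for \<open>v k\<close>.\<close>

lemma e_u_in_J: "\<lbrakk>i < \<ell> A; k < n; \<iota> k \<noteq> i; x \<in> carrier A\<rbrakk> \<Longrightarrow> e i \<otimes> x \<otimes> u k \<in> J"
  using e_mult_e_in_J[of i "\<iota> k" "x \<otimes> u k"] u_e[of k] u_closed[of k] iota[of k] e_closed[of i] e_closed[of "\<iota> k"]
  by (auto simp: A.m_assoc)

lemma v_e_in_J: "\<lbrakk>i < \<ell> A; k < n; \<iota> k \<noteq> i; x \<in> carrier A\<rbrakk> \<Longrightarrow> v k \<otimes> x \<otimes> e i \<in> J"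
  using e_mult_e_in_J[of "\<iota> k" i "v k \<otimes> x"] e_v[of k] v_closed[of k] iota[of k] e_closed[of i] e_closed[of "\<iota> k"]
  by (auto simp: A.m_assoc[symmetric])

lemma corner_coefficient_ex:
  assumes "i < \<ell> A" "x \<in> corner i" shows "\<exists>c\<in>carrier F. x \<ominus> c \<odot> e i \<in> J"
  using corner_scalar[OF assms(1) cornerD(1)[OF assms(2)]] cornerD[OF assms(2)] by metis

lemma smult_e_in_J:
  assumes "i < \<ell> A" "c \<in> carrier F" "c \<odot> e i \<in> J" shows "c = \<zero>\<^bsub>F\<^esub>"
proof (rule ccontr)
  assume c: "c \<noteq> \<zero>\<^bsub>F\<^esub>"
  then have inv: "inv\<^bsub>F\<^esub> c \<in> carrier F" "inv\<^bsub>F\<^esub> c \<otimes>\<^bsub>F\<^esub> c = \<one>\<^bsub>F\<^esub>"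
    using assms(2) field_Units by (auto simp: R.Units_l_inv)
  have "inv\<^bsub>F\<^esub> c \<odot> (c \<odot> e i) \<in> J" using VR.submodule_act[OF ideal_subspace[OF J_ideal] inv(1) assms(3)] .
  then show False using inv assms(1,2) e_closed[OF assms(1)] e_notin_J by (simp add: smult_assoc1[symmetric])
qed

text \<open>The residue map of the local algebra \<open>e i A e i\<close>, whose residue field is
  \<open>F\<close> by the splitting hypothesis.\<close>

definition "\<epsilon> i x = (SOME c. c \<in> carrier F \<and> x \<ominus> c \<odot> e i \<in> J)"

lemma eps:
  assumes "i < \<ell> A" "x \<in> corner i" shows "\<epsilon> i x \<in> carrier F" "x \<ominus> \<epsilon> i x \<odot> e i \<in> J"
  using someI_ex[OF corner_coefficient_ex[OF assms, unfolded Bex_def]] unfolding \<epsilon>_def by blast+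

lemma eps_eqI:
  assumes i: "i < \<ell> A" and x: "x \<in> corner i" and c: "c \<in> carrier F" "x \<ominus> c \<odot> e i \<in> J" shows "\<epsilon> i x = c"
proof -
  note xA = cornerD(1)[OF x] and e = e_closed[OF i] and ep = eps[OF i x] and JF = ideal_subspace[OF J_ideal]
  have "c \<odot> e i \<ominus> x \<in> J" by (rule VR.submodule_minus_commute[OF JF xA _ c(2)]) (use c e in simp)
  from VR.submodule_minus_trans[OF JF _ xA _ this ep(2)] have "c \<odot> e i \<ominus> \<epsilon> i x \<odot> e i \<in> J"
    using c e ep by simp
  then have "(c \<ominus>\<^bsub>F\<^esub> \<epsilon> i x) \<odot> e i \<in> J" using c e ep by (simp add: VR.act_minus_scalar)
  then have "c \<ominus>\<^bsub>F\<^esub> \<epsilon> i x = \<zero>\<^bsub>F\<^esub>" using c ep by (intro smult_e_in_J[OF i]) auto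
  then show ?thesis using c ep by (simp add: R.minus_eq_zero_iff)
qed

lemma eps_hom: "i < \<ell> A \<Longrightarrow> \<epsilon> i \<in> module_hom F (A\<lparr>carrier := corner i\<rparr>) (regular_module F)"
proof (rule module_homI; simp)
  note JF = ideal_subspace[OF J_ideal]
  fix x assume i: "i < \<ell> A" and x: "x \<in> corner i"
  note e = e_closed[OF i]
  show "\<epsilon> i x \<in> carrier F" by (rule eps(1)[OF i x])
  show "\<epsilon> i (x \<oplus> y) = \<epsilon> i x \<oplus>\<^bsub>F\<^esub> \<epsilon> i y" if y: "y \<in> corner i" for y
    using VR.submodule_add_cong[OF JF cornerD(1)[OF x] cornerD(1)[OF y] _ _ eps(2)[OF i x] eps(2)[OF i y]]
      eps(1)[OF i x] eps(1)[OF i y] e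
    by (intro eps_eqI[OF i corner_add[OF i x y]]) (auto simp: smult_l_distr)
  show "\<epsilon> i (a \<odot> x) = \<epsilon> i x \<otimes>\<^bsub>F\<^esub> a" if a: "a \<in> carrier F" for a
    using VR.submodule_act[OF JF a eps(2)[OF i x]] eps(1)[OF i x] e a cornerD(1)[OF x]
    by (intro eps_eqI[OF i corner_smult[OF i a x]]) (auto simp: VR.act_minus R.m_comm[of _ a] smult_assoc1)
qed

lemma eps_e: "i < \<ell> A \<Longrightarrow> \<epsilon> i (e i) = \<one>\<^bsub>F\<^esub>"
  using ideal_subspace[OF J_ideal] VR.submodule_zero e_closed
  by (intro eps_eqI corner_e) (auto simp: a_minus_def M.r_neg)

lemma eps_eq_zero_iff: "i < \<ell> A \<Longrightarrow> x \<in> corner i \<Longrightarrow> \<epsilon> i x = \<zero>\<^bsub>F\<^esub> \<longleftrightarrow> x \<in> J"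
  using eps[of i x] eps_eqI[of i x "\<zero>\<^bsub>F\<^esub>"] cornerD(1)[of x i] e_closed[of i] M.add.inv_one
  by (auto simp: a_minus_def a_inv_def)

text \<open>As \<open>e i\<close> is the identity of the corner, subtracting
  \<open>\<epsilon> i x \<odot> e i\<close> from \<open>x\<close> and likewise for \<open>y\<close>
  leaves the commutator unchanged. The differences lie in \<open>J\<close>, so their products lie in
  \<open>J2\<close>.\<close>

lemma corner_commute:
  assumes i: "i < \<ell> A" and x: "x \<in> corner i" and y: "y \<in> corner i"
  shows "x \<otimes> y \<ominus> y \<otimes> x \<in> J2"
proof -
  note xy = cornerD[OF x] cornerD[OF y] and e = e_closed[OF i]
  note ex = eps[OF i x] and ey = eps[OF i y]
  let ?x = "x \<ominus> \<epsilon> i x \<odot> e i" and ?y = "y \<ominus> \<epsilon> i y \<odot> e i"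
  have yc: "?y \<in> carrier A" "e i \<otimes> ?y = ?y" "?y \<otimes> e i = ?y"
    using cornerD[OF corner_minus[OF i y corner_smult[OF i ey(1) corner_e[OF i]]]] .
  have "?x \<otimes> ?y = (x \<otimes> y \<ominus> \<epsilon> i y \<odot> x) \<ominus> \<epsilon> i x \<odot> ?y"
  proof -
    have "?x \<otimes> ?y = x \<otimes> ?y \<ominus> (\<epsilon> i x \<odot> e i) \<otimes> ?y"
      using xy e ex ey by (simp add: a_minus_def A.l_distr A.l_minus)
    also have "x \<otimes> ?y = x \<otimes> y \<ominus> \<epsilon> i y \<odot> x"
      using xy e ex ey by (simp add: a_minus_def A.r_distr A.r_minus smult_mult_right)
    also have "(\<epsilon> i x \<odot> e i) \<otimes> ?y = \<epsilon> i x \<odot> ?y"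
      using yc e ex by (simp add: smult_mult_left)
    finally show ?thesis .
  qed
  moreover have "?y \<otimes> ?x = (y \<otimes> x \<ominus> \<epsilon> i y \<odot> x) \<ominus> \<epsilon> i x \<odot> ?y"
  proof -
    have "?y \<otimes> ?x = ?y \<otimes> x \<ominus> ?y \<otimes> (\<epsilon> i x \<odot> e i)"
      using xy e ex ey by (simp add: a_minus_def A.r_distr A.r_minus)
    also have "?y \<otimes> x = y \<otimes> x \<ominus> \<epsilon> i y \<odot> x"
      using xy e ex ey by (simp add: a_minus_def A.l_distr A.l_minus smult_mult_left)
    also have "?y \<otimes> (\<epsilon> i x \<odot> e i) = \<epsilon> i x \<odot> ?y"
      using yc e ex by (simp add: smult_mult_right)
    finally show ?thesis .
  qed
  ultimately have "x \<otimes> y \<ominus> y \<otimes> x = ?x \<otimes> ?y \<ominus> ?y \<otimes> ?x"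
    using xy e ex ey by (simp add: a_minus_def M.minus_add M.minus_minus M.a_ac M.r_neg1 M.r_neg2 M.r_neg M.l_neg)
  then show ?thesis
    using reg.submodule_minus[OF ideal_right_ideal[OF J2_ideal] J_mult_J[OF ex(2) ey(2)] J_mult_J[OF ey(2) ex(2)]]
    by simp
qed

lemma term_corner: "k \<in> K i \<Longrightarrow> x \<in> carrier A \<Longrightarrow> v k \<otimes> x \<otimes> u k \<in> corner i"
proof -
  assume k: "k \<in> K i" and x: "x \<in> carrier A"
  note kn = K_less[OF k]
  note c = u_closed[OF kn] v_closed[OF kn] e_closed[OF iota[OF kn]]
  have "e (\<iota> k) \<otimes> (v k \<otimes> x \<otimes> u k) = (e (\<iota> k) \<otimes> v k) \<otimes> x \<otimes> u k" using c x by (simp add: A.m_assoc)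
  moreover have "(v k \<otimes> x \<otimes> u k) \<otimes> e (\<iota> k) = v k \<otimes> x \<otimes> (u k \<otimes> e (\<iota> k))" using c x by (simp add: A.m_assoc)
  ultimately show ?thesis using u_e[OF kn] e_v[OF kn] c x K_iota[OF k] by (intro cornerI) auto
qed

lemma Tr_corner: "i < \<ell> A \<Longrightarrow> x \<in> carrier A \<Longrightarrow> Tr i x \<in> corner i"
  unfolding Tr_def using term_corner by (intro VR.submodule_finsum[OF corner_subspace]) auto

lemma Tr_closed: "x \<in> carrier A \<Longrightarrow> Tr i x \<in> carrier A"
  unfolding Tr_def using u_closed v_closed K_less by (intro M.finsum_closed) auto

lemma Tr_hom: "i < \<ell> A \<Longrightarrow> Tr i \<in> module_hom F A (A\<lparr>carrier := corner i\<rparr>)"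
proof (rule module_homI; simp)
  assume i: "i < \<ell> A"
  fix x assume x: "x \<in> carrier A"
  show "Tr i x \<in> corner i" by (rule Tr_corner[OF i x])
  show "Tr i (x \<oplus> y) = Tr i x \<oplus> Tr i y" if y: "y \<in> carrier A" for y
  proof -
    have "Tr i (x \<oplus> y) = (\<Oplus>k\<in>K i. v k \<otimes> x \<otimes> u k \<oplus> v k \<otimes> y \<otimes> u k)"
      unfolding Tr_def
      using x y u_closed v_closed K_less by (intro M.finsum_cong') (auto simp: A.l_distr A.r_distr)
    also have "\<dots> = Tr i x \<oplus> Tr i y"
      unfolding Tr_def using x y u_closed v_closed K_less by (intro M.finsum_addf) auto
    finally show ?thesis .
  qed
  show "Tr i (a \<odot> x) = a \<odot> Tr i x" if a: "a \<in> carrier F" for a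
  proof -
    have "Tr i (a \<odot> x) = (\<Oplus>k\<in>K i. a \<odot> (v k \<otimes> x \<otimes> u k))"
      unfolding Tr_def using x a u_closed v_closed K_less
      by (intro M.finsum_cong') (auto simp: smult_mult_left smult_mult_right)
    also have "\<dots> = a \<odot> Tr i x"
      unfolding Tr_def using x a u_closed v_closed K_less by (intro finsum_smult_ldistr[symmetric]) auto
    finally show ?thesis .
  qed
qed

lemma Tr_minus:
  assumes "i < \<ell> A" "x \<in> carrier A" "y \<in> carrier A" shows "Tr i (x \<ominus> y) = Tr i x \<ominus> Tr i y"
proof -
  have "Tr i \<in> module_hom F A A"
    using module_homD[OF Tr_hom[OF assms(1)]] Tr_closed by (intro module_homI) auto
  then show ?thesis using module_hom_minus[OF VR.right_module_axioms VR.right_module_axioms] assms(2,3) by blast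
qed

lemma Tr_ideal: "ideal N A \<Longrightarrow> x \<in> N \<Longrightarrow> Tr i x \<in> N"
  unfolding Tr_def
  by (rule VR.submodule_finsum[OF ideal_subspace])
    (auto dest: K_less simp: u_closed v_closed ideal.I_l_closed ideal.I_r_closed)

text \<open>For \<open>x\<close> replaced by \<open>v k x\<close> and \<open>y\<close> by
  \<open>y u m\<close> this is the product rule for the block matrices with entries
  \<open>v k x u m\<close>.\<close>

lemma insert_one:
  assumes "x \<in> carrier A" "y \<in> carrier A"
  shows "x \<otimes> y = (\<Oplus>k\<in>{..<n}. (x \<otimes> u k) \<otimes> (v k \<otimes> y))"
proof -
  have "x \<otimes> y = (x \<otimes> \<one>) \<otimes> y" using assms by simp
  also have "x \<otimes> \<one> = (\<Oplus>k\<in>{..<n}. x \<otimes> (u k \<otimes> v k))"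
    unfolding one_eq using assms u_closed v_closed by (intro A.finsum_rdistr) auto
  also have "\<dots> \<otimes> y = (\<Oplus>k\<in>{..<n}. x \<otimes> (u k \<otimes> v k) \<otimes> y)"
    using assms u_closed v_closed by (intro A.finsum_ldistr) auto
  also have "\<dots> = (\<Oplus>k\<in>{..<n}. (x \<otimes> u k) \<otimes> (v k \<otimes> y))"
    using assms u_closed v_closed by (intro M.finsum_cong') (auto simp: A.m_assoc)
  finally show ?thesis .
qed

text \<open>The identity is inserted between \<open>x\<close> and \<open>y\<close>. A term that
  passes through a foreign index \<open>m\<close> is a product of \<open>v k x u m\<close> and
  \<open>v m y u k\<close>, both of which lie in \<open>J\<close>.\<close>

lemma Tr_mult:
  assumes i: "i < \<ell> A" and x: "x \<in> carrier A" and y: "y \<in> carrier A"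
  shows "Tr i (x \<otimes> y) \<ominus> (\<Oplus>k\<in>K i. \<Oplus>m\<in>K i. (v k \<otimes> x \<otimes> u m) \<otimes> (v m \<otimes> y \<otimes> u k)) \<in> J2"
  unfolding Tr_def
proof (rule VR.submodule_finsum_cong[OF ideal_subspace[OF J2_ideal] K_finite])
  fix k assume k: "k \<in> K i"
  note kn = K_less[OF k]
  note c = u_closed[OF kn] v_closed[OF kn] e_closed[OF i]
  have ue: "u k \<otimes> e i = u k" "e i \<otimes> v k = v k" using u_e[OF kn] e_v[OF kn] K_iota[OF k] by auto
  show "v k \<otimes> (x \<otimes> y) \<otimes> u k \<in> carrier A" using c x y by simp
  show "(\<Oplus>m\<in>K i. (v k \<otimes> x \<otimes> u m) \<otimes> (v m \<otimes> y \<otimes> u k)) \<in> carrier A"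
    using c x y u_closed v_closed K_less by (intro M.finsum_closed) auto
  have "v k \<otimes> (x \<otimes> y) \<otimes> u k = (v k \<otimes> x) \<otimes> (y \<otimes> u k)" using c x y by (simp add: A.m_assoc)
  also have "\<dots> = (\<Oplus>m\<in>{..<n}. (v k \<otimes> x \<otimes> u m) \<otimes> (v m \<otimes> (y \<otimes> u k)))" using c x y by (intro insert_one) auto
  also have "\<dots> = (\<Oplus>m\<in>{..<n}. (v k \<otimes> x \<otimes> u m) \<otimes> (v m \<otimes> y \<otimes> u k))"
    using c x y u_closed v_closed by (intro M.finsum_cong') (auto simp: A.m_assoc)
  finally have eq: "v k \<otimes> (x \<otimes> y) \<otimes> u k = (\<Oplus>m\<in>{..<n}. (v k \<otimes> x \<otimes> u m) \<otimes> (v m \<otimes> y \<otimes> u k))" .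
  show "v k \<otimes> (x \<otimes> y) \<otimes> u k \<ominus> (\<Oplus>m\<in>K i. (v k \<otimes> x \<otimes> u m) \<otimes> (v m \<otimes> y \<otimes> u k)) \<in> J2"
    unfolding eq
  proof (rule VR.submodule_finsum_subset[OF ideal_subspace[OF J2_ideal] _ K_subset])
    fix m assume m: "m \<in> {..<n} - K i"
    then have mn: "m < n" and ne: "\<iota> m \<noteq> i" by (auto simp: K_def)
    note cm = u_closed[OF mn] v_closed[OF mn]
    have "v k \<otimes> x \<otimes> u m = e i \<otimes> (v k \<otimes> x) \<otimes> u m" using ue c cm x by (simp add: A.m_assoc[symmetric])
    moreover have "v m \<otimes> y \<otimes> u k = v m \<otimes> (y \<otimes> u k) \<otimes> e i" using ue c cm y by (simp add: A.m_assoc)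
    ultimately show "(v k \<otimes> x \<otimes> u m) \<otimes> (v m \<otimes> y \<otimes> u k) \<in> J2"
      using e_u_in_J[OF i mn ne, of "v k \<otimes> x"] v_e_in_J[OF i mn ne, of "y \<otimes> u k"] c x y by (auto intro: J_mult_J)
  qed (use c x y u_closed v_closed in auto)
qed

lemma vxu_corner: "\<lbrakk>i < \<ell> A; k \<in> K i; m \<in> K i; x \<in> carrier A\<rbrakk> \<Longrightarrow> v k \<otimes> x \<otimes> u m \<in> corner i"
  using u_closed[of m] v_closed[of k] u_e[of m] e_v[of k] e_closed[of i]
  by (intro cornerI) (auto simp: K_def A.m_assoc A.m_assoc[of "e i" "v k", symmetric])

text \<open>The usual proof that a trace is symmetric: the double sum is reordered and its factors
  are swapped, which is allowed modulo \<open>J2\<close> because they lie in one corner.\<close>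

lemma Tr_commute:
  assumes i: "i < \<ell> A" and x: "x \<in> carrier A" and y: "y \<in> carrier A"
  shows "Tr i (x \<otimes> y) \<ominus> Tr i (y \<otimes> x) \<in> J2"
proof -
  note N = ideal_subspace[OF J2_ideal]
  have cl: "v k \<otimes> z \<otimes> u m \<in> carrier A" if "k \<in> K i" "m \<in> K i" "z \<in> carrier A" for k m z
    using cornerD(1)[OF vxu_corner[OF i that]] .
  let ?D = "\<lambda>x y. \<Oplus>k\<in>K i. \<Oplus>m\<in>K i. (v k \<otimes> x \<otimes> u m) \<otimes> (v m \<otimes> y \<otimes> u k)"
  have D: "?D x y \<in> carrier A" "?D y x \<in> carrier A"
    using cl x y by (auto intro!: M.finsum_closed)
  have "?D x y \<ominus> (\<Oplus>k\<in>K i. \<Oplus>m\<in>K i. (v m \<otimes> y \<otimes> u k) \<otimes> (v k \<otimes> x \<otimes> u m)) \<in> J2"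
    using cl x y corner_commute[OF i vxu_corner[OF i] vxu_corner[OF i]]
    by (intro VR.submodule_finsum_cong[OF N]) (auto intro!: M.finsum_closed)
  moreover have "(\<Oplus>k\<in>K i. \<Oplus>m\<in>K i. (v m \<otimes> y \<otimes> u k) \<otimes> (v k \<otimes> x \<otimes> u m)) = ?D y x"
    using cl x y by (intro M.finsum_swap) auto
  ultimately have "?D x y \<ominus> ?D y x \<in> J2" by simp
  from VR.submodule_minus_trans[OF N _ D Tr_mult[OF i x y] this]
  have "Tr i (x \<otimes> y) \<ominus> ?D y x \<in> J2" using Tr_closed x y by simp
  moreover have "?D y x \<ominus> Tr i (y \<otimes> x) \<in> J2"
    using VR.submodule_minus_commute[OF N _ D(2) Tr_mult[OF i y x]] Tr_closed x y by simp
  ultimately show ?thesis using VR.submodule_minus_trans[OF N _ D(2)] Tr_closed x y by simp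
qed

text \<open>Modulo \<open>J2\<close>, \<open>z = z e i\<close> is the sum of the products
  \<open>(z u k) (v k e i)\<close> over block \<open>i\<close>. Both factors lie in the corner, and
  swapping them gives the terms of the trace.\<close>

lemma Tr_corner_same:
  assumes i: "i < \<ell> A" and z: "z \<in> corner i"
  shows "Tr i z \<ominus> z \<in> J2"
proof -
  note N = ideal_subspace[OF J2_ideal] and zD = cornerD[OF z] and e = e_closed[OF i]
  have cl: "u k \<in> carrier A" "v k \<in> carrier A" if "k < n" for k using that u_closed v_closed by auto
  have K: "u k \<in> carrier A" "v k \<in> carrier A" "u k \<otimes> e i = u k" "e i \<otimes> v k = v k" if "k \<in> K i" for k
    using that cl u_e e_v by (auto simp: K_def)
  have "z = z \<otimes> e i" using zD by simp
  also have "\<dots> = (\<Oplus>k\<in>{..<n}. (z \<otimes> u k) \<otimes> (v k \<otimes> e i))" using zD e by (intro insert_one) auto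
  finally have zeq: "z = (\<Oplus>k\<in>{..<n}. (z \<otimes> u k) \<otimes> (v k \<otimes> e i))" .
  let ?s = "\<Oplus>k\<in>K i. (z \<otimes> u k) \<otimes> (v k \<otimes> e i)"
  have s: "?s \<in> carrier A" using zD e K by (auto intro!: M.finsum_closed)
  have "(\<Oplus>k\<in>{..<n}. (z \<otimes> u k) \<otimes> (v k \<otimes> e i)) \<ominus> ?s \<in> J2"
  proof (rule VR.submodule_finsum_subset[OF N _ K_subset])
    fix k assume "k \<in> {..<n} - K i"
    then have k: "k < n" "\<iota> k \<noteq> i" by (auto simp: K_def)
    have "z \<otimes> u k = e i \<otimes> z \<otimes> u k" "v k \<otimes> e i = v k \<otimes> \<one> \<otimes> e i" using zD cl[OF k(1)] e by auto
    then show "(z \<otimes> u k) \<otimes> (v k \<otimes> e i) \<in> J2"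
      using e_u_in_J[OF i k zD(1)] v_e_in_J[OF i k A.one_closed] J_mult_J by simp
  qed (use zD e cl in auto)
  then have "?s \<ominus> z \<in> J2" using VR.submodule_minus_commute[OF N zD(1) s] zeq by simp
  moreover have "Tr i z \<ominus> ?s \<in> J2"
    unfolding Tr_def
  proof (rule VR.submodule_finsum_cong[OF N K_finite])
    fix k assume k: "k \<in> K i"
    note c = K[OF k]
    have ve: "v k \<otimes> e i \<in> corner i" and zu: "z \<otimes> u k \<in> corner i"
      using c zD e e_idem[OF i] by (auto intro!: cornerI simp: A.m_assoc) (auto simp: A.m_assoc[symmetric])
    have "v k \<otimes> z \<otimes> u k = (v k \<otimes> e i) \<otimes> (z \<otimes> u k)"
    proof -
      have "(v k \<otimes> e i) \<otimes> (z \<otimes> u k) = v k \<otimes> (e i \<otimes> z) \<otimes> u k" using c zD(1) e by (simp add: A.m_assoc)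
      then show ?thesis using zD by simp
    qed
    then show "v k \<otimes> z \<otimes> u k \<ominus> (z \<otimes> u k) \<otimes> (v k \<otimes> e i) \<in> J2"
      using corner_commute[OF i ve zu] by simp
  qed (use K zD e in auto)
  ultimately show ?thesis using VR.submodule_minus_trans[OF N Tr_closed[OF zD(1)] s zD(1)] by blast
qed

text \<open>With \<open>z = z e j e j\<close>, each term splits into \<open>v k z e j\<close> and
  \<open>e j u k\<close>; both lie in \<open>J\<close> because \<open>k\<close> belongs to block
  \<open>i\<close>.\<close>

lemma Tr_corner_other:
  assumes i: "i < \<ell> A" and j: "j < \<ell> A" and ne: "i \<noteq> j" and z: "z \<in> corner j"
  shows "Tr i z \<in> J2"
  unfolding Tr_def
proof (rule VR.submodule_finsum[OF ideal_subspace[OF J2_ideal] K_finite], rule funcsetI)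
  fix k assume k: "k \<in> K i"
  note kn = K_less[OF k] and zD = cornerD[OF z] and e = e_closed[OF j]
  note c = u_closed[OF kn] v_closed[OF kn]
  have "\<iota> k \<noteq> j" using K_iota[OF k] ne by simp
  note in_J = e_u_in_J[OF j kn this A.one_closed] v_e_in_J[OF j kn this zD(1)]
  have "v k \<otimes> z \<otimes> u k = (v k \<otimes> z \<otimes> e j) \<otimes> (e j \<otimes> \<one> \<otimes> u k)"
  proof -
    have "(v k \<otimes> z \<otimes> e j) \<otimes> (e j \<otimes> \<one> \<otimes> u k) = v k \<otimes> (z \<otimes> e j \<otimes> e j) \<otimes> u k" using c e zD(1) by (simp add: A.m_assoc)
    then show ?thesis using zD by simp
  qed
  then show "v k \<otimes> z \<otimes> u k \<in> J2" using in_J J_mult_J by simp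
qed

text \<open>Here \<open>x\<close> is the sum of the products \<open>(x u k) (v k)\<close>, and
  swapping the two factors of each product costs a commutator.\<close>

lemma trace_sum_commutator:
  assumes x: "x \<in> carrier A"
  shows "x \<ominus> (\<Oplus>k\<in>{..<n}. v k \<otimes> x \<otimes> u k) \<in> commutator_space F A"
proof -
  have "x = x \<otimes> \<one>" using x by simp
  also have "\<dots> = (\<Oplus>k\<in>{..<n}. (x \<otimes> u k) \<otimes> (v k \<otimes> \<one>))" using x by (intro insert_one) auto
  finally have "x \<ominus> (\<Oplus>k\<in>{..<n}. v k \<otimes> x \<otimes> u k) =
      (\<Oplus>k\<in>{..<n}. (x \<otimes> u k) \<otimes> (v k \<otimes> \<one>)) \<ominus> (\<Oplus>k\<in>{..<n}. v k \<otimes> x \<otimes> u k)" by simp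
  also have "\<dots> \<in> commutator_space F A"
  proof (rule VR.submodule_finsum_cong[OF commutator_space_subspace])
    fix k assume "k \<in> {..<n}"
    then have c: "u k \<in> carrier A" "v k \<in> carrier A" using u_closed v_closed by auto
    show "(x \<otimes> u k) \<otimes> (v k \<otimes> \<one>) \<ominus> v k \<otimes> x \<otimes> u k \<in> commutator_space F A"
      using commutator_in_space[of "x \<otimes> u k" "v k"] c x by (simp add: A.m_assoc)
  qed (use x u_closed v_closed in auto)
  finally show ?thesis .
qed

lemma trace_sum_eq:
  assumes x: "x \<in> carrier A"
  shows "(\<Oplus>k\<in>{..<n}. v k \<otimes> x \<otimes> u k) = (\<Oplus>i\<in>{..<\<ell> A}. Tr i x)"
proof -
  have "{..<n} = (\<Union>i\<in>{..<\<ell> A}. K i)" using iota by (auto simp: K_def)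
  moreover have "(\<Oplus>k\<in>(\<Union>i\<in>{..<\<ell> A}. K i). v k \<otimes> x \<otimes> u k) = (\<Oplus>i\<in>{..<\<ell> A}. Tr i x)"
    unfolding Tr_def
    by (rule M.add.finprod_UN_disjoint[folded finsum_def, simplified])
       (use x u_closed v_closed in \<open>auto simp: K_def pairwise_def disjnt_def\<close>)
  ultimately show ?thesis by simp
qed

text \<open>The coordinates on the corners are pulled back along the traces. An element is killed by
  all of them when its traces lie in \<open>N\<close>. These elements are exactly those of the sum:
  commutators have trace in \<open>J2\<close>, and modulo commutators an element is the sum of its
  traces.\<close>

lemma codim_commutator_plus_ideal:
  fixes B :: "nat \<Rightarrow> 'j set"
  assumes N: "ideal N A" "J2 \<subseteq> N"
    and B: "\<And>i. i < \<ell> A \<Longrightarrow> finite (B i)"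
    and d: "\<And>i. i < \<ell> A \<Longrightarrow> dual_family F (A\<lparr>carrier := corner i\<rparr>) (B i) (b i) (c i)"
    and ker: "\<And>i x. \<lbrakk>i < \<ell> A; x \<in> corner i\<rbrakk> \<Longrightarrow> x \<in> N \<longleftrightarrow> (\<forall>j\<in>B i. c i j x = \<zero>\<^bsub>F\<^esub>)"
  shows "codim F A (commutator_space F A <+>\<^bsub>A\<^esub> N) = (\<Sum>i<\<ell> A. card (B i))"
proof -
  define I where "I = (SIGMA i:{..<\<ell> A}. B i)"
  \<comment> \<open>Coordinates of the \<open>i\<close>-th trace, indexed by block and
    position.\<close>
  define C where "C = (\<lambda>(i, j) x. c i j (Tr i x))"
  note NF = ideal_subspace[OF N(1)]
  have NA: "N \<subseteq> carrier A" by (rule VR.submodule_subset[OF NF])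
  have finI: "finite I" unfolding I_def using B by auto
  have Chom: "C p \<in> module_hom F A (regular_module F)" if "p \<in> I" for p
    using that module_hom_comp[OF Tr_hom dual_familyD(2)[OF d]] by (auto simp: I_def C_def)
  have C_minus: "C p (x \<ominus> y) = C p x \<ominus>\<^bsub>F\<^esub> C p y" if "p \<in> I" "x \<in> carrier A" "y \<in> carrier A" for p x y
    using module_hom_minus[OF VR.right_module_axioms regular_right_module[OF R.ring_axioms] Chom[OF that(1)] that(2,3)]
    by simp
  have C_closed: "C p x \<in> carrier F" if "p \<in> I" "x \<in> carrier A" for p x
    using module_homD(1)[OF Chom] that by simp
  have kerC: "(\<forall>p\<in>I. C p x = \<zero>\<^bsub>F\<^esub>) \<longleftrightarrow> (\<forall>i<\<ell> A. Tr i x \<in> N)" if "x \<in> carrier A" for x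
    using ker[OF _ Tr_corner] that by (auto simp: I_def C_def)
  have dual: "C p (case q of (i, j) \<Rightarrow> b i j) = (if p = q then \<one>\<^bsub>F\<^esub> else \<zero>\<^bsub>F\<^esub>)" if p: "p \<in> I" and q: "q \<in> I" for p q
  proof -
    obtain i j i' j' where pq: "p = (i, j)" "q = (i', j')" "i < \<ell> A" "i' < \<ell> A" "j \<in> B i" "j' \<in> B i'"
      using p q by (auto simp: I_def)
    have b: "b i' j' \<in> corner i'" using dual_familyD(1)[OF d[OF pq(4)] pq(6)] by simp
    show ?thesis
    proof (cases "i = i'")
      case True
      let ?b = "b i j'"
      note h = dual_familyD(2)[OF d[OF pq(3)] pq(5)]
      have bc: "?b \<in> corner i" "Tr i ?b \<in> corner i" using b True Tr_corner[OF pq(3)] cornerD(1) by auto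
      \<comment> \<open>On its own corner the trace is the identity modulo \<open>N\<close>, so
        \<open>C\<close> takes the same values as \<open>c\<close>.\<close>
      have "Tr i ?b \<ominus> ?b \<in> N" using Tr_corner_same[OF pq(3) bc(1)] N(2) by blast
      then have "c i j (Tr i ?b \<ominus> ?b) = \<zero>\<^bsub>F\<^esub>" using ker[OF pq(3)] corner_minus[OF pq(3) bc(2,1)] pq(5) by blast
      moreover have "c i j (Tr i ?b) = c i j (Tr i ?b \<ominus> ?b) \<oplus>\<^bsub>F\<^esub> c i j ?b"
        using module_homD(2)[OF h, of "Tr i ?b \<ominus> ?b" ?b] corner_minus[OF pq(3) bc(2,1)] bc cornerD(1)[OF bc(1)] cornerD(1)[OF bc(2)]
        by (simp add: a_minus_def M.a_assoc M.l_neg)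
      ultimately show ?thesis
        using pq True dual_familyD(3)[OF d[OF pq(3)] pq(5), of j'] by (auto simp: C_def)
    next
      case False
      then have "Tr i (b i' j') \<in> N" using Tr_corner_other[OF pq(3,4) False b] N(2) by blast
      then have "c i j (Tr i (b i' j')) = \<zero>\<^bsub>F\<^esub>"
        using ker[OF pq(3) Tr_corner[OF pq(3) cornerD(1)[OF b]]] pq(5) by blast
      then show ?thesis using pq False by (auto simp: C_def)
    qed
  qed
  have "dual_family F A I (\<lambda>(i, j). b i j) C"
  proof -
    have "b i j \<in> carrier A" if "i < \<ell> A" "j \<in> B i" for i j
      using dual_familyD(1)[OF d[OF that(1)] that(2)] cornerD(1) by simp
    with Chom dual show ?thesis unfolding dual_family_def by (auto simp: I_def)
  qed
  from codim_dual_family[OF vectorspace_axioms finI this]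
  have "codim F A {x \<in> carrier A. \<forall>p\<in>I. C p x = \<zero>\<^bsub>F\<^esub>} = card I" .
  moreover have "{x \<in> carrier A. \<forall>p\<in>I. C p x = \<zero>\<^bsub>F\<^esub>} = commutator_space F A <+>\<^bsub>A\<^esub> N"
  proof (intro Set.equalityI subsetI)
    fix x assume "x \<in> {x \<in> carrier A. \<forall>p\<in>I. C p x = \<zero>\<^bsub>F\<^esub>}"
    then have x: "x \<in> carrier A" and T: "\<And>i. i < \<ell> A \<Longrightarrow> Tr i x \<in> N" using kerC by auto
    let ?s = "\<Oplus>k\<in>{..<n}. v k \<otimes> x \<otimes> u k"
    \<comment> \<open>All traces of \<open>x\<close> lie in \<open>N\<close>, hence so does their
      sum, which differs from \<open>x\<close> by commutators.\<close>
    have s: "?s \<in> N" unfolding trace_sum_eq[OF x] using T by (intro VR.submodule_finsum[OF NF]) auto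
    have "s' \<in> carrier A \<Longrightarrow> (x \<ominus> s') \<oplus> s' = x" for s' using x by (simp add: a_minus_def M.a_assoc M.l_neg)
    then have eq: "(x \<ominus> ?s) \<oplus> ?s = x" using s NA by blast
    have "(x \<ominus> ?s) \<oplus> ?s \<in> commutator_space F A <+>\<^bsub>A\<^esub> N"
      using trace_sum_commutator[OF x] s unfolding set_add_def' by blast
    then show "x \<in> commutator_space F A <+>\<^bsub>A\<^esub> N" by (simp only: eq)
  next
    let ?W = "{x \<in> carrier A. \<forall>p\<in>I. C p x = \<zero>\<^bsub>F\<^esub>}"
    have W: "Module.submodule ?W F A" by (rule dual_family_kernel_submodule[OF vectorspace_axioms Chom])
    have "N \<subseteq> ?W" using kerC NA Tr_ideal[OF N(1)] by blast
    moreover have "commutator_space F A \<subseteq> ?W"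
    proof -
      have "x \<otimes> y \<ominus> y \<otimes> x \<in> ?W" if xy: "x \<in> carrier A" "y \<in> carrier A" for x y
      proof -
        have "Tr i (x \<otimes> y \<ominus> y \<otimes> x) \<in> N" if "i < \<ell> A" for i
          using Tr_commute[OF that xy] N(2) Tr_minus[OF that] xy by auto
        then show ?thesis using kerC[of "x \<otimes> y \<ominus> y \<otimes> x"] xy by simp
      qed
      then show ?thesis unfolding commutator_space_def by (intro span_least[OF _ W]) blast
    qed
    ultimately have "y \<oplus> z \<in> ?W" if "y \<in> commutator_space F A" "z \<in> N" for y z
      using that VR.submodule_add[OF W] by blast
    moreover fix x assume "x \<in> commutator_space F A <+>\<^bsub>A\<^esub> N"
    ultimately show "x \<in> ?W" unfolding set_add_def' by blast
  qed
  moreover have "card I = (\<Sum>i<\<ell> A. card (B i))" unfolding I_def using B by simp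
  ultimately show ?thesis by simp
qed

section \<open>The codimensions of \<open>KR^1\<close> and \<open>KR^2\<close>\<close>

lemma codim_KR1: "codim F A (KR F A 1) = \<ell> A"
proof -
  \<comment> \<open>Modulo \<open>J\<close> each corner is a line: one coordinate, the residue, dual
    to \<open>e i\<close>.\<close>
  have "codim F A (KR F A 1) = (\<Sum>i<\<ell> A. card {()})"
    unfolding KR_1
  proof (rule codim_commutator_plus_ideal[OF J_ideal J2_subset])
    fix i assume i: "i < \<ell> A"
    show "dual_family F (A\<lparr>carrier := corner i\<rparr>) {()} (\<lambda>_. e i) (\<lambda>_. \<epsilon> i)"
      using corner_e[OF i] eps_hom[OF i] eps_e[OF i] by (simp add: dual_family_def)
  qed (auto simp: eps_eq_zero_iff)
  then show ?thesis by simp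
qed

text \<open>A basis of \<open>eJe\<close> modulo the square of the radical, with its coordinate functions.\<close>

definition radical_basis :: "nat \<Rightarrow> 'a set \<Rightarrow> ('a \<Rightarrow> 'a \<Rightarrow> 'f) \<Rightarrow> bool" where
  "radical_basis i I c \<longleftrightarrow> finite I \<and> I \<subseteq> corner i \<inter> J \<and>
    dual_family F (A\<lparr>carrier := corner i \<inter> J\<rparr>) I (\<lambda>b. b) c \<and>
    (\<forall>x \<in> corner i \<inter> J. x \<in> J2 \<longleftrightarrow> (\<forall>b\<in>I. c b x = \<zero>\<^bsub>F\<^esub>))"

lemma corner_J_subspace: "i < \<ell> A \<Longrightarrow> Module.submodule (corner i \<inter> J) F A"
  using corner_subspace[of i] ideal_subspace[OF J_ideal] by (auto simp: VR.submodule_iff)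

lemma radical_basis_exists: "i < \<ell> A \<Longrightarrow> \<exists>I c. radical_basis i I c"
  using dual_family_exists[OF vectorspace_axioms fin corner_J_subspace ideal_subspace[OF J2_ideal]]
  unfolding radical_basis_def by metis

text \<open>A corner is the sum of the line through \<open>e i\<close> and its radical part, so
  \<open>e i\<close> together with a radical basis is a basis modulo \<open>J2\<close>.\<close>

lemma codim_KR2:
  assumes I: "\<And>i. i < \<ell> A \<Longrightarrow> radical_basis i (I i) (c i)"
  shows "codim F A (KR F A 2) = \<ell> A + (\<Sum>i<\<ell> A. card (I i))"
proof -
  note I = I[unfolded radical_basis_def]
  \<comment> \<open>\<open>c i b\<close> is linear only on the radical part of the corner, so the
    scalar part of \<open>x\<close> is removed before it is applied.\<close>
  define d where "d i b x = (if b = e i then \<epsilon> i x else c i b (x \<ominus> \<epsilon> i x \<odot> e i))" for i b x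
  have ne: "e i \<notin> I i" if "i < \<ell> A" for i using I[OF that] e_notin_J[OF that] by blast
  have rad: "x \<ominus> \<epsilon> i x \<odot> e i \<in> corner i \<inter> J" if "i < \<ell> A" "x \<in> corner i" for i x
    using that eps[OF that] corner_minus corner_smult corner_e by auto
  have rad_J: "x \<ominus> \<epsilon> i x \<odot> e i = x" if "i < \<ell> A" "x \<in> corner i \<inter> J" for i x
    using that eps_eq_zero_iff[of i x] cornerD(1)[of x i] e_closed[of i] M.add.inv_one
    by (simp add: a_minus_def a_inv_def)
  have "codim F A (KR F A 2) = (\<Sum>i<\<ell> A. card (insert (e i) (I i)))"
    unfolding KR_2
  proof (rule codim_commutator_plus_ideal[OF J2_ideal subset_refl])
    fix i assume i: "i < \<ell> A"
    note Ii = I[OF i] and ei = e_closed[OF i]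
    have dI: "dual_family F (A\<lparr>carrier := corner i \<inter> J\<rparr>) (I i) (\<lambda>b. b) (c i)" using Ii by blast
    note hom = module_homD[OF dual_familyD(2)[OF dI], simplified]
    show "finite (insert (e i) (I i))" using Ii by simp
    have zero: "c i b \<zero> = \<zero>\<^bsub>F\<^esub>" if "b \<in> I i" for b
      using module_hom_zero[OF VR.submodule_right_module[OF corner_J_subspace[OF i]] regular_right_module[OF R.ring_axioms] dual_familyD(2)[OF dI that]]
      by simp
    have lin: "d i b \<in> module_hom F (A\<lparr>carrier := corner i\<rparr>) (regular_module F)" if b: "b \<in> insert (e i) (I i)" for b
    proof (cases "b = e i")
      case True
      then have "d i b = \<epsilon> i" by (auto simp: d_def)
      then show ?thesis using eps_hom[OF i] by simp
    next
      case False
      with b have b: "b \<in> I i" by simp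
      note E = module_homD[OF eps_hom[OF i], simplified]
      have "d i b = (\<lambda>x. c i b (x \<ominus> \<epsilon> i x \<odot> e i))" using False by (simp add: d_def fun_eq_iff)
      also have "\<dots> \<in> module_hom F (A\<lparr>carrier := corner i\<rparr>) (regular_module F)"
      proof (rule module_homI; simp)
        fix x assume x: "x \<in> corner i"
        show "c i b (x \<ominus> \<epsilon> i x \<odot> e i) \<in> carrier F" using hom(1)[OF b] rad[OF i x] by simp
        show "c i b (x \<oplus> y \<ominus> \<epsilon> i (x \<oplus> y) \<odot> e i) = c i b (x \<ominus> \<epsilon> i x \<odot> e i) \<oplus>\<^bsub>F\<^esub> c i b (y \<ominus> \<epsilon> i y \<odot> e i)"
          if y: "y \<in> corner i" for y
        proof -
          have "x \<oplus> y \<ominus> \<epsilon> i (x \<oplus> y) \<odot> e i = (x \<ominus> \<epsilon> i x \<odot> e i) \<oplus> (y \<ominus> \<epsilon> i y \<odot> e i)"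
            using E x y cornerD(1)[OF x] cornerD(1)[OF y] ei
            by (simp add: a_minus_def smult_l_distr M.minus_add M.a_ac)
          then show ?thesis using hom(2)[OF b] rad[OF i x] rad[OF i y] by simp
        qed
        show "c i b (a \<odot> x \<ominus> \<epsilon> i (a \<odot> x) \<odot> e i) = c i b (x \<ominus> \<epsilon> i x \<odot> e i) \<otimes>\<^bsub>F\<^esub> a"
          if a: "a \<in> carrier F" for a
        proof -
          have "a \<odot> x \<ominus> \<epsilon> i (a \<odot> x) \<odot> e i = a \<odot> (x \<ominus> \<epsilon> i x \<odot> e i)"
            using E x a cornerD(1)[OF x] ei
            by (simp add: VR.act_minus R.m_comm[of _ a] smult_assoc1)
          then show ?thesis using hom(3)[OF b a] rad[OF i x] by simp
        qed
      qed
      finally show ?thesis .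
    qed
    have "d i b b' = (if b = b' then \<one>\<^bsub>F\<^esub> else \<zero>\<^bsub>F\<^esub>)"
      if b: "b \<in> insert (e i) (I i)" and b': "b' \<in> insert (e i) (I i)" for b b'
    proof (cases "b' = e i")
      case True
      have "e i \<ominus> \<epsilon> i (e i) \<odot> e i = \<zero>" using eps_e[OF i] ei by (simp add: a_minus_def M.r_neg)
      then show ?thesis using True b eps_e[OF i] zero by (auto simp: d_def)
    next
      case False
      then have b'I: "b' \<in> I i" "b' \<in> corner i \<inter> J" using b' Ii by auto
      show ?thesis
      proof (cases "b = e i")
        case True
        then show ?thesis using False b'I eps_eq_zero_iff[OF i] by (simp add: d_def)
      next
        case False
        then show ?thesis using dual_familyD(3)[OF dI _ b'I(1), of b] b rad_J[OF i b'I(2)] by (simp add: d_def)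
      qed
    qed
    then show "dual_family F (A\<lparr>carrier := corner i\<rparr>) (insert (e i) (I i)) (\<lambda>b. b) (d i)"
      unfolding dual_family_def using lin Ii corner_e[OF i] by auto
    fix x assume x: "x \<in> corner i"
    show "x \<in> J2 \<longleftrightarrow> (\<forall>b\<in>insert (e i) (I i). d i b x = \<zero>\<^bsub>F\<^esub>)"
    proof (cases "x \<in> J")
      case True
      then have xJ: "x \<in> corner i \<inter> J" using x by simp
      have "x \<in> J2 \<longleftrightarrow> (\<forall>b\<in>I i. c i b x = \<zero>\<^bsub>F\<^esub>)" using Ii xJ by blast
      moreover have "d i (e i) x = \<zero>\<^bsub>F\<^esub>" using eps_eq_zero_iff[OF i x] True by (simp add: d_def)
      moreover have "d i b x = c i b x" if "b \<in> I i" for b using that ne[OF i] rad_J[OF i xJ] by (auto simp: d_def)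
      ultimately show ?thesis by simp
    next
      case False
      then show ?thesis using J2_subset eps_eq_zero_iff[OF i x] by (auto simp: d_def)
    qed
  qed
  also have "\<dots> = (\<Sum>i<\<ell> A. 1 + card (I i))"
    using I ne by (intro sum.cong refl) auto
  also have "\<dots> = \<ell> A + (\<Sum>i<\<ell> A. card (I i))" by (subst sum.distrib) simp
  finally show ?thesis .
qed

section \<open>Bounds for the codimension of the commutator space\<close>

lemma codim_KR2_le: "codim F A (KR F A 2) \<le> codim F A (commutator_space F A)"
proof (rule codim_antimono[OF vectorspace_axioms fin commutator_space_subspace])
  show "Module.submodule (KR F A 2) F A"
    unfolding KR_2 by (rule VR.sum_submodule[OF commutator_space_subspace ideal_subspace[OF J2_ideal]])
  show "commutator_space F A \<subseteq> KR F A 2"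
  proof
    fix x assume x: "x \<in> commutator_space F A"
    then have "x = x \<oplus> \<zero>" using VR.submodule_subset[OF commutator_space_subspace] by auto
    then show "x \<in> KR F A 2"
      unfolding KR_2 set_add_def' using x VR.submodule_zero[OF ideal_subspace[OF J2_ideal]] by blast
  qed
qed

text \<open>Modulo commutators an element is the sum of its traces, so spanning sets of the corners
  together span the quotient.\<close>

lemma codim_commutator_space_le:
  assumes Y: "\<And>i. i < \<ell> A \<Longrightarrow> finite (Y i)" "\<And>i. i < \<ell> A \<Longrightarrow> Y i \<subseteq> carrier A"
    and sp: "\<And>i. i < \<ell> A \<Longrightarrow> corner i \<subseteq> span (Y i)"
  shows "codim F A (commutator_space F A) \<le> (\<Sum>i<\<ell> A. card (Y i))"
proof -
  let ?Y = "\<Union>i<\<ell> A. Y i"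
  have Y': "finite ?Y" "?Y \<subseteq> carrier A" using Y by auto
  have "\<exists>y\<in>span ?Y. x \<ominus> y \<in> commutator_space F A" if x: "x \<in> carrier A" for x
  proof
    let ?s = "\<Oplus>k\<in>{..<n}. v k \<otimes> x \<otimes> u k"
    show "x \<ominus> ?s \<in> commutator_space F A" by (rule trace_sum_commutator[OF x])
    have "Tr i x \<in> span ?Y" if "i < \<ell> A" for i
      using Tr_corner[OF that x] sp[OF that] span_is_monotone[of "Y i" ?Y] that by blast
    then show "?s \<in> span ?Y"
      unfolding trace_sum_eq[OF x] by (intro VR.submodule_finsum[OF span_submodule[OF Y'(2)]]) auto
  qed
  then have "codim F A (commutator_space F A) \<le> card ?Y"
    using codim_le_card(2)[OF vectorspace_axioms commutator_space_subspace Y'] by blast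
  also have "\<dots> \<le> (\<Sum>i<\<ell> A. card (Y i))" by (rule card_UN_le) simp
  finally show ?thesis .
qed

end

section \<open>Composition series and projective covers\<close>

definition submodule_chain :: "('a, 'k) ring_scheme \<Rightarrow> ('a, 'm) module \<Rightarrow> nat \<Rightarrow> (nat \<Rightarrow> 'm set) \<Rightarrow> bool" where
  "submodule_chain A M n N \<longleftrightarrow> N 0 = {\<zero>\<^bsub>M\<^esub>} \<and> N n = carrier M \<and>
    (\<forall>k\<le>n. Module.submodule (N k) A M) \<and> (\<forall>k<n. N k \<subset> N (Suc k))"

text \<open>In a chain of greatest length no step can be refined, so every factor is simple.\<close>

lemma maximal_chain_composition_series:
  fixes M :: "('a, 'm) module"
  assumes M: "right_module A M" and N: "submodule_chain A M n N"
    and max: "\<And>n' N'. submodule_chain A M n' N' \<Longrightarrow> n' \<le> n"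
  shows "composition_series A M n N"
proof -
  interpret right_module A M by fact
  note N = N[unfolded submodule_chain_def]
  have "simple_module A (comp_factor M N k)" if k: "k < n" for k
    unfolding comp_factor_def
  proof (rule quot_module_simple)
    have S: "Module.submodule (N (Suc k)) A M" "Module.submodule (N k) A M" "N k \<subset> N (Suc k)" using N k by auto
    show "right_module A (M\<lparr>carrier := N (Suc k)\<rparr>)" by (rule submodule_right_module[OF S(1)])
    show "Module.submodule (N k) A (M\<lparr>carrier := N (Suc k)\<rparr>)" using S submodule_of_submodule[OF S(1)] by auto
    show "N k \<noteq> carrier (M\<lparr>carrier := N (Suc k)\<rparr>)" using S(3) by auto
    fix Y assume Y: "Module.submodule Y A (M\<lparr>carrier := N (Suc k)\<rparr>)" "N k \<subseteq> Y"
    have Y': "Module.submodule Y A M" "Y \<subseteq> N (Suc k)" using Y(1) submodule_of_submodule[OF S(1)] by auto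
    show "Y = N k \<or> Y = carrier (M\<lparr>carrier := N (Suc k)\<rparr>)"
    proof (rule ccontr)
      assume ne: "\<not> ?thesis"
      \<comment> \<open>\<open>Y\<close> is inserted at position \<open>Suc k\<close>, and the later
        members move up by one.\<close>
      let ?N = "\<lambda>j. if j \<le> k then N j else if j = Suc k then Y else N (j - 1)"
      have "submodule_chain A M (Suc n) ?N"
        unfolding submodule_chain_def
      proof (intro conjI allI impI)
        fix j assume "j < Suc n"
        then consider "j < k" | "j = k" | "j = Suc k" | "j > Suc k" "j - 1 < n" "Suc (j - 1) = j" by linarith
        then show "?N j \<subset> ?N (Suc j)"
        proof cases
          case 4
          then have "N (j - 1) \<subset> N (Suc (j - 1))" using N by blast
          then show ?thesis using 4 by simp
        qed (use N k Y Y' ne in auto)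
      qed (use N k Y' in auto)
      from max[OF this] show False by simp
    qed
  qed
  then show ?thesis unfolding composition_series_def using M N by auto
qed

context split_algebra begin

text \<open>\<open>M\<close> is an image of \<open>A\<close> under \<open>a \<mapsto> z a\<close>.
  Preimages of a strict chain of submodules form a strict chain of subspaces of \<open>A\<close>, so
  \<open>dim\<close> bounds the length and a longest chain exists.\<close>

lemma composition_series_exists:
  fixes M :: "('a, 'p) module"
  assumes M: "right_module A M" and z: "z \<in> carrier M" and gen: "(\<lambda>a. a \<odot>\<^bsub>M\<^esub> z) ` carrier A = carrier M"
  shows "\<exists>n N. composition_series A M n N"
proof -
  interpret M: right_module A M by fact
  obtain r :: "'a set \<Rightarrow> nat" where b: "\<And>U. r U \<le> dim"
    and r: "\<And>U U'. Module.submodule U F A \<Longrightarrow> Module.submodule U' F A \<Longrightarrow> U \<subset> U' \<Longrightarrow> r U < r U'"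
    using rank_exists[OF fin] by metis
  have bound: "n \<le> dim" if N: "submodule_chain A M n N" for n N
  proof -
    note N = N[unfolded submodule_chain_def]
    define U where "U k = {a \<in> carrier A. a \<odot>\<^bsub>M\<^esub> z \<in> N k}" for k
    have U: "Module.submodule (U k) F A" if "k \<le> n" for k
      using submodule_vimage[OF reg.right_module_axioms M.right_module_axioms M.act_hom[OF z], of "N k"] N that
      unfolding U_def by (intro right_ideal_subspace) simp
    have strict: "U k \<subset> U (Suc k)" if k: "k < n" for k
    proof -
      have Nk: "N k \<subset> N (Suc k)" "N (Suc k) \<subseteq> carrier M" using N k M.submodule_subset by auto
      then obtain x where x: "x \<in> N (Suc k)" "x \<notin> N k" by blast
      then have "x \<in> (\<lambda>a. a \<odot>\<^bsub>M\<^esub> z) ` carrier A" using Nk(2) unfolding gen by blast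
      then obtain a where "a \<in> carrier A" "x = a \<odot>\<^bsub>M\<^esub> z" by blast
      with x Nk show ?thesis by (auto simp: U_def)
    qed
    have "k \<le> r (U k)" if "k \<le> n" for k
      using that
    proof (induction k)
      case (Suc k)
      then have "r (U k) < r (U (Suc k))" using r[OF U U strict] by simp
      with Suc show ?case by simp
    qed simp
    then have "n \<le> r (U n)" by simp
    also have "\<dots> \<le> dim" by (rule b)
    finally show ?thesis .
  qed
  have whole: "Module.submodule (carrier M) A M" "Module.submodule {\<zero>\<^bsub>M\<^esub>} A M"
    by (auto simp: M.submodule_iff M.act_closed M.act_zero)
  have "\<exists>n N. submodule_chain A M n N"
  proof (cases "carrier M = {\<zero>\<^bsub>M\<^esub>}")
    case True
    then have "submodule_chain A M 0 (\<lambda>_. carrier M)" using whole by (simp add: submodule_chain_def)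
    then show ?thesis by blast
  next
    case False
    then have "submodule_chain A M 1 (\<lambda>k. if k = 0 then {\<zero>\<^bsub>M\<^esub>} else carrier M)"
      using whole by (auto simp: submodule_chain_def)
    then show ?thesis by blast
  qed
  then obtain n0 where "\<exists>N. submodule_chain A M n0 N" by blast
  then obtain n where "\<exists>N. submodule_chain A M n N" "\<And>n'. \<exists>N. submodule_chain A M n' N \<Longrightarrow> n' \<le> n"
    using ex_has_greatest_nat[of "\<lambda>n. \<exists>N. submodule_chain A M n N" n0 "\<lambda>n. n" "Suc dim"] bound
    by (metis le_imp_less_Suc)
  then show ?thesis using maximal_chain_composition_series[OF M] by blast
qed

end

section \<open>The projective covers of the \<open>S i\<close>\<close>

context basic_idempotents begin

abbreviation eA :: "nat \<Rightarrow> ('a, 'a) module" where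
  "eA i \<equiv> (regular_module A)\<lparr>carrier := {x \<in> carrier A. e i \<otimes> x = x}\<rparr>"

lemma eA_right_ideal: "i < \<ell> A \<Longrightarrow> right_ideal {x \<in> carrier A. e i \<otimes> x = x}"
  unfolding reg.submodule_iff by (auto simp: e_closed A.r_distr A.m_assoc[symmetric])

lemma eA_right_module: "i < \<ell> A \<Longrightarrow> right_module A (eA i)"
  by (rule reg.submodule_right_module[OF eA_right_ideal])

lemma eA_act_hom:
  assumes "right_module A M" "m \<in> carrier M" shows "(\<lambda>x. x \<odot>\<^bsub>M\<^esub> m) \<in> module_hom A (eA i) M"
proof -
  interpret M: right_module A M by fact
  show ?thesis using assms(2) by (intro module_homI) (auto simp: M.act_closed M.act_add_scalar M.act_mult)
qed

text \<open>The kernel of \<open>x \<mapsto> w i x\<close> is the only maximal submodule of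
  \<open>eA i\<close>: a submodule not inside it contains \<open>e i\<close> by minimality.\<close>

lemma eA_submodule:
  assumes i: "i < \<ell> A" and U: "Module.submodule U A (eA i)" and u: "u \<in> U" "u \<odot>\<^bsub>S i\<^esub> w i \<noteq> \<zero>\<^bsub>S i\<^esub>"
  shows "U = carrier (eA i)"
proof -
  have R: "right_ideal U" "U \<subseteq> {x \<in> carrier A. e i \<otimes> x = x}"
    using U reg.submodule_of_submodule[OF eA_right_ideal[OF i]] by auto
  then have "e i \<in> U" using e_minimal[OF i R _ u(1) w_closed[OF i]] u(2) by blast
  then have "x \<in> U" if "x \<in> carrier A" "e i \<otimes> x = x" for x
    using reg.submodule_act[OF R(1) that(1) \<open>e i \<in> U\<close>] that(2) by simp
  with R(2) show ?thesis by auto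
qed

lemma eA_surj: "i < \<ell> A \<Longrightarrow> (\<lambda>x. x \<odot>\<^bsub>S i\<^esub> w i) ` carrier (eA i) = carrier (S i)"
proof -
  assume i: "i < \<ell> A"
  interpret Si: right_module A "S i" by (rule S_module[OF i])
  note e = e_closed[OF i] and w = w_closed[OF i]
  show ?thesis
  proof
    show "carrier (S i) \<subseteq> (\<lambda>x. x \<odot>\<^bsub>S i\<^esub> w i) ` carrier (eA i)"
    proof
      fix s assume "s \<in> carrier (S i)"
      then obtain a where a: "a \<in> carrier A" "s = a \<odot>\<^bsub>S i\<^esub> w i"
        using simple_module_cyclic[OF simple[OF i] w w_nonzero[OF i]] by (metis (no_types, lifting) imageE)
      then have "s = (e i \<otimes> a) \<odot>\<^bsub>S i\<^esub> w i" using e w e_w[OF i] by (simp add: Si.act_mult)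
      moreover have "e i \<otimes> a \<in> carrier (eA i)" using a e e_idem[OF i] by (simp add: A.m_assoc[symmetric])
      ultimately show "s \<in> (\<lambda>x. x \<odot>\<^bsub>S i\<^esub> w i) ` carrier (eA i)" by blast
    qed
  qed (use w in \<open>auto simp: Si.act_closed\<close>)
qed

text \<open>This witness guarantees that the choice in \<open>proj_cover\<close> returns a
  projective cover.\<close>

lemma eA_projective_cover:
  assumes i: "i < \<ell> A" shows "projective_cover A (eA i) (\<lambda>x. x \<odot>\<^bsub>S i\<^esub> w i) (S i)"
  unfolding projective_cover_def
proof (intro conjI allI impI)
  interpret E: right_module A "eA i" by (rule eA_right_module[OF i])
  note e = e_closed[OF i] and w = w_closed[OF i]
  let ?p = "\<lambda>x. x \<odot>\<^bsub>S i\<^esub> w i"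
  have p: "?p \<in> module_hom A (eA i) (S i)" by (rule eA_act_hom[OF S_module[OF i] w])
  show "projective_module A (eA i)"
    unfolding projective_module_def
  proof (intro conjI allI impI E.right_module_axioms)
    fix M :: "('a, 'a \<Rightarrow> 'a) module" and N :: "('a, 'a) module" and g f
    assume H: "right_module A M \<and> right_module A N \<and> g \<in> module_hom A M N \<and>
      g ` carrier M = carrier N \<and> f \<in> module_hom A (eA i) N"
    then have M: "right_module A M" and g: "g \<in> module_hom A M N" "g ` carrier M = carrier N"
      and f: "f \<in> module_hom A (eA i) N" by blast+
    have ei: "e i \<in> carrier (eA i)" using e e_idem[OF i] by simp
    have "f (e i) \<in> g ` carrier M" unfolding g(2) by (rule module_homD(1)[OF f ei])
    \<comment> \<open>Any preimage of \<open>f (e i)\<close> will do: \<open>x \<mapsto> m x\<close>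
      is the restriction of a map on \<open>A\<close>, and
      \<open>f (e i) x = f (e i x) = f x\<close> on \<open>eA i\<close>.\<close>
    then obtain m where m: "m \<in> carrier M" "g m = f (e i)" by auto
    have "g (x \<odot>\<^bsub>M\<^esub> m) = f x" if x: "x \<in> carrier (eA i)" for x
    proof -
      have "g (x \<odot>\<^bsub>M\<^esub> m) = x \<odot>\<^bsub>N\<^esub> f (e i)" using module_homD(3)[OF g(1) _ m(1), of x] m(2) x by simp
      also have "\<dots> = f (x \<odot>\<^bsub>eA i\<^esub> e i)" using module_homD(3)[OF f _ ei, of x] x by simp
      also have "x \<odot>\<^bsub>eA i\<^esub> e i = x" using x by simp
      finally show ?thesis .
    qed
    then have "\<forall>x\<in>carrier (eA i). g (x \<odot>\<^bsub>M\<^esub> m) = f x" by (rule ballI)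
    then show "\<exists>h\<in>module_hom A (eA i) M. \<forall>x\<in>carrier (eA i). g (h x) = f x"
      by (rule bexI[of _ "\<lambda>x. x \<odot>\<^bsub>M\<^esub> m", OF _ eA_act_hom[OF M m(1)]])
  qed
  show "right_module A (S i)" by (rule S_module[OF i])
  show "?p \<in> module_hom A (eA i) (S i)" by (rule p)
  show "?p ` carrier (eA i) = carrier (S i)" by (rule eA_surj[OF i])
  fix U assume U: "Module.submodule U A (eA i) \<and> U <+>\<^bsub>eA i\<^esub> a_kernel (eA i) (S i) ?p = carrier (eA i)"
  show "U = carrier (eA i)"
  proof (rule ccontr)
    assume ne: "U \<noteq> carrier (eA i)"
    \<comment> \<open>A proper \<open>U\<close> and the kernel both annihilate \<open>w i\<close>,
      so their sum cannot contain \<open>e i\<close>.\<close>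
    have "e i \<in> U <+>\<^bsub>eA i\<^esub> a_kernel (eA i) (S i) ?p" using U e e_idem[OF i] by simp
    then obtain x y where xy: "x \<in> U" "y \<in> carrier (eA i)" "?p y = \<zero>\<^bsub>S i\<^esub>" "e i = x \<oplus>\<^bsub>eA i\<^esub> y"
      unfolding set_add_def' a_kernel_def' by blast
    have px: "?p x = \<zero>\<^bsub>S i\<^esub>" using eA_submodule[OF i _ xy(1)] U ne by blast
    have "x \<in> carrier (eA i)" using U E.submodule_subset xy(1) by blast
    then have "?p (x \<oplus>\<^bsub>eA i\<^esub> y) = ?p x \<oplus>\<^bsub>S i\<^esub> ?p y" using xy(2) by (rule module_homD(2)[OF p])
    moreover have "?p (e i) = ?p (x \<oplus>\<^bsub>eA i\<^esub> y)" by (rule arg_cong[OF xy(4)])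
    ultimately have "?p (e i) = \<zero>\<^bsub>S i\<^esub> \<oplus>\<^bsub>S i\<^esub> \<zero>\<^bsub>S i\<^esub>" using px xy(3) by simp
    also have "\<dots> = \<zero>\<^bsub>S i\<^esub>"
      using abelian_monoid.l_zero[OF abelian_group.axioms(1)[OF right_module.axioms(2)[OF S_module[OF i]]]]
        abelian_monoid.zero_closed[OF abelian_group.axioms(1)[OF right_module.axioms(2)[OF S_module[OF i]]]]
          by simp
    finally show False using e_w[OF i] w_nonzero[OF i] by simp
  qed
qed

lemma projective_cover_cyclic:
  fixes P :: "('a, 'p) module"
  assumes i: "i < \<ell> A" and P: "projective_cover A P p (S i)"
  obtains z where "z \<in> carrier P" "(\<lambda>a. a \<odot>\<^bsub>P\<^esub> z) ` carrier A = carrier P"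
proof -
  have rP: "right_module A P" and p: "p \<in> module_hom A P (S i)" "p ` carrier P = carrier (S i)"
    and sup: "\<And>U. Module.submodule U A P \<and> U <+>\<^bsub>P\<^esub> a_kernel P (S i) p = carrier P \<Longrightarrow> U = carrier P"
    using P unfolding projective_cover_def projective_module_def by blast+
  interpret P: right_module A P by (rule rP)
  interpret Si: right_module A "S i" by (rule S_module[OF i])
  obtain z where z: "z \<in> carrier P" "p z = w i" using p(2) w_closed[OF i] by (metis (no_types, lifting) imageE)
  let ?U = "(\<lambda>a. a \<odot>\<^bsub>P\<^esub> z) ` carrier A"
  have U: "Module.submodule ?U A P"
    by (rule submodule_image[OF reg.right_module_axioms rP P.act_hom[OF z(1)] A.right_ideal_carrier])
  have "?U <+>\<^bsub>P\<^esub> a_kernel P (S i) p = carrier P"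
  proof
    show "?U <+>\<^bsub>P\<^esub> a_kernel P (S i) p \<subseteq> carrier P"
      unfolding set_add_def' a_kernel_def' using z by (auto simp: P.act_closed)
    show "carrier P \<subseteq> ?U <+>\<^bsub>P\<^esub> a_kernel P (S i) p"
    proof
      fix x assume x: "x \<in> carrier P"
      then have "p x \<in> carrier (S i)" using module_homD(1)[OF p(1)] by simp
      then obtain a where a: "a \<in> carrier A" "p x = a \<odot>\<^bsub>S i\<^esub> w i"
        using simple_module_cyclic[OF simple[OF i] w_closed[OF i] w_nonzero[OF i]]
        by (metis (no_types, lifting) imageE)
      have az: "a \<odot>\<^bsub>P\<^esub> z \<in> carrier P" using a z by (simp add: P.act_closed)
      have "p (x \<ominus>\<^bsub>P\<^esub> a \<odot>\<^bsub>P\<^esub> z) = \<zero>\<^bsub>S i\<^esub>"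
        using module_hom_minus[OF rP S_module[OF i] p(1) x az] module_homD(3)[OF p(1) a(1) z(1)] a z w_closed[OF i]
        by (simp add: a_minus_def Si.M.r_neg Si.act_closed)
      moreover have "a \<odot>\<^bsub>P\<^esub> z \<oplus>\<^bsub>P\<^esub> (x \<ominus>\<^bsub>P\<^esub> a \<odot>\<^bsub>P\<^esub> z) = x"
        using x az by (simp add: a_minus_def P.M.a_ac P.M.r_neg2 P.M.r_neg)
      ultimately show "x \<in> ?U <+>\<^bsub>P\<^esub> a_kernel P (S i) p"
        unfolding set_add_def' a_kernel_def' using x az a(1)
        by (auto intro!: bexI[of _ a] exI[of _ "x \<ominus>\<^bsub>P\<^esub> a \<odot>\<^bsub>P\<^esub> z"])
    qed
  qed
  with U sup have "?U = carrier P" by blast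
  with z that show thesis by blast
qed

end

section \<open>Composition factors and the size of the corners\<close>

context decomposition begin

text \<open>The image of \<open>y\<close> in the factor is nonzero and fixed by \<open>e i\<close>.
  This identifies the factor with \<open>S i\<close> and makes every fixed vector in it a multiple
  of the image of \<open>y\<close>.\<close>

lemma comp_factor_not_iso:
  fixes P :: "('a, 'p) module"
  assumes i: "i < \<ell> A" and N: "composition_series A P len N" and k: "k < len"
    and y: "y \<in> N (Suc k)" "e i \<odot>\<^bsub>P\<^esub> y = y" "y \<notin> N k"
  shows "module_iso A (comp_factor P N k) (S i)"
    and "\<And>x. \<lbrakk>x \<in> N (Suc k); e i \<odot>\<^bsub>P\<^esub> x = x\<rbrakk> \<Longrightarrow> \<exists>c\<in>carrier F. x \<ominus>\<^bsub>P\<^esub> (c \<odot> \<one>) \<odot>\<^bsub>P\<^esub> y \<in> N k"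
proof -
  note N = N[unfolded composition_series_def]
  interpret P: right_module A P using N by blast
  have S: "Module.submodule (N (Suc k)) A P" "Module.submodule (N k) A P" "N k \<subseteq> N (Suc k)" using N k by auto
  let ?M = "P\<lparr>carrier := N (Suc k)\<rparr>" and ?q = "\<lambda>x. N k +>\<^bsub>P\<lparr>carrier := N (Suc k)\<rparr>\<^esub> x"
  interpret M: right_module A ?M by (rule P.submodule_right_module[OF S(1)])
  have Nk: "Module.submodule (N k) A ?M" using P.submodule_of_submodule[OF S(1)] S by simp
  have T: "simple_module A (quot_module ?M (N k))" using N k by (simp add: comp_factor_def)
  interpret T: right_module A "quot_module ?M (N k)" by (rule simple_moduleD(1)[OF T])
  note e = e_closed[OF i]
  have q: "?q x \<in> carrier (quot_module ?M (N k))" if "x \<in> N (Suc k)" for x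
    using that M.quot_carrier[OF Nk] by auto
  have act: "a \<odot>\<^bsub>quot_module ?M (N k)\<^esub> ?q x = ?q (a \<odot>\<^bsub>P\<^esub> x)" if "a \<in> carrier A" "x \<in> N (Suc k)" for a x
    using M.quot_act[OF Nk that(1)] that(2) by simp
  have y0: "?q y \<noteq> \<zero>\<^bsub>quot_module ?M (N k)\<^esub>" using M.coset_eq_zero_iff[OF Nk] y by simp
  show "module_iso A (comp_factor P N k) (S i)"
    unfolding comp_factor_def using simple_iso_S[OF i T q[OF y(1)]] act[OF e y(1)] y(2) y0 by simp
  fix x assume x: "x \<in> N (Suc k)" "e i \<odot>\<^bsub>P\<^esub> x = x"
  obtain c where c: "c \<in> carrier F" "?q x = (c \<odot> \<one>) \<odot>\<^bsub>quot_module ?M (N k)\<^esub> ?q y"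
    using simple_corner_scalar[OF i T q[OF y(1)] y0 _ q[OF x(1)]] act[OF e y(1)] act[OF e x(1)] y(2) x(2) by metis
  have c1: "c \<odot> \<one> \<in> carrier A" using c(1) by simp
  have cy: "(c \<odot> \<one>) \<odot>\<^bsub>P\<^esub> y \<in> N (Suc k)" by (rule P.submodule_act[OF S(1) c1 y(1)])
  have "x \<ominus>\<^bsub>?M\<^esub> (c \<odot> \<one>) \<odot>\<^bsub>P\<^esub> y \<in> N k"
    using c(2) M.coset_eq_iff[OF Nk] x(1) cy act[OF c1 y(1)] by simp
  then have "x \<ominus>\<^bsub>P\<^esub> (c \<odot> \<one>) \<odot>\<^bsub>P\<^esub> y \<in> N k" using P.submodule_minus_eq[OF S(1) x(1) cy] by simp
  then show "\<exists>c\<in>carrier F. x \<ominus>\<^bsub>P\<^esub> (c \<odot> \<one>) \<odot>\<^bsub>P\<^esub> y \<in> N k" using c(1) by blast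
qed

text \<open>The vectors of \<open>P\<close> fixed by \<open>e i\<close> map onto the corner.
  Climbing the composition series, they gain at most one dimension per step, and only at steps whose
  factor is isomorphic to \<open>S i\<close>.\<close>

lemma corner_span:
  fixes P :: "('a, 'p) module"
  assumes i: "i < \<ell> A" and N: "composition_series A P len N"
    and h: "h \<in> module_hom A P (eA i)" "h ` carrier P = carrier (eA i)"
  obtains Y where "finite Y" "Y \<subseteq> carrier A" "corner i \<subseteq> span Y"
    "card Y \<le> card {k. k < len \<and> module_iso A (comp_factor P N k) (S i)}"
proof -
  note ND = N[unfolded composition_series_def]
  interpret P: right_module A P using ND by blast
  note e = e_closed[OF i]
  \<comment> \<open>\<open>good k y\<close>: a vector fixed by \<open>e i\<close> that is new at
    step \<open>k\<close>. \<open>I m\<close> collects the steps below \<open>m\<close> where one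
    exists, and \<open>g\<close> maps one such vector into \<open>A\<close>.\<close>
  define good where "good k y \<longleftrightarrow> y \<in> N (Suc k) \<and> e i \<odot>\<^bsub>P\<^esub> y = y \<and> y \<notin> N k" for k y
  define g where "g k = h (SOME y. good k y)" for k
  define I where "I m = {k. k < m \<and> (\<exists>y. good k y)}" for m
  have finI: "finite (I m)" for m by (simp add: I_def)
  have good: "good k (SOME y. good k y)" if "k \<in> I m" for k m
    using that someI_ex[of "good k"] by (simp add: I_def)
  have Nsub: "Module.submodule (N k) A P" "N k \<subseteq> carrier P" if "k \<le> len" for k
    using ND that P.submodule_subset by auto
  have gA: "g ` I m \<subseteq> carrier A" if "m \<le> len" for m
  proof
    fix x assume "x \<in> g ` I m"
    then obtain k where k: "k \<in> I m" "x = g k" by blast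
    then have "(SOME y. good k y) \<in> carrier P"
      using good[OF k(1)] Nsub(2)[of "Suc k"] that by (auto simp: good_def I_def)
    then show "x \<in> carrier A" using module_homD(1)[OF h(1)] k(2) by (auto simp: g_def)
  qed
  have claim: "h x \<in> span (g ` I m)" if "m \<le> len" "x \<in> N m" "e i \<odot>\<^bsub>P\<^esub> x = x" for m x
    using that
  proof (induction m arbitrary: x)
    case 0
    then have "x = \<zero>\<^bsub>P\<^esub>" using ND by simp
    then have "h x = \<zero>" using module_hom_zero[OF P.right_module_axioms eA_right_module[OF i] h(1)] by simp
    then show ?case using VR.submodule_zero[OF span_submodule[OF gA]] 0 by simp
  next
    case (Suc m)
    then have m: "m < len" "m \<le> len" by auto
    have sp: "span (g ` I m) \<subseteq> span (g ` I (Suc m))" by (rule span_is_monotone) (auto simp: I_def)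
    show ?case
    proof (cases "x \<in> N m")
      case True
      then show ?thesis using Suc.IH[OF m(2) True Suc.prems(3)] sp by blast
    next
      case False
      then have mI: "m \<in> I (Suc m)" using Suc.prems by (auto simp: I_def good_def)
      define y where "y = (SOME y. good m y)"
      have y: "y \<in> N (Suc m)" "e i \<odot>\<^bsub>P\<^esub> y = y" "y \<notin> N m" using good[OF mI] by (auto simp: good_def y_def)
      \<comment> \<open>A multiple of the new vector corrects \<open>x\<close> into
        \<open>N m\<close>; the difference is still fixed by \<open>e i\<close> because scalars are
        central.\<close>
      obtain c where c: "c \<in> carrier F" "x \<ominus>\<^bsub>P\<^esub> (c \<odot> \<one>) \<odot>\<^bsub>P\<^esub> y \<in> N m"
        using comp_factor_not_iso(2)[OF i N m(1) y Suc.prems(2,3)] by blast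
      have c1: "c \<odot> \<one> \<in> carrier A" using c(1) by simp
      have xP: "x \<in> carrier P" and yP: "y \<in> carrier P" using Nsub(2)[OF Suc.prems(1)] Suc.prems(2) y(1) by auto
      have cy: "(c \<odot> \<one>) \<odot>\<^bsub>P\<^esub> y \<in> carrier P" by (rule P.act_closed[OF c1 yP])
      have comm: "(c \<odot> \<one>) \<otimes> e i = e i \<otimes> (c \<odot> \<one>)" using c(1) e by (simp add: smult_mult_left smult_mult_right)
      have "e i \<odot>\<^bsub>P\<^esub> ((c \<odot> \<one>) \<odot>\<^bsub>P\<^esub> y) = (c \<odot> \<one>) \<odot>\<^bsub>P\<^esub> y"
        using P.act_mult[OF c1 e yP] P.act_mult[OF e c1 yP] comm y(2) by simp
      then have "e i \<odot>\<^bsub>P\<^esub> (x \<ominus>\<^bsub>P\<^esub> (c \<odot> \<one>) \<odot>\<^bsub>P\<^esub> y) = x \<ominus>\<^bsub>P\<^esub> (c \<odot> \<one>) \<odot>\<^bsub>P\<^esub> y"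
        using P.act_minus[OF e xP cy] Suc.prems(3) by simp
      from Suc.IH[OF m(2) c(2) this] have 1: "h (x \<ominus>\<^bsub>P\<^esub> (c \<odot> \<one>) \<odot>\<^bsub>P\<^esub> y) \<in> span (g ` I (Suc m))" using sp by blast
      have hy: "h y \<in> carrier A" using module_homD(1)[OF h(1) yP] by simp
      have "h ((c \<odot> \<one>) \<odot>\<^bsub>P\<^esub> y) = c \<odot> h y"
        using module_homD(3)[OF h(1) c1 yP] hy c(1) by (simp add: smult_mult_right)
      moreover have "h y \<in> span (g ` I (Suc m))"
        using subsetD[OF in_own_span[OF gA[OF Suc.prems(1)]]] mI by (simp add: g_def y_def)
      ultimately have 2: "h ((c \<odot> \<one>) \<odot>\<^bsub>P\<^esub> y) \<in> span (g ` I (Suc m))"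
        using VR.submodule_act[OF span_submodule[OF gA[OF Suc.prems(1)]] c(1)] by simp
      have "x = (x \<ominus>\<^bsub>P\<^esub> (c \<odot> \<one>) \<odot>\<^bsub>P\<^esub> y) \<oplus>\<^bsub>P\<^esub> (c \<odot> \<one>) \<odot>\<^bsub>P\<^esub> y"
        using xP cy P.M.a_assoc P.M.l_neg unfolding a_minus_def by (metis P.M.a_inv_closed P.M.r_zero)
      then have "h x = h (x \<ominus>\<^bsub>P\<^esub> (c \<odot> \<one>) \<odot>\<^bsub>P\<^esub> y) \<oplus> h ((c \<odot> \<one>) \<odot>\<^bsub>P\<^esub> y)"
        using module_homD(2)[OF h(1) _ cy, of "x \<ominus>\<^bsub>P\<^esub> (c \<odot> \<one>) \<odot>\<^bsub>P\<^esub> y"] xP cy by simp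
      then show ?thesis
        using VR.submodule_add[OF span_submodule[OF gA[OF Suc.prems(1)]] 1 2] by simp
    qed
  qed
  show thesis
  proof
    show "finite (g ` I len)" "g ` I len \<subseteq> carrier A" using finI gA by auto
    show "corner i \<subseteq> span (g ` I len)"
    proof
      fix x assume x: "x \<in> corner i"
      note xD = cornerD[OF x]
      have "x \<in> h ` carrier P" unfolding h(2) using xD by simp
      then obtain y where y: "y \<in> carrier P" "x = h y" by blast
      \<comment> \<open>A preimage of a corner element becomes fixed after applying
        \<open>e i\<close>, and its image stays \<open>x\<close> because
        \<open>x e i = x\<close>.\<close>
      have ey: "e i \<odot>\<^bsub>P\<^esub> y \<in> carrier P" "e i \<odot>\<^bsub>P\<^esub> (e i \<odot>\<^bsub>P\<^esub> y) = e i \<odot>\<^bsub>P\<^esub> y"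
        using e y(1) e_idem[OF i] by (auto simp: P.act_closed P.act_mult[symmetric])
      have "h (e i \<odot>\<^bsub>P\<^esub> y) = x" using module_homD(3)[OF h(1) e y(1)] y(2) xD by simp
      then show "x \<in> span (g ` I len)" using claim[of len "e i \<odot>\<^bsub>P\<^esub> y"] ey ND by simp
    qed
    have "card (g ` I len) \<le> card (I len)" by (rule card_image_le[OF finI])
    also have "\<dots> \<le> card {k. k < len \<and> module_iso A (comp_factor P N k) (S i)}"
      using comp_factor_not_iso(1)[OF i N] by (intro card_mono) (auto simp: I_def good_def)
    finally show "card (g ` I len) \<le> card {k. k < len \<and> module_iso A (comp_factor P N k) (S i)}" .
  qed
qed

text \<open>Lifting \<open>p\<close> through \<open>eA i\<close> gives \<open>h\<close>. A preimage
  of \<open>w i\<close> is sent outside the maximal submodule of \<open>eA i\<close>, so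
  \<open>h\<close> is onto.\<close>

lemma projective_cover_onto_eA:
  fixes P :: "('a, 'p) module"
  assumes i: "i < \<ell> A" and P: "projective_cover A P p (S i)"
  obtains h where "h \<in> module_hom A P (eA i)" "h ` carrier P = carrier (eA i)"
proof -
  have pP: "projective_module A P" and p: "p \<in> module_hom A P (S i)" "p ` carrier P = carrier (S i)"
    using P unfolding projective_cover_def by blast+
  have rP: "right_module A P" using pP unfolding projective_module_def by blast
  interpret P: right_module A P by (rule rP)
  from projective_lift[OF pP eA_right_module[OF i] S_module[OF i] eA_act_hom[OF S_module[OF i] w_closed[OF i]] eA_surj[OF i] p(1)]
  obtain h where h: "h \<in> module_hom A P (eA i)" "\<forall>x\<in>carrier P. h x \<odot>\<^bsub>S i\<^esub> w i = p x" by (rule bexE)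
  have "Module.submodule (carrier P) A P" by (simp add: P.submodule_iff P.act_closed)
  from submodule_image[OF rP eA_right_module[OF i] h(1) this] have im: "Module.submodule (h ` carrier P) A (eA i)" .
  obtain z where z: "z \<in> carrier P" "p z = w i" using p(2) w_closed[OF i] by (metis (no_types, lifting) imageE)
  have "h ` carrier P = carrier (eA i)"
    by (rule eA_submodule[OF i im, of "h z"]) (use z h(2) w_nonzero[OF i] in auto)
  with h(1) that show thesis by blast
qed

lemma codim_commutator_space_le_trace:
  "codim F A (commutator_space F A) \<le> mat_trace (cartan_matrix A S)"
proof -
  let ?C = "\<lambda>i. comp_multiplicity A (proj_cover A (S i)) (S i)"
  have ex: "\<exists>Y. finite Y \<and> Y \<subseteq> carrier A \<and> corner i \<subseteq> span Y \<and> card Y \<le> ?C i" if i: "i < \<ell> A" for i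
  proof -
    let ?P = "proj_cover A (S i)"
    obtain p where P: "projective_cover A ?P p (S i)"
      using someI_ex[of "\<lambda>P :: ('a, 'a) module. \<exists>p. projective_cover A P p (S i)"] eA_projective_cover[OF i]
      unfolding proj_cover_def by blast
    have rP: "right_module A ?P" using P by (simp add: projective_cover_def projective_module_def)
    obtain z where "z \<in> carrier ?P" "(\<lambda>a. a \<odot>\<^bsub>?P\<^esub> z) ` carrier A = carrier ?P"
      by (rule projective_cover_cyclic[OF i P])
    \<comment> \<open>The multiplicity is a choice as well: it counts factors in some series, and
      the span bound is applied to that very series.\<close>
    from composition_series_exists[OF rP this] obtain len N where
      "\<exists>len N. composition_series A ?P len N \<and> ?C i = card {k. k < len \<and> module_iso A (comp_factor ?P N k) (S i)}"
      using someI_ex[of "\<lambda>m. \<exists>len N. composition_series A ?P len N \<and> m = card {k. k < len \<and> module_iso A (comp_factor ?P N k) (S i)}"]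
      unfolding comp_multiplicity_def by blast
    then obtain len N where N: "composition_series A ?P len N"
      "?C i = card {k. k < len \<and> module_iso A (comp_factor ?P N k) (S i)}" by blast
    obtain h where h: "h \<in> module_hom A ?P (eA i)" "h ` carrier ?P = carrier (eA i)"
      by (rule projective_cover_onto_eA[OF i P])
    show ?thesis using corner_span[OF i N(1) h] N(2) by metis
  qed
  then obtain Y where Y: "\<And>i. i < \<ell> A \<Longrightarrow> finite (Y i) \<and> Y i \<subseteq> carrier A \<and> corner i \<subseteq> span (Y i) \<and> card (Y i) \<le> ?C i"
    by metis
  have "codim F A (commutator_space F A) \<le> (\<Sum>i<\<ell> A. card (Y i))"
    using Y by (intro codim_commutator_space_le) auto
  also have "\<dots> \<le> (\<Sum>i<\<ell> A. ?C i)" using Y by (intro sum_mono) auto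
  also have "\<dots> = mat_trace (cartan_matrix A S)" by (simp add: mat_trace_def cartan_matrix_def)
  finally show ?thesis .
qed

end

section \<open>Extensions\<close>

context assoc_algebra begin

lemma scalar_central: "\<lbrakk>c \<in> carrier F; a \<in> carrier A\<rbrakk> \<Longrightarrow> a \<otimes>\<^bsub>A\<^esub> (c \<odot>\<^bsub>A\<^esub> \<one>\<^bsub>A\<^esub>) = (c \<odot>\<^bsub>A\<^esub> \<one>\<^bsub>A\<^esub>) \<otimes>\<^bsub>A\<^esub> a"
  by (simp add: smult_mult_left smult_mult_right)

context
  fixes N :: "('a, 'n) module"
  assumes N: "right_module A N"
begin

interpretation N: right_module A N by (rule N)

lemma scalar_act_commute:
  "\<lbrakk>c \<in> carrier F; a \<in> carrier A; x \<in> carrier N\<rbrakk> \<Longrightarrow>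
    (c \<odot>\<^bsub>A\<^esub> \<one>\<^bsub>A\<^esub>) \<odot>\<^bsub>N\<^esub> (a \<odot>\<^bsub>N\<^esub> x) = a \<odot>\<^bsub>N\<^esub> ((c \<odot>\<^bsub>A\<^esub> \<one>\<^bsub>A\<^esub>) \<odot>\<^bsub>N\<^esub> x)"
  by (simp add: N.act_mult[symmetric] scalar_central)

lemma scalar_act_mult:
  "\<lbrakk>c \<in> carrier F; d \<in> carrier F; x \<in> carrier N\<rbrakk> \<Longrightarrow>
    ((c \<otimes>\<^bsub>F\<^esub> d) \<odot>\<^bsub>A\<^esub> \<one>\<^bsub>A\<^esub>) \<odot>\<^bsub>N\<^esub> x = (c \<odot>\<^bsub>A\<^esub> \<one>\<^bsub>A\<^esub>) \<odot>\<^bsub>N\<^esub> ((d \<odot>\<^bsub>A\<^esub> \<one>\<^bsub>A\<^esub>) \<odot>\<^bsub>N\<^esub> x)"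
  using N.act_mult[of "d \<odot>\<^bsub>A\<^esub> \<one>\<^bsub>A\<^esub>" "c \<odot>\<^bsub>A\<^esub> \<one>\<^bsub>A\<^esub>" x]
  by (simp add: smult_mult_left smult_assoc1[symmetric] R.m_comm)

lemma scalar_act_add_scalar:
  "\<lbrakk>c \<in> carrier F; d \<in> carrier F; x \<in> carrier N\<rbrakk> \<Longrightarrow>
    ((c \<oplus>\<^bsub>F\<^esub> d) \<odot>\<^bsub>A\<^esub> \<one>\<^bsub>A\<^esub>) \<odot>\<^bsub>N\<^esub> x = (c \<odot>\<^bsub>A\<^esub> \<one>\<^bsub>A\<^esub>) \<odot>\<^bsub>N\<^esub> x \<oplus>\<^bsub>N\<^esub> (d \<odot>\<^bsub>A\<^esub> \<one>\<^bsub>A\<^esub>) \<odot>\<^bsub>N\<^esub> x"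
  by (simp add: smult_l_distr N.act_add_scalar)

lemma scalar_act_add:
  "\<lbrakk>c \<in> carrier F; x \<in> carrier N; y \<in> carrier N\<rbrakk> \<Longrightarrow>
    (c \<odot>\<^bsub>A\<^esub> \<one>\<^bsub>A\<^esub>) \<odot>\<^bsub>N\<^esub> (x \<oplus>\<^bsub>N\<^esub> y) = (c \<odot>\<^bsub>A\<^esub> \<one>\<^bsub>A\<^esub>) \<odot>\<^bsub>N\<^esub> x \<oplus>\<^bsub>N\<^esub> (c \<odot>\<^bsub>A\<^esub> \<one>\<^bsub>A\<^esub>) \<odot>\<^bsub>N\<^esub> y"
  by (simp add: N.act_add)

lemma scalar_act_one: "x \<in> carrier N \<Longrightarrow> (\<one>\<^bsub>F\<^esub> \<odot>\<^bsub>A\<^esub> \<one>\<^bsub>A\<^esub>) \<odot>\<^bsub>N\<^esub> x = x"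
  by (simp add: N.act_one)

lemma scalar_act_zero: "x \<in> carrier N \<Longrightarrow> (\<zero>\<^bsub>F\<^esub> \<odot>\<^bsub>A\<^esub> \<one>\<^bsub>A\<^esub>) \<odot>\<^bsub>N\<^esub> x = \<zero>\<^bsub>N\<^esub>"
  by (simp add: N.act_zero_scalar)

lemma scalar_act_eq_zero:
  assumes "c \<in> carrier F" "x \<in> carrier N" "(c \<odot>\<^bsub>A\<^esub> \<one>\<^bsub>A\<^esub>) \<odot>\<^bsub>N\<^esub> x = \<zero>\<^bsub>N\<^esub>" "x \<noteq> \<zero>\<^bsub>N\<^esub>"
  shows "c = \<zero>\<^bsub>F\<^esub>"
proof (rule ccontr)
  assume c: "c \<noteq> \<zero>\<^bsub>F\<^esub>"
  then have inv: "inv\<^bsub>F\<^esub> c \<in> carrier F" "inv\<^bsub>F\<^esub> c \<otimes>\<^bsub>F\<^esub> c = \<one>\<^bsub>F\<^esub>"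
    using assms(1) field_Units by (auto simp: R.Units_l_inv)
  have "x = (inv\<^bsub>F\<^esub> c \<odot>\<^bsub>A\<^esub> \<one>\<^bsub>A\<^esub>) \<odot>\<^bsub>N\<^esub> ((c \<odot>\<^bsub>A\<^esub> \<one>\<^bsub>A\<^esub>) \<odot>\<^bsub>N\<^esub> x)"
    using scalar_act_mult[OF inv(1) assms(1,2)] inv(2) scalar_act_one[OF assms(2)] by simp
  then show False using assms(3,4) inv(1) by (simp add: N.act_zero)
qed

lemma scalar_act_inj:
  assumes "c \<in> carrier F" "d \<in> carrier F" "x \<in> carrier N" "x \<noteq> \<zero>\<^bsub>N\<^esub>"
    "(c \<odot>\<^bsub>A\<^esub> \<one>\<^bsub>A\<^esub>) \<odot>\<^bsub>N\<^esub> x = (d \<odot>\<^bsub>A\<^esub> \<one>\<^bsub>A\<^esub>) \<odot>\<^bsub>N\<^esub> x"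
  shows "c = d"
proof -
  interpret VR: right_module F A by (rule vectorspace_right_module[OF vectorspace_axioms])
  have "((c \<ominus>\<^bsub>F\<^esub> d) \<odot>\<^bsub>A\<^esub> \<one>\<^bsub>A\<^esub>) \<odot>\<^bsub>N\<^esub> x = \<zero>\<^bsub>N\<^esub>"
  proof -
    have cd: "c \<odot>\<^bsub>A\<^esub> \<one>\<^bsub>A\<^esub> \<in> carrier A" "d \<odot>\<^bsub>A\<^esub> \<one>\<^bsub>A\<^esub> \<in> carrier A" using assms(1,2) by simp_all
    have "(c \<ominus>\<^bsub>F\<^esub> d) \<odot>\<^bsub>A\<^esub> \<one>\<^bsub>A\<^esub> = c \<odot>\<^bsub>A\<^esub> \<one>\<^bsub>A\<^esub> \<ominus>\<^bsub>A\<^esub> d \<odot>\<^bsub>A\<^esub> \<one>\<^bsub>A\<^esub>"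
      by (rule VR.act_minus_scalar[OF assms(1,2) A.one_closed])
    then show ?thesis
      using N.act_minus_scalar[OF cd assms(3)] N.M.minus_eq_zero_iff N.act_closed[OF cd(1) assms(3)] assms(5)
      by simp
  qed
  from scalar_act_eq_zero[OF _ assms(3) this assms(4)] have "c \<ominus>\<^bsub>F\<^esub> d = \<zero>\<^bsub>F\<^esub>" using assms(1,2) by simp
  then show ?thesis using assms(1,2) by (simp add: R.minus_eq_zero_iff)
qed

lemma hom_space_vectorspace:
  fixes M :: "('a, 'p) module"
  assumes M: "right_module A M" shows "vectorspace F (hom_space A M N)"
proof (rule right_module_vectorspace[OF field_axioms])
  interpret M: right_module A M by fact
  let ?H = "hom_space A M N"
  have H [simp]: "\<zero>\<^bsub>?H\<^esub> = (\<lambda>x\<in>carrier M. \<zero>\<^bsub>N\<^esub>)" "f \<oplus>\<^bsub>?H\<^esub> g = (\<lambda>x\<in>carrier M. f x \<oplus>\<^bsub>N\<^esub> g x)"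
    "c \<odot>\<^bsub>?H\<^esub> f = (\<lambda>x\<in>carrier M. (c \<odot>\<^bsub>A\<^esub> \<one>\<^bsub>A\<^esub>) \<odot>\<^bsub>N\<^esub> f x)" for f g c
    by (simp_all add: hom_space_def)
  have carr: "f \<in> carrier ?H \<longleftrightarrow> f \<in> module_hom A M N \<and> f \<in> extensional (carrier M)" for f
    by (simp add: hom_space_def)
  have restr: "(\<lambda>x\<in>carrier M. f x) \<in> carrier ?H"
    if "\<And>x. x \<in> carrier M \<Longrightarrow> f x \<in> carrier N"
      "\<And>x y. \<lbrakk>x \<in> carrier M; y \<in> carrier M\<rbrakk> \<Longrightarrow> f (x \<oplus>\<^bsub>M\<^esub> y) = f x \<oplus>\<^bsub>N\<^esub> f y"
      "\<And>a x. \<lbrakk>a \<in> carrier A; x \<in> carrier M\<rbrakk> \<Longrightarrow> f (a \<odot>\<^bsub>M\<^esub> x) = a \<odot>\<^bsub>N\<^esub> f x" for f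
    unfolding carr using that by (auto intro!: module_homI simp: M.act_closed)
  have hom: "f \<in> module_hom A M N" if "f \<in> carrier ?H" for f using that carr by blast
  have val: "f x \<in> carrier N" if "f \<in> carrier ?H" "x \<in> carrier M" for f x
    by (rule module_homD(1)[OF hom[OF that(1)] that(2)])
  have add: "f (x \<oplus>\<^bsub>M\<^esub> y) = f x \<oplus>\<^bsub>N\<^esub> f y" if "f \<in> carrier ?H" "x \<in> carrier M" "y \<in> carrier M" for f x y
    by (rule module_homD(2)[OF hom[OF that(1)] that(2,3)])
  have act: "f (a \<odot>\<^bsub>M\<^esub> x) = a \<odot>\<^bsub>N\<^esub> f x" if "f \<in> carrier ?H" "a \<in> carrier A" "x \<in> carrier M" for f a x
    by (rule module_homD(3)[OF hom[OF that(1)] that(2,3)])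
  have ext: "f \<in> extensional (carrier M)" if "f \<in> carrier ?H" for f using that carr by blast
  have eqI: "f = g" if "f \<in> extensional (carrier M)" "g \<in> extensional (carrier M)"
    "\<And>x. x \<in> carrier M \<Longrightarrow> f x = g x" for f g :: "'p \<Rightarrow> 'n" using that by (rule extensionalityI)
  have add_closed: "f \<oplus>\<^bsub>?H\<^esub> g \<in> carrier ?H" if "f \<in> carrier ?H" "g \<in> carrier ?H" for f g
    unfolding H using that val by (intro restr) (auto simp: add act N.M.a_ac N.act_add)
  \<comment> \<open>A multiple of a homomorphism is again \<open>A\<close>-linear because
    \<open>c \<odot> \<one>\<close> is central.\<close>
  have smult_closed: "c \<odot>\<^bsub>?H\<^esub> f \<in> carrier ?H" if "c \<in> carrier F" "f \<in> carrier ?H" for c f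
    unfolding H using that val by (intro restr) (auto simp: add act N.act_add scalar_act_commute N.act_closed)
  have ag: "abelian_group ?H"
  proof (rule abelian_groupI)
    show "\<zero>\<^bsub>?H\<^esub> \<in> carrier ?H" unfolding H by (rule restr) (auto simp: N.act_zero)
    fix f assume f: "f \<in> carrier ?H"
    show "\<zero>\<^bsub>?H\<^esub> \<oplus>\<^bsub>?H\<^esub> f = f" using f val by (intro eqI) (auto simp: ext)
    have "(\<lambda>x\<in>carrier M. \<ominus>\<^bsub>N\<^esub> f x) \<in> carrier ?H"
      using f val by (intro restr) (auto simp: add act N.M.minus_add N.act_neg)
    moreover have "(\<lambda>x\<in>carrier M. \<ominus>\<^bsub>N\<^esub> f x) \<oplus>\<^bsub>?H\<^esub> f = \<zero>\<^bsub>?H\<^esub>"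
      using f val by (intro eqI) (auto simp: N.M.l_neg)
    ultimately show "\<exists>g\<in>carrier ?H. g \<oplus>\<^bsub>?H\<^esub> f = \<zero>\<^bsub>?H\<^esub>" by blast
    fix g assume g: "g \<in> carrier ?H"
    show "f \<oplus>\<^bsub>?H\<^esub> g \<in> carrier ?H" by (rule add_closed[OF f g])
    show "f \<oplus>\<^bsub>?H\<^esub> g = g \<oplus>\<^bsub>?H\<^esub> f" using f g val by (intro eqI) (auto simp: N.M.a_comm)
    fix h assume h: "h \<in> carrier ?H"
    show "f \<oplus>\<^bsub>?H\<^esub> g \<oplus>\<^bsub>?H\<^esub> h = f \<oplus>\<^bsub>?H\<^esub> (g \<oplus>\<^bsub>?H\<^esub> h)" using f g h val by (intro eqI) (auto simp: N.M.a_assoc)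
  qed
  show "right_module F ?H"
  proof (intro right_module.intro right_module_axioms.intro R.ring_axioms ag smult_closed)
    fix a b f assume abf: "a \<in> carrier F" "b \<in> carrier F" "f \<in> carrier ?H"
    show "(a \<oplus>\<^bsub>F\<^esub> b) \<odot>\<^bsub>?H\<^esub> f = a \<odot>\<^bsub>?H\<^esub> f \<oplus>\<^bsub>?H\<^esub> b \<odot>\<^bsub>?H\<^esub> f"
      using abf val by (intro eqI) (auto simp: scalar_act_add_scalar)
    show "(a \<otimes>\<^bsub>F\<^esub> b) \<odot>\<^bsub>?H\<^esub> f = b \<odot>\<^bsub>?H\<^esub> (a \<odot>\<^bsub>?H\<^esub> f)"
      using abf val by (intro eqI) (auto simp: R.m_comm[of a b] scalar_act_mult)
  next
    fix a f g assume afg: "a \<in> carrier F" "f \<in> carrier ?H" "g \<in> carrier ?H"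
    show "a \<odot>\<^bsub>?H\<^esub> (f \<oplus>\<^bsub>?H\<^esub> g) = a \<odot>\<^bsub>?H\<^esub> f \<oplus>\<^bsub>?H\<^esub> a \<odot>\<^bsub>?H\<^esub> g"
      using afg val by (intro eqI) (auto simp: scalar_act_add)
  next
    fix f assume f: "f \<in> carrier ?H"
    show "\<one>\<^bsub>F\<^esub> \<odot>\<^bsub>?H\<^esub> f = f" using f val by (intro eqI) (auto simp: N.act_one ext)
  qed
qed

end

end

lemma syzygy_props:
  assumes "right_module A M"
  shows "right_module A (syzygy A M)"
    "carrier (syzygy A M) = {g \<in> carrier (free_module A (carrier M)). free_eval A M g = \<zero>\<^bsub>M\<^esub>}"
    "Module.submodule (carrier (syzygy A M)) A (free_module A (carrier M))"
    "zero (syzygy A M) = zero (free_module A (carrier M))" "add (syzygy A M) = add (free_module A (carrier M))"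
    "smult (syzygy A M) = smult (free_module A (carrier M))"
proof -
  interpret M: right_module A M by fact
  note F = free_right_module[OF M.A.ring_axioms, of "carrier M"]
  show c: "carrier (syzygy A M) = {g \<in> carrier (free_module A (carrier M)). free_eval A M g = \<zero>\<^bsub>M\<^esub>}"
    by (simp add: syzygy_def a_kernel_def')
  show s: "Module.submodule (carrier (syzygy A M)) A (free_module A (carrier M))"
    unfolding c by (rule submodule_kernel[OF F assms free_eval_surj(1)[OF assms]])
  then show "right_module A (syzygy A M)"
    using right_module.submodule_right_module[OF F] by (simp add: syzygy_def)
qed (simp_all add: syzygy_def)

section \<open>Homomorphisms from \<open>eJ i\<close> to \<open>S i\<close>, and
  \<open>Ext\<close>\<close>

context decomposition begin

abbreviation eJ :: "nat \<Rightarrow> ('a, 'a) module" where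
  "eJ i \<equiv> (regular_module A)\<lparr>carrier := {x \<in> J. e i \<otimes> x = x}\<rparr>"

lemma eJ_right_ideal: "i < \<ell> A \<Longrightarrow> right_ideal {x \<in> J. e i \<otimes> x = x}"
  using eA_right_ideal[of i] ideal_right_ideal[OF J_ideal] J_subset
  unfolding reg.submodule_iff by (simp add: subset_iff)

lemma eJ_right_module: "i < \<ell> A \<Longrightarrow> right_module A (eJ i)"
  by (rule reg.submodule_right_module[OF eJ_right_ideal])

text \<open>Thus \<open>eJ i\<close> is the kernel of \<open>eA i \<rightarrow> S i\<close>, the
  first syzygy with respect to the projective cover.\<close>

lemma eJ_iff: "i < \<ell> A \<Longrightarrow> x \<in> carrier A \<Longrightarrow> e i \<otimes> x = x \<Longrightarrow> x \<in> J \<longleftrightarrow> x \<odot>\<^bsub>S i\<^esub> w i = \<zero>\<^bsub>S i\<^esub>"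
  using e_mult_in_J[of i x] jacobson_annihilates[OF simple w_closed, of i] by auto

text \<open>A coordinate function on \<open>eJe\<close> extends to a homomorphism \<open>eJ \<rightarrow> S i\<close>, given by
  \<open>x \<mapsto> \<Sum> c(x u\<^sub>k) w v\<^sub>k\<close> over the indices \<open>k\<close> belonging to \<open>i\<close>.\<close>

lemma coordinate_extends:
  assumes i: "i < \<ell> A" and I: "radical_basis i I c" and b: "b \<in> I"
  shows "\<exists>\<phi> \<in> module_hom A (eJ i) (S i). \<forall>x \<in> corner i \<inter> J. \<phi> x = (c b x \<odot> \<one>) \<odot>\<^bsub>S i\<^esub> w i"
proof -
  interpret Si: right_module A "S i" by (rule S_module[OF i])
  note e = e_closed[OF i] and w = w_closed[OF i]
  note Sm = S_module[OF i]
  let ?U = "corner i \<inter> J"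
  note U = corner_J_subspace[OF i]
  note I = I[unfolded radical_basis_def]
  have dI: "dual_family F (A\<lparr>carrier := ?U\<rparr>) I (\<lambda>b. b) c" using I by blast
  note cb = module_homD[OF dual_familyD(2)[OF dI b], simplified]
  have cbA: "c b x \<odot> \<one> \<in> carrier A" if "x \<in> ?U" for x using cb(1) that by simp
  have c_zero: "c b x = \<zero>\<^bsub>F\<^esub>" if "x \<in> corner i" "x \<in> J2" for x
    using that I b J2_subset by blast
  have UA: "x \<in> carrier A" if "x \<in> ?U" for x using that cornerD by blast
  have Ku: "u k \<in> carrier A" "v k \<in> carrier A" "u k \<otimes> e i = u k" "e i \<otimes> v k = v k" if "k \<in> K i" for k
    using that u_closed v_closed u_e e_v by (auto simp: K_def)
  have xu: "x \<otimes> u k \<in> ?U" if "x \<in> J" "e i \<otimes> x = x" "k \<in> K i" for x k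
    using that Ku[OF that(3)] J_subset e ideal.I_r_closed[OF J_ideal]
    by (auto intro!: cornerI simp: A.m_assoc A.m_assoc[of "e i" x, symmetric])
  \<comment> \<open>Coordinates depend only on the class modulo \<open>J2\<close>.\<close>
  have c_cong: "c b x = c b y" if "x \<in> ?U" "y \<in> ?U" "x \<ominus> y \<in> J2" for x y
  proof -
    have d: "x \<ominus> y \<in> ?U" by (rule VR.submodule_minus[OF U that(1,2)])
    have "c b ((x \<ominus> y) \<oplus> y) = c b (x \<ominus> y) \<oplus>\<^bsub>F\<^esub> c b y" using cb(2) d that by simp
    moreover have "(x \<ominus> y) \<oplus> y = x" using UA that by (simp add: a_minus_def M.a_assoc M.l_neg)
    ultimately show ?thesis using c_zero[of "x \<ominus> y"] d that cb(1) by simp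
  qed
  define \<gamma> where "\<gamma> y s = (c b y \<odot> \<one>) \<odot>\<^bsub>S i\<^esub> s" for y s
  have \<gamma>_closed: "\<gamma> y s \<in> carrier (S i)" if "y \<in> ?U" "s \<in> carrier (S i)" for y s
    unfolding \<gamma>_def using that cbA by (simp add: Si.act_closed)
  have \<gamma>_add: "\<gamma> (y \<oplus> z) s = \<gamma> y s \<oplus>\<^bsub>S i\<^esub> \<gamma> z s" if "y \<in> ?U" "z \<in> ?U" "s \<in> carrier (S i)" for y z s
    unfolding \<gamma>_def using that cb(1,2) scalar_act_add_scalar[OF Sm] by simp
  have \<gamma>_add2: "\<gamma> y (s \<oplus>\<^bsub>S i\<^esub> t) = \<gamma> y s \<oplus>\<^bsub>S i\<^esub> \<gamma> y t" if "y \<in> ?U" "s \<in> carrier (S i)" "t \<in> carrier (S i)" for y s t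
    unfolding \<gamma>_def using that cbA by (simp add: Si.act_add)
  have \<gamma>_act: "\<gamma> y (a \<odot>\<^bsub>S i\<^esub> s) = a \<odot>\<^bsub>S i\<^esub> \<gamma> y s" if "y \<in> ?U" "a \<in> carrier A" "s \<in> carrier (S i)" for y a s
    unfolding \<gamma>_def using that cb(1) scalar_act_commute[OF Sm] by simp
  have \<gamma>_zero: "\<gamma> \<zero> s = \<zero>\<^bsub>S i\<^esub>" if "s \<in> carrier (S i)" for s
  proof -
    have z: "\<zero> \<in> ?U" by (rule VR.submodule_zero[OF U])
    then have "\<zero> \<in> corner i" "\<zero> \<in> J2" using VR.submodule_zero[OF ideal_subspace[OF J2_ideal]] by auto
    then show ?thesis using c_zero[of \<zero>] that scalar_act_zero[OF Sm] by (simp add: \<gamma>_def)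
  qed
  have ag: "abelian_monoid (S i)" by (rule Si.M.abelian_monoid_axioms)
  have \<gamma>_sum: "\<gamma> (\<Oplus>k\<in>B. y k) s = (\<Oplus>\<^bsub>S i\<^esub>k\<in>B. \<gamma> (y k) s)"
    if "finite B" "\<And>k. k \<in> B \<Longrightarrow> y k \<in> ?U" "s \<in> carrier (S i)" for B y s
    by (rule VR.additive_finsum[OF U ag]) (use that \<gamma>_closed \<gamma>_add \<gamma>_zero in auto)
  \<comment> \<open>The pairing \<open>\<gamma>\<close> is balanced over the corner:
    \<open>t\<close> acts as the scalar \<open>\<epsilon> i t\<close> on the left argument modulo
    \<open>J2\<close>, and equally on \<open>w i\<close>, which \<open>J\<close>
    annihilates.\<close>
  have \<gamma>_move: "\<gamma> (y \<otimes> t) (a \<odot>\<^bsub>S i\<^esub> w i) = \<gamma> y ((t \<otimes> a) \<odot>\<^bsub>S i\<^esub> w i)"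
    if y: "y \<in> ?U" and t: "t \<in> corner i" and a: "a \<in> carrier A" for y t a
  proof -
    note tD = cornerD[OF t] and et = eps[OF i t]
    have yA: "y \<in> carrier A" "y \<otimes> e i = y" "y \<in> J" "y \<in> corner i" using y cornerD by auto
    have yt: "y \<otimes> t \<in> ?U"
      using y t corner_mult[OF i _ t] ideal.I_r_closed[OF J_ideal _ tD(1)] by auto
    have ey: "\<epsilon> i t \<odot> y \<in> ?U" by (rule VR.submodule_act[OF U et(1) y])
    have "y \<otimes> (t \<ominus> \<epsilon> i t \<odot> e i) = y \<otimes> t \<ominus> \<epsilon> i t \<odot> y"
      using yA tD e et by (simp add: a_minus_def A.r_distr A.r_minus smult_mult_right)
    then have "y \<otimes> t \<ominus> \<epsilon> i t \<odot> y \<in> J2" using J_mult_J[OF yA(3) et(2)] by simp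
    from c_cong[OF yt ey this] have 1: "c b (y \<otimes> t) = \<epsilon> i t \<otimes>\<^bsub>F\<^esub> c b y"
      using cb(1,3) y et(1) by (simp add: R.m_comm)
    have "(t \<ominus> \<epsilon> i t \<odot> e i) \<odot>\<^bsub>S i\<^esub> w i = \<zero>\<^bsub>S i\<^esub>" by (rule jacobson_annihilates[OF simple[OF i] w et(2)])
    then have "t \<odot>\<^bsub>S i\<^esub> w i = (\<epsilon> i t \<odot> e i) \<odot>\<^bsub>S i\<^esub> w i"
      using tD e et w by (simp add: Si.act_minus_scalar Si.M.minus_eq_zero_iff Si.act_closed)
    also have "\<epsilon> i t \<odot> e i = e i \<otimes> (\<epsilon> i t \<odot> \<one>)" using e et by (simp add: smult_mult_right)
    also have "\<dots> \<odot>\<^bsub>S i\<^esub> w i = (\<epsilon> i t \<odot> \<one>) \<odot>\<^bsub>S i\<^esub> w i" using e et w e_w[OF i] by (simp add: Si.act_mult)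
    finally have 2: "(t \<otimes> a) \<odot>\<^bsub>S i\<^esub> w i = (\<epsilon> i t \<odot> \<one>) \<odot>\<^bsub>S i\<^esub> (a \<odot>\<^bsub>S i\<^esub> w i)"
      using tD a w et scalar_act_commute[OF Sm et(1) a w] by (simp add: Si.act_mult)
    show ?thesis
      unfolding \<gamma>_def 2 1
      using scalar_act_mult[OF Sm, of "c b y" "\<epsilon> i t" "a \<odot>\<^bsub>S i\<^esub> w i"] cb(1)[of y] y et(1) a w
      by (simp add: Si.act_closed R.m_comm)
  qed
  define \<phi> where "\<phi> x = (\<Oplus>\<^bsub>S i\<^esub>k\<in>K i. \<gamma> (x \<otimes> u k) (v k \<odot>\<^bsub>S i\<^esub> w i))" for x
  have vw: "v k \<odot>\<^bsub>S i\<^esub> w i \<in> carrier (S i)" if "k \<in> K i" for k using Ku[OF that] w by (simp add: Si.act_closed)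
  \<comment> \<open>On \<open>w i\<close> the identity acts through its block \<open>i\<close>
    alone: for \<open>a = e i a\<close> and foreign \<open>k\<close> the product
    \<open>a u k\<close> lies in \<open>J\<close>.\<close>
  have sum_w: "(\<Oplus>\<^bsub>S i\<^esub>k\<in>K i. (a \<otimes> u k \<otimes> v k) \<odot>\<^bsub>S i\<^esub> w i) = a \<odot>\<^bsub>S i\<^esub> w i"
    if a: "a \<in> carrier A" "e i \<otimes> a = a" for a
  proof -
    have "(\<Oplus>k\<in>{..<n}. (a \<otimes> u k) \<otimes> (v k \<otimes> \<one>)) = (\<Oplus>k\<in>{..<n}. a \<otimes> u k \<otimes> v k)"
      using a u_closed v_closed by (intro M.finsum_cong') auto
    then have eq: "(\<Oplus>k\<in>{..<n}. a \<otimes> u k \<otimes> v k) = a" using insert_one[OF a(1) A.one_closed] a by simp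
    have "(\<Oplus>k\<in>{..<n}. a \<otimes> u k \<otimes> v k) \<ominus> (\<Oplus>k\<in>K i. a \<otimes> u k \<otimes> v k) \<in> J"
    proof (rule VR.submodule_finsum_subset[OF ideal_subspace[OF J_ideal] _ K_subset])
      fix k assume "k \<in> {..<n} - K i"
      then have k: "k < n" "\<iota> k \<noteq> i" by (auto simp: K_def)
      show "a \<otimes> u k \<otimes> v k \<in> J"
        using ideal.I_r_closed[OF J_ideal e_u_in_J[OF i k a(1)] v_closed[OF k(1)]] a(2) by simp
    qed (use a u_closed v_closed in auto)
    then have "(a \<ominus> (\<Oplus>k\<in>K i. a \<otimes> u k \<otimes> v k)) \<odot>\<^bsub>S i\<^esub> w i = \<zero>\<^bsub>S i\<^esub>"
      unfolding eq by (rule jacobson_annihilates[OF simple[OF i] w])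
    moreover have s: "(\<Oplus>k\<in>K i. a \<otimes> u k \<otimes> v k) \<in> carrier A" using a Ku by (intro M.finsum_closed) auto
    ultimately have "a \<odot>\<^bsub>S i\<^esub> w i = (\<Oplus>k\<in>K i. a \<otimes> u k \<otimes> v k) \<odot>\<^bsub>S i\<^esub> w i"
      using a w by (simp add: Si.act_minus_scalar Si.M.minus_eq_zero_iff Si.act_closed)
    also have "\<dots> = (\<Oplus>\<^bsub>S i\<^esub>k\<in>K i. (a \<otimes> u k \<otimes> v k) \<odot>\<^bsub>S i\<^esub> w i)"
      using a Ku w by (intro Si.act_finsum_scalar) auto
    finally show ?thesis by simp
  qed
  have vau: "v m \<otimes> a \<otimes> u k \<in> corner i" if "k \<in> K i" "m \<in> K i" "a \<in> carrier A" for k m a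
    by (rule vxu_corner[OF i that(2,1,3)])
  have hom: "\<phi> \<in> module_hom A (eJ i) (S i)"
  proof (rule module_homI; simp)
    fix x assume x: "x \<in> J \<and> e i \<otimes> x = x"
    have xA: "x \<in> carrier A" using x J_subset by auto
    show "\<phi> x \<in> carrier (S i)"
      unfolding \<phi>_def using x xu \<gamma>_closed vw by (intro Si.M.finsum_closed) auto
    show "\<phi> (x \<oplus> y) = \<phi> x \<oplus>\<^bsub>S i\<^esub> \<phi> y" if y: "y \<in> J \<and> e i \<otimes> y = y" for y
    proof -
      have yA: "y \<in> carrier A" using y J_subset by auto
      have "\<phi> (x \<oplus> y) = (\<Oplus>\<^bsub>S i\<^esub>k\<in>K i. \<gamma> (x \<otimes> u k) (v k \<odot>\<^bsub>S i\<^esub> w i) \<oplus>\<^bsub>S i\<^esub> \<gamma> (y \<otimes> u k) (v k \<odot>\<^bsub>S i\<^esub> w i))"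
        unfolding \<phi>_def using x y xu Ku vw xA yA \<gamma>_add \<gamma>_closed
        by (intro Si.M.finsum_cong') (auto simp: A.l_distr)
      also have "\<dots> = \<phi> x \<oplus>\<^bsub>S i\<^esub> \<phi> y"
        unfolding \<phi>_def using x y xu vw \<gamma>_closed by (intro Si.M.finsum_addf) auto
      finally show ?thesis .
    qed
    show "\<phi> (x \<otimes> a) = a \<odot>\<^bsub>S i\<^esub> \<phi> x" if a: "a \<in> carrier A" for a
    proof -
      have xa: "x \<otimes> a \<in> J" "e i \<otimes> (x \<otimes> a) = x \<otimes> a"
        using ideal.I_r_closed[OF J_ideal _ a] x xA a e by (auto simp: A.m_assoc[symmetric])
      \<comment> \<open>The identity is inserted between \<open>x\<close> and \<open>a\<close>.
        Foreign terms lie in \<open>J2\<close>, and \<open>\<gamma>_move\<close> carries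
        \<open>v m a u k\<close> over to the second argument.\<close>
      have split: "\<gamma> (x \<otimes> a \<otimes> u k) (v k \<odot>\<^bsub>S i\<^esub> w i) =
          (\<Oplus>\<^bsub>S i\<^esub>m\<in>K i. \<gamma> (x \<otimes> u m) ((v m \<otimes> a \<otimes> u k \<otimes> v k) \<odot>\<^bsub>S i\<^esub> w i))" if k: "k \<in> K i" for k
      proof -
        note Kk = Ku[OF k]
        have prod: "(x \<otimes> u m) \<otimes> (v m \<otimes> a \<otimes> u k) \<in> ?U" if m: "m \<in> K i" for m
          using xu[OF _ _ m] x vau[OF k m a] corner_mult[OF i] ideal.I_r_closed[OF J_ideal] cornerD(1) by auto
        have "(x \<otimes> (a \<otimes> u k)) = (\<Oplus>m\<in>{..<n}. (x \<otimes> u m) \<otimes> (v m \<otimes> (a \<otimes> u k)))"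
          using xA a Kk by (intro insert_one) auto
        also have "\<dots> = (\<Oplus>m\<in>{..<n}. (x \<otimes> u m) \<otimes> (v m \<otimes> a \<otimes> u k))"
          using xA a Kk u_closed v_closed by (intro M.finsum_cong') (auto simp: A.m_assoc)
        finally have eq: "x \<otimes> a \<otimes> u k = (\<Oplus>m\<in>{..<n}. (x \<otimes> u m) \<otimes> (v m \<otimes> a \<otimes> u k))"
          using xA a Kk by (simp add: A.m_assoc)
        let ?s = "\<Oplus>m\<in>K i. (x \<otimes> u m) \<otimes> (v m \<otimes> a \<otimes> u k)"
        have "x \<otimes> a \<otimes> u k \<ominus> ?s \<in> J2"
          unfolding eq
        proof (rule VR.submodule_finsum_subset[OF ideal_subspace[OF J2_ideal] _ K_subset])
          fix m assume "m \<in> {..<n} - K i"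
          then have m: "m < n" "\<iota> m \<noteq> i" by (auto simp: K_def)
          have "v m \<otimes> a \<otimes> u k = v m \<otimes> (a \<otimes> u k) \<otimes> e i"
            using v_closed[OF m(1)] a Kk e by (simp add: A.m_assoc)
          then have "v m \<otimes> a \<otimes> u k \<in> J" using v_e_in_J[OF i m, of "a \<otimes> u k"] a Kk by simp
          moreover have "x \<otimes> u m \<in> J" using ideal.I_r_closed[OF J_ideal _ u_closed[OF m(1)]] x by simp
          ultimately show "(x \<otimes> u m) \<otimes> (v m \<otimes> a \<otimes> u k) \<in> J2" by (intro J_mult_J)
        qed (use xA a Kk u_closed v_closed in auto)
        moreover have "?s \<in> ?U" using prod by (intro VR.submodule_finsum[OF U]) auto
        ultimately have "c b (x \<otimes> a \<otimes> u k) = c b ?s" using c_cong[OF xu[OF xa k]] by blast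
        then have "\<gamma> (x \<otimes> a \<otimes> u k) (v k \<odot>\<^bsub>S i\<^esub> w i) = \<gamma> ?s (v k \<odot>\<^bsub>S i\<^esub> w i)" by (simp add: \<gamma>_def)
        also have "\<dots> = (\<Oplus>\<^bsub>S i\<^esub>m\<in>K i. \<gamma> ((x \<otimes> u m) \<otimes> (v m \<otimes> a \<otimes> u k)) (v k \<odot>\<^bsub>S i\<^esub> w i))"
          using prod vw[OF k] by (intro \<gamma>_sum) auto
        also have "\<dots> = (\<Oplus>\<^bsub>S i\<^esub>m\<in>K i. \<gamma> (x \<otimes> u m) ((v m \<otimes> a \<otimes> u k \<otimes> v k) \<odot>\<^bsub>S i\<^esub> w i))"
        proof (rule Si.M.finsum_cong'[OF refl])
          show "(\<lambda>m. \<gamma> (x \<otimes> u m) ((v m \<otimes> a \<otimes> u k \<otimes> v k) \<odot>\<^bsub>S i\<^esub> w i)) \<in> K i \<rightarrow> carrier (S i)"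
            using x xu Ku a Kk w by (auto intro!: \<gamma>_closed Si.act_closed)
          show "\<gamma> ((x \<otimes> u m) \<otimes> (v m \<otimes> a \<otimes> u k)) (v k \<odot>\<^bsub>S i\<^esub> w i) = \<gamma> (x \<otimes> u m) ((v m \<otimes> a \<otimes> u k \<otimes> v k) \<odot>\<^bsub>S i\<^esub> w i)"
            if m: "m \<in> K i" for m
            using \<gamma>_move[OF xu[OF _ _ m] vau[OF k m a] Kk(2)] x by simp
        qed
        finally show ?thesis .
      qed
      have cl: "\<gamma> (x \<otimes> u m) ((v m \<otimes> a \<otimes> u k \<otimes> v k) \<odot>\<^bsub>S i\<^esub> w i) \<in> carrier (S i)" if "m \<in> K i" "k \<in> K i" for m k
        using that x xu[OF _ _ that(1)] Ku a w by (intro \<gamma>_closed Si.act_closed) auto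
      have "\<phi> (x \<otimes> a) = (\<Oplus>\<^bsub>S i\<^esub>k\<in>K i. \<Oplus>\<^bsub>S i\<^esub>m\<in>K i. \<gamma> (x \<otimes> u m) ((v m \<otimes> a \<otimes> u k \<otimes> v k) \<odot>\<^bsub>S i\<^esub> w i))"
        unfolding \<phi>_def using split cl by (intro Si.M.finsum_cong') (auto intro!: Si.M.finsum_closed)
      \<comment> \<open>After the exchange the inner sum runs over \<open>k\<close> and collapses by
        \<open>sum_w\<close>.\<close>
      also have "\<dots> = (\<Oplus>\<^bsub>S i\<^esub>m\<in>K i. \<Oplus>\<^bsub>S i\<^esub>k\<in>K i. \<gamma> (x \<otimes> u m) ((v m \<otimes> a \<otimes> u k \<otimes> v k) \<odot>\<^bsub>S i\<^esub> w i))"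
        using cl by (intro Si.M.finsum_swap) auto
      also have "\<dots> = (\<Oplus>\<^bsub>S i\<^esub>m\<in>K i. a \<odot>\<^bsub>S i\<^esub> \<gamma> (x \<otimes> u m) (v m \<odot>\<^bsub>S i\<^esub> w i))"
      proof (rule Si.M.finsum_cong'[OF refl])
        show "(\<lambda>m. a \<odot>\<^bsub>S i\<^esub> \<gamma> (x \<otimes> u m) (v m \<odot>\<^bsub>S i\<^esub> w i)) \<in> K i \<rightarrow> carrier (S i)"
          using x xu Ku w a by (auto intro!: \<gamma>_closed Si.act_closed)
        fix m assume m: "m \<in> K i"
        note Km = Ku[OF m]
        have xm: "x \<otimes> u m \<in> ?U" using xu m x by simp
        have "(\<Oplus>\<^bsub>S i\<^esub>k\<in>K i. \<gamma> (x \<otimes> u m) ((v m \<otimes> a \<otimes> u k \<otimes> v k) \<odot>\<^bsub>S i\<^esub> w i)) =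
            \<gamma> (x \<otimes> u m) (\<Oplus>\<^bsub>S i\<^esub>k\<in>K i. (v m \<otimes> a \<otimes> u k \<otimes> v k) \<odot>\<^bsub>S i\<^esub> w i)"
          unfolding \<gamma>_def using cbA[OF xm] Km a Ku w by (intro Si.act_finsum[symmetric]) (auto simp: Si.act_closed)
        also have "\<dots> = \<gamma> (x \<otimes> u m) ((v m \<otimes> a) \<odot>\<^bsub>S i\<^esub> w i)"
          using sum_w[of "v m \<otimes> a"] Km a e by (simp add: A.m_assoc[of "e i" "v m", symmetric])
        also have "\<dots> = a \<odot>\<^bsub>S i\<^esub> \<gamma> (x \<otimes> u m) (v m \<odot>\<^bsub>S i\<^esub> w i)"
          using \<gamma>_act[OF xm a vw[OF m]] Km a w by (simp add: Si.act_mult)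
        finally show "(\<Oplus>\<^bsub>S i\<^esub>k\<in>K i. \<gamma> (x \<otimes> u m) ((v m \<otimes> a \<otimes> u k \<otimes> v k) \<odot>\<^bsub>S i\<^esub> w i)) =
          a \<odot>\<^bsub>S i\<^esub> \<gamma> (x \<otimes> u m) (v m \<odot>\<^bsub>S i\<^esub> w i)" .
      qed
      also have "\<dots> = a \<odot>\<^bsub>S i\<^esub> \<phi> x"
        unfolding \<phi>_def using x xu vw a by (intro Si.act_finsum[symmetric]) (auto intro!: \<gamma>_closed)
      finally show ?thesis .
    qed
  qed
  have "\<phi> x = (c b x \<odot> \<one>) \<odot>\<^bsub>S i\<^esub> w i" if x: "x \<in> ?U" for x
  proof -
    have xD: "x \<in> carrier A" "x \<otimes> e i = x" "e i \<otimes> x = x" "x \<in> J" using x cornerD by auto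
    have "\<phi> x = (\<Oplus>\<^bsub>S i\<^esub>k\<in>K i. \<gamma> x ((e i \<otimes> u k \<otimes> v k) \<odot>\<^bsub>S i\<^esub> w i))"
      unfolding \<phi>_def
    proof (rule Si.M.finsum_cong'[OF refl])
      show "(\<lambda>k. \<gamma> x ((e i \<otimes> u k \<otimes> v k) \<odot>\<^bsub>S i\<^esub> w i)) \<in> K i \<rightarrow> carrier (S i)"
        using x Ku e w by (auto intro!: \<gamma>_closed Si.act_closed)
      fix k assume k: "k \<in> K i"
      note Kk = Ku[OF k]
      \<comment> \<open>As \<open>x = x e i\<close>, the corner element \<open>e i u k\<close> can
        be moved to the second argument, where the sum over \<open>k\<close> restores
        \<open>w i\<close>.\<close>
      have "e i \<otimes> u k \<in> corner i"
        using Kk e e_idem[OF i] by (intro cornerI) (auto simp: A.m_assoc A.m_assoc[of "e i" "e i", symmetric])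
      from \<gamma>_move[OF x this Kk(2)] show "\<gamma> (x \<otimes> u k) (v k \<odot>\<^bsub>S i\<^esub> w i) = \<gamma> x ((e i \<otimes> u k \<otimes> v k) \<odot>\<^bsub>S i\<^esub> w i)"
        using xD e Kk by (simp add: A.m_assoc[of x "e i", symmetric])
    qed
    also have "\<dots> = \<gamma> x (\<Oplus>\<^bsub>S i\<^esub>k\<in>K i. (e i \<otimes> u k \<otimes> v k) \<odot>\<^bsub>S i\<^esub> w i)"
      unfolding \<gamma>_def using cbA[OF x] e Ku w by (intro Si.act_finsum[symmetric]) (auto simp: Si.act_closed)
    also have "\<dots> = \<gamma> x (w i)" using sum_w[OF e e_idem[OF i]] e_w[OF i] by simp
    finally show ?thesis by (simp add: \<gamma>_def)
  qed
  with hom show ?thesis by blast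
qed

text \<open>The presentation \<open>eJ \<rightarrow> eA \<rightarrow> S i\<close> is compared with the canonical one through
  \<open>\<alpha> : eA \<rightarrow> P0\<close> and \<open>\<beta> : P0 \<rightarrow> eA\<close> over \<open>S i\<close> with \<open>\<beta> \<circ> \<alpha> = id\<close>.\<close>

lemma resolution_comparison:
  assumes i: "i < \<ell> A"
  obtains \<alpha> \<beta> where
    "\<alpha> \<in> module_hom A (eA i) (free_module A (carrier (S i)))"
    "\<beta> \<in> module_hom A (free_module A (carrier (S i))) (eA i)"
    "\<And>x. x \<in> carrier (eA i) \<Longrightarrow> free_eval A (S i) (\<alpha> x) = x \<odot>\<^bsub>S i\<^esub> w i"
    "\<And>y. y \<in> carrier (free_module A (carrier (S i))) \<Longrightarrow> \<beta> y \<odot>\<^bsub>S i\<^esub> w i = free_eval A (S i) y"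
    "\<And>x. x \<in> carrier (eA i) \<Longrightarrow> \<beta> (\<alpha> x) = x"
    "\<And>f x. f \<in> module_hom A (free_module A (carrier (S i))) (S i) \<Longrightarrow> x \<in> carrier (eJ i) \<Longrightarrow> f (\<alpha> x) = \<zero>\<^bsub>S i\<^esub>"
proof -
  interpret Si: right_module A "S i" by (rule S_module[OF i])
  interpret E: right_module A "eA i" by (rule eA_right_module[OF i])
  note e = e_closed[OF i] and w = w_closed[OF i] and Sm = S_module[OF i]
  let ?P0 = "free_module A (carrier (S i))" and ?ev = "free_eval A (S i)"
  have rP0: "right_module A ?P0" by (rule free_right_module[OF A.ring_axioms])
  note ev = free_eval_surj[OF Sm]
  \<comment> \<open>The basis vector of the free module at the element \<open>w i\<close>.\<close>
  let ?\<delta> = "\<lambda>y\<in>carrier (S i). if y = w i then \<one> else \<zero>"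
  have \<delta>: "?\<delta> \<in> carrier ?P0" "?ev ?\<delta> = w i"
    using Si.lin_ext_delta[of "\<lambda>x. x" "carrier (S i)" "w i"] w by (auto simp: free_eval_eq[OF Sm])
  \<comment> \<open>Basis vectors go to preimages under \<open>eA i \<rightarrow> S i\<close>. Over
    \<open>w i\<close> the preimage \<open>e i\<close> is prescribed, which makes
    \<open>\<beta> \<circ> \<alpha>\<close> the identity.\<close>
  define bf where "bf s = (if s = w i then e i else (SOME x. x \<in> carrier (eA i) \<and> x \<odot>\<^bsub>S i\<^esub> w i = s))" for s
  have ei: "e i \<in> carrier (eA i)" using e e_idem[OF i] by simp
  have bf: "bf s \<in> carrier (eA i) \<and> bf s \<odot>\<^bsub>S i\<^esub> w i = s" if s: "s \<in> carrier (S i)" for s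
  proof (cases "s = w i")
    case True
    then show ?thesis using ei e_w[OF i] by (simp add: bf_def)
  next
    case False
    have "s \<in> (\<lambda>x. x \<odot>\<^bsub>S i\<^esub> w i) ` carrier (eA i)" using s by (simp only: eA_surj[OF i])
    then have "\<exists>x. x \<in> carrier (eA i) \<and> x \<odot>\<^bsub>S i\<^esub> w i = s" by blast
    from someI_ex[OF this] show ?thesis using False by (simp add: bf_def)
  qed
  then have bfP: "bf \<in> carrier (S i) \<rightarrow> carrier (eA i)" by blast
  define \<alpha> where "\<alpha> x = x \<odot>\<^bsub>?P0\<^esub> ?\<delta>" for x
  define \<beta> where "\<beta> = E.lin_ext (carrier (S i)) bf"
  have \<beta>: "\<beta> \<in> module_hom A ?P0 (eA i)" unfolding \<beta>_def by (rule E.lin_ext_hom[OF bfP])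
  have \<beta>\<delta>: "\<beta> ?\<delta> = e i" unfolding \<beta>_def using E.lin_ext_delta(2)[OF bfP w] by (simp add: bf_def)
  show thesis
  proof
    show "\<alpha> \<in> module_hom A (eA i) ?P0" unfolding \<alpha>_def by (rule eA_act_hom[OF rP0 \<delta>(1)])
    show "\<beta> \<in> module_hom A ?P0 (eA i)" by (rule \<beta>)
    show "?ev (\<alpha> x) = x \<odot>\<^bsub>S i\<^esub> w i" if "x \<in> carrier (eA i)" for x
      unfolding \<alpha>_def using module_homD(3)[OF ev(1) _ \<delta>(1), of x] that \<delta>(2) by simp
    show "\<beta> (\<alpha> x) = x" if "x \<in> carrier (eA i)" for x
      unfolding \<alpha>_def using module_homD(3)[OF \<beta> _ \<delta>(1), of x] that \<beta>\<delta> by simp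
    \<comment> \<open>The composite \<open>f \<circ> \<alpha>\<close> sends \<open>x\<close> to the
      image of the basis vector acted on by \<open>x\<close>, and \<open>x\<close> in
      \<open>J\<close> annihilates \<open>S i\<close>. Hence coboundaries die on
      \<open>eJ i\<close>.\<close>
    show "f (\<alpha> x) = \<zero>\<^bsub>S i\<^esub>" if f: "f \<in> module_hom A ?P0 (S i)" and x: "x \<in> carrier (eJ i)" for f x
    proof -
      have "f (\<alpha> x) = x \<odot>\<^bsub>S i\<^esub> f ?\<delta>"
        unfolding \<alpha>_def using x J_subset by (intro module_homD(3)[OF f _ \<delta>(1)]) auto
      then show ?thesis using jacobson_annihilates[OF simple[OF i] module_homD(1)[OF f \<delta>(1)]] x by simp
    qed
    show "\<beta> y \<odot>\<^bsub>S i\<^esub> w i = ?ev y" if y: "y \<in> carrier ?P0" for y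
    proof -
      let ?B = "{s \<in> carrier (S i). y s \<noteq> \<zero>}"
      have yA: "y s \<in> carrier A" if "s \<in> carrier (S i)" for s using y that by (auto simp: free_module_def)
      have B: "finite ?B" using y by (simp add: free_module_def)
      have cl: "(\<lambda>s. y s \<odot>\<^bsub>eA i\<^esub> bf s) \<in> ?B \<rightarrow> carrier (eA i)"
        using yA bf by (intro funcsetI E.act_closed) blast+
      have "\<beta> y \<odot>\<^bsub>S i\<^esub> w i = (\<Oplus>\<^bsub>S i\<^esub>s\<in>?B. (y s \<odot>\<^bsub>eA i\<^esub> bf s) \<odot>\<^bsub>S i\<^esub> w i)"
        unfolding \<beta>_def E.lin_ext_def by (rule hom_finsum[OF E.right_module_axioms Sm eA_act_hom[OF Sm w] B cl])
      also have "\<dots> = (\<Oplus>\<^bsub>S i\<^esub>s\<in>?B. y s \<odot>\<^bsub>S i\<^esub> s)"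
      proof (rule Si.M.finsum_cong'[OF refl])
        show "(\<lambda>s. y s \<odot>\<^bsub>S i\<^esub> s) \<in> ?B \<rightarrow> carrier (S i)" using yA by (auto simp: Si.act_closed)
        show "(y s \<odot>\<^bsub>eA i\<^esub> bf s) \<odot>\<^bsub>S i\<^esub> w i = y s \<odot>\<^bsub>S i\<^esub> s" if "s \<in> ?B" for s
          using that yA bf[of s] module_homD(3)[OF eA_act_hom[OF Sm w], of "y s" "bf s"] by auto
      qed
      finally show ?thesis by (simp add: free_eval_def)
    qed
  qed
qed

text \<open>The injective half of the identification of homomorphisms
  \<open>eJ i \<rightarrow> S i\<close> with functionals on \<open>e J e\<close> modulo
  \<open>J2\<close>; \<open>coordinate_extends\<close> is the surjective half.\<close>

lemma hom_vanishing_on_radical_basis: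
  assumes i: "i < \<ell> A" and I: "radical_basis i I c" and g: "g \<in> module_hom A (eJ i) (S i)"
    and z: "\<And>b. b \<in> I \<Longrightarrow> g b = \<zero>\<^bsub>S i\<^esub>" and x: "x \<in> carrier (eJ i)"
  shows "g x = \<zero>\<^bsub>S i\<^esub>"
proof (rule ccontr)
  interpret Si: right_module A "S i" by (rule S_module[OF i])
  interpret EJ: right_module A "eJ i" by (rule eJ_right_module[OF i])
  note e = e_closed[OF i] and w = w_closed[OF i] and Sm = S_module[OF i]
  note I = I[unfolded radical_basis_def]
  note hg = module_homD[OF g]
  have IJ: "y \<in> J2 \<longleftrightarrow> (\<forall>b\<in>I. c b y = \<zero>\<^bsub>F\<^esub>)" if "y \<in> corner i \<inter> J" for y using I that by blast
  let ?U = "corner i \<inter> J"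
  note U = corner_J_subspace[OF i]
  have UE: "y \<in> carrier (eJ i)" if "y \<in> ?U" for y using that cornerD by simp
  \<comment> \<open>An element of \<open>J2\<close> need not lie in \<open>eJ i\<close>, so it is
    multiplied by \<open>e i\<close> first. On generators, \<open>g (e i s t) = g (e i s) t\<close>,
    and \<open>J\<close> annihilates \<open>S i\<close>.\<close>
  have g2: "g (e i \<otimes> t) = \<zero>\<^bsub>S i\<^esub> \<and> t \<in> carrier A" if "t \<in> J2" for t
    using that
  proof (induction t rule: ideal_prod.induct)
    case (prod s t)
    then have st: "s \<in> carrier A" "t \<in> carrier A" using J_subset by auto
    have es: "e i \<otimes> s \<in> carrier (eJ i)"
      using ideal.I_l_closed[OF J_ideal prod(1) e] e st e_idem[OF i] by (simp add: A.m_assoc[symmetric])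
    have "g (t \<odot>\<^bsub>eJ i\<^esub> (e i \<otimes> s)) = t \<odot>\<^bsub>S i\<^esub> g (e i \<otimes> s)" by (rule hg(3)[OF st(2) es])
    also have "\<dots> = \<zero>\<^bsub>S i\<^esub>" by (rule jacobson_annihilates[OF simple[OF i] hg(1)[OF es] prod(2)])
    finally show ?case using st e by (simp add: A.m_assoc)
  next
    case (sum s t)
    have "e i \<otimes> s \<in> carrier (eJ i)" "e i \<otimes> t \<in> carrier (eJ i)"
      using ideal.I_l_closed[OF J_ideal _ e] sum J2_subset e e_idem[OF i] by (auto simp: A.m_assoc[symmetric])
    from hg(2)[OF this] show ?case using sum e by (simp add: A.r_distr)
  qed
  have corner: "g y = \<zero>\<^bsub>S i\<^esub>" if y: "y \<in> ?U" for y
  proof -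
    let ?W = "{y \<in> ?U. g y = \<zero>\<^bsub>S i\<^esub>}"
    have "Module.submodule ?W F (A\<lparr>carrier := ?U\<rparr>)"
      unfolding VR.submodule_of_submodule[OF U] VR.submodule_iff
    proof (intro conjI ballI)
      show "?W \<subseteq> carrier A" using VR.submodule_subset[OF U] by blast
      show "\<zero> \<in> ?W" using VR.submodule_zero[OF U] module_hom_zero[OF EJ.right_module_axioms Sm g] by simp
      fix x assume x: "x \<in> ?W"
      show "x \<oplus> y \<in> ?W" if "y \<in> ?W" for y
        using x that hg(2)[OF UE UE, of x y] VR.submodule_add[OF U] by simp
      fix a assume a: "a \<in> carrier F"
      have xU: "x \<in> ?U" "x \<in> carrier A" "g x = \<zero>\<^bsub>S i\<^esub>" using x cornerD(1)[of x i] by auto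
      have "g (a \<odot> x) = g ((a \<odot> \<one>) \<odot>\<^bsub>eJ i\<^esub> x)" using a xU by (simp add: smult_mult_right)
      also have "\<dots> = (a \<odot> \<one>) \<odot>\<^bsub>S i\<^esub> g x" using a UE[OF xU(1)] by (intro hg(3)) auto
      finally show "a \<odot> x \<in> ?W" using xU a VR.submodule_act[OF U a xU(1)] by (simp add: Si.act_zero)
    qed blast
    moreover have "y \<in> ?W" if "y \<in> carrier (A\<lparr>carrier := ?U\<rparr>)" "\<forall>b\<in>I. c b y = \<zero>\<^bsub>F\<^esub>" for y
    proof -
      have yU: "y \<in> ?U" using that(1) by simp
      have "y \<in> J2" by (rule iffD2[OF IJ[OF yU] that(2)])
      then show ?thesis using g2[of y] yU cornerD(2)[of y i] by simp
    qed
    moreover have "b \<in> ?W" if "b \<in> I" for b using that I z by blast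
    moreover have "finite I" "dual_family F (A\<lparr>carrier := ?U\<rparr>) I (\<lambda>b. b) c" using I by blast+
    moreover have "y \<in> carrier (A\<lparr>carrier := ?U\<rparr>)" using y by simp
    ultimately have "y \<in> ?W"
      by (intro dual_family_generates[OF right_module_vectorspace[OF field_axioms VR.submodule_right_module[OF U]],
          of I "\<lambda>b. b" c ?W y])
    then show ?thesis by simp
  qed
  assume ne: "g x \<noteq> \<zero>\<^bsub>S i\<^esub>"
  have xA: "x \<in> carrier A" "x \<in> J" "e i \<otimes> x = x" using x J_subset by auto
  have "w i \<in> (\<lambda>a. a \<odot>\<^bsub>S i\<^esub> g x) ` carrier A"
    using w by (simp only: simple_module_cyclic[OF simple[OF i] hg(1)[OF x] ne])
  then obtain a where a: "a \<in> carrier A" "w i = a \<odot>\<^bsub>S i\<^esub> g x" by blast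
  have ae: "a \<otimes> e i \<in> carrier A" using a e by simp
  \<comment> \<open>A nonzero \<open>g x\<close> generates \<open>S i\<close>. Writing
    \<open>w i = w i e i\<close> as a value of \<open>g\<close> replaces \<open>x\<close> by
    \<open>x a e i\<close>, an element of the corner, where \<open>g\<close> vanishes.\<close>
  have "w i = e i \<odot>\<^bsub>S i\<^esub> w i" by (rule e_w[OF i, symmetric])
  also have "\<dots> = e i \<odot>\<^bsub>S i\<^esub> (a \<odot>\<^bsub>S i\<^esub> g x)" by (rule arg_cong[OF a(2)])
  also have "\<dots> = (a \<otimes> e i) \<odot>\<^bsub>S i\<^esub> g x" by (rule Si.act_mult[OF a(1) e hg(1)[OF x], symmetric])
  also have "\<dots> = g (x \<otimes> (a \<otimes> e i))" using hg(3)[OF ae x] by simp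
  also have "\<dots> = \<zero>\<^bsub>S i\<^esub>"
  proof (rule corner)
    have "e i \<otimes> (x \<otimes> (a \<otimes> e i)) = x \<otimes> (a \<otimes> e i)" using A.m_assoc[OF e xA(1) ae] xA(3) by simp
    moreover have "x \<otimes> (a \<otimes> e i) \<otimes> e i = x \<otimes> (a \<otimes> e i)"
      using xA(1) a(1) e e_idem[OF i] by (simp add: A.m_assoc)
    ultimately show "x \<otimes> (a \<otimes> e i) \<in> ?U"
      using ideal.I_r_closed[OF J_ideal xA(2) ae] xA(1) ae by (intro IntI cornerI) auto
  qed
  finally show False using w_nonzero[OF i] by simp
qed

text \<open>The coordinate on the line \<open>F w i\<close>, which consists of the vectors of
  \<open>S i\<close> fixed by \<open>e i\<close>.\<close>

definition "\<kappa> i s = (SOME k. k \<in> carrier F \<and> s = (k \<odot> \<one>) \<odot>\<^bsub>S i\<^esub> w i)"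

lemma kappa_eq: "i < \<ell> A \<Longrightarrow> k \<in> carrier F \<Longrightarrow> \<kappa> i ((k \<odot> \<one>) \<odot>\<^bsub>S i\<^esub> w i) = k"
  unfolding \<kappa>_def
  using scalar_act_inj[OF S_module _ _ w_closed w_nonzero, of i] by (intro some_equality) auto

lemma kappa:
  assumes "i < \<ell> A" "s \<in> carrier (S i)" "e i \<odot>\<^bsub>S i\<^esub> s = s"
  shows "\<kappa> i s \<in> carrier F" "s = (\<kappa> i s \<odot> \<one>) \<odot>\<^bsub>S i\<^esub> w i"
proof -
  obtain k where k: "k \<in> carrier F" "s = (k \<odot> \<one>) \<odot>\<^bsub>S i\<^esub> w i"
    using simple_corner_scalar[OF assms(1) simple[OF assms(1)] w_closed[OF assms(1)] w_nonzero[OF assms(1)] e_w[OF assms(1)] assms(2,3)] .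
  then have "\<kappa> i s = k" using kappa_eq[OF assms(1) k(1)] by simp
  with k show "\<kappa> i s \<in> carrier F" "s = (\<kappa> i s \<odot> \<one>) \<odot>\<^bsub>S i\<^esub> w i" by auto
qed

text \<open>A cocycle is a homomorphism on the syzygy \<open>Z0\<close>; restricted along
  \<open>\<alpha>\<close> to \<open>eJ i\<close> it is read off at the radical basis. The
  coboundaries are the common kernel of these functionals, and dual cocycles arise from
  \<open>coordinate_extends\<close> along \<open>\<beta>\<close>.\<close>

lemma dim_Ext1:
  assumes i: "i < \<ell> A" and I: "radical_basis i I c"
  shows "vectorspace.dim F (Ext1 A (S i) (S i)) = card I"
proof -
  note Sm = S_module[OF i] and e = e_closed[OF i] and w = w_closed[OF i]
  interpret Si: right_module A "S i" by (rule Sm)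
  define P0 where "P0 = free_module A (carrier (S i))"
  define Z0 where "Z0 = syzygy A (S i)"
  define P1 where "P1 = free_module A (carrier Z0)"
  define d1 where "d1 = free_eval A Z0"
  define Z1 where "Z1 = syzygy A Z0"
  define P2 where "P2 = free_module A (carrier Z1)"
  define d2 where "d2 = free_eval A Z1"
  have rP: "right_module A P0" "right_module A P1"
    unfolding P0_def P1_def by (rule free_right_module[OF A.ring_axioms])+
  have rZ0: "right_module A Z0" unfolding Z0_def by (rule syzygy_props(1)[OF Sm])
  have rZ1: "right_module A Z1" unfolding Z1_def by (rule syzygy_props(1)[OF rZ0])
  interpret P0: right_module A P0 by (rule rP)
  interpret P1: right_module A P1 by (rule rP)
  interpret Z0: right_module A Z0 by (rule rZ0)
  have d1: "d1 \<in> module_hom A P1 Z0" "d1 ` carrier P1 = carrier Z0"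
    unfolding d1_def P1_def by (rule free_eval_surj[OF rZ0])+
  \<comment> \<open>Exactness at \<open>P1\<close>: a cocycle is a homomorphism that vanishes on the
    kernel of \<open>d1\<close>.\<close>
  have d2: "d2 ` carrier P2 = {y \<in> carrier P1. d1 y = \<zero>\<^bsub>Z0\<^esub>}"
    unfolding d2_def P2_def free_eval_surj(2)[OF rZ1]
    using syzygy_props(2)[OF rZ0] by (simp add: Z1_def P1_def d1_def)
  have Z0c: "carrier Z0 = {y \<in> carrier P0. free_eval A (S i) y = \<zero>\<^bsub>S i\<^esub>}"
    unfolding Z0_def P0_def by (rule syzygy_props(2)[OF Sm])
  have Z0sub: "Module.submodule (carrier Z0) A P0" unfolding Z0_def P0_def by (rule syzygy_props(3)[OF Sm])
  have Z0ops: "zero Z0 = zero P0" "add Z0 = add P0" "smult Z0 = smult P0"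
    unfolding Z0_def P0_def by (rule syzygy_props(4-6)[OF Sm])+
  obtain \<alpha> \<beta> where \<alpha>: "\<alpha> \<in> module_hom A (eA i) P0" and \<beta>: "\<beta> \<in> module_hom A P0 (eA i)"
    and ev\<alpha>: "\<And>x. x \<in> carrier (eA i) \<Longrightarrow> free_eval A (S i) (\<alpha> x) = x \<odot>\<^bsub>S i\<^esub> w i"
    and ev\<beta>: "\<And>y. y \<in> carrier P0 \<Longrightarrow> \<beta> y \<odot>\<^bsub>S i\<^esub> w i = free_eval A (S i) y"
    and \<beta>\<alpha>: "\<And>x. x \<in> carrier (eA i) \<Longrightarrow> \<beta> (\<alpha> x) = x"
    and kill: "\<And>f x. f \<in> module_hom A P0 (S i) \<Longrightarrow> x \<in> carrier (eJ i) \<Longrightarrow> f (\<alpha> x) = \<zero>\<^bsub>S i\<^esub>"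
    using resolution_comparison[OF i] unfolding P0_def by blast
  have eJA: "x \<in> carrier (eA i)" if "x \<in> carrier (eJ i)" for x using that J_subset by auto
  have \<alpha>J: "\<alpha> x \<in> carrier Z0" if x: "x \<in> carrier (eJ i)" for x
    using ev\<alpha>[OF eJA[OF x]] module_homD(1)[OF \<alpha> eJA[OF x]] x eJ_iff[OF i, of x] eJA[OF x] unfolding Z0c by simp
  have \<alpha>Jhom: "\<alpha> \<in> module_hom A (eJ i) Z0"
  proof (rule module_homI)
    fix x assume x: "x \<in> carrier (eJ i)"
    show "\<alpha> x \<in> carrier Z0" by (rule \<alpha>J[OF x])
    show "\<alpha> (x \<oplus>\<^bsub>eJ i\<^esub> y) = \<alpha> x \<oplus>\<^bsub>Z0\<^esub> \<alpha> y" if y: "y \<in> carrier (eJ i)" for y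
      using module_homD(2)[OF \<alpha> eJA[OF x] eJA[OF y]] by (simp add: Z0ops)
    show "\<alpha> (a \<odot>\<^bsub>eJ i\<^esub> x) = a \<odot>\<^bsub>Z0\<^esub> \<alpha> x" if a: "a \<in> carrier A" for a
      using module_homD(3)[OF \<alpha> a eJA[OF x]] by (simp add: Z0ops)
  qed
  have \<beta>Z: "\<beta> z \<in> carrier (eJ i)" if z: "z \<in> carrier Z0" for z
    using z ev\<beta>[of z] module_homD(1)[OF \<beta>, of z] eJ_iff[OF i, of "\<beta> z"] unfolding Z0c by simp
  have \<beta>Zhom: "\<beta> \<in> module_hom A Z0 (eJ i)"
  proof (rule module_homI)
    have ZP: "z \<in> carrier P0" if "z \<in> carrier Z0" for z using that Z0c by blast
    fix x assume x: "x \<in> carrier Z0"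
    show "\<beta> x \<in> carrier (eJ i)" by (rule \<beta>Z[OF x])
    show "\<beta> (x \<oplus>\<^bsub>Z0\<^esub> y) = \<beta> x \<oplus>\<^bsub>eJ i\<^esub> \<beta> y" if y: "y \<in> carrier Z0" for y
      using module_homD(2)[OF \<beta> ZP[OF x] ZP[OF y]] by (simp add: Z0ops)
    show "\<beta> (a \<odot>\<^bsub>Z0\<^esub> x) = a \<odot>\<^bsub>eJ i\<^esub> \<beta> x" if a: "a \<in> carrier A" for a
      using module_homD(3)[OF \<beta> a ZP[OF x]] by (simp add: Z0ops)
  qed
  have IJ: "b \<in> carrier (eJ i)" "b \<otimes> e i = b" if "b \<in> I" for b
    using that I cornerD by (auto simp: radical_basis_def)
  \<comment> \<open>Cocycles live on \<open>P1\<close>, so the elements \<open>\<alpha> b\<close> of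
    \<open>Z0\<close> are lifted there to evaluate them.\<close>
  define y where "y b = (SOME y. y \<in> carrier P1 \<and> d1 y = \<alpha> b)" for b
  have y: "y b \<in> carrier P1" "d1 (y b) = \<alpha> b" if "b \<in> I" for b
  proof -
    have "\<alpha> b \<in> d1 ` carrier P1" unfolding d1(2) by (rule \<alpha>J[OF IJ(1)[OF that]])
    then have "\<exists>y. y \<in> carrier P1 \<and> d1 y = \<alpha> b" by (metis imageE)
    from someI_ex[OF this] show "y b \<in> carrier P1" "d1 (y b) = \<alpha> b" by (auto simp: y_def)
  qed
  let ?H = "hom_space A P1 (S i)"
  define Z where "Z = {f \<in> carrier ?H. \<forall>g\<in>carrier P2. f (d2 g) = \<zero>\<^bsub>S i\<^esub>}"
  define B where "B = (\<lambda>h. \<lambda>g\<in>carrier P1. h (d1 g)) ` carrier (hom_space A P0 (S i))"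
  have Hc: "f \<in> carrier ?H \<longleftrightarrow> f \<in> module_hom A P1 (S i) \<and> f \<in> extensional (carrier P1)" for f
    by (simp add: hom_space_def)
  have Zc: "f \<in> Z \<longleftrightarrow> f \<in> carrier ?H \<and> (\<forall>y\<in>carrier P1. d1 y = \<zero>\<^bsub>Z0\<^esub> \<longrightarrow> f y = \<zero>\<^bsub>S i\<^esub>)" for f
  proof -
    have "(\<forall>g\<in>carrier P2. f (d2 g) = \<zero>\<^bsub>S i\<^esub>) \<longleftrightarrow> (\<forall>y\<in>d2 ` carrier P2. f y = \<zero>\<^bsub>S i\<^esub>)" by blast
    then show ?thesis unfolding Z_def d2 by auto
  qed
  have Zhom: "f \<in> module_hom A P1 (S i)" if "f \<in> Z" for f using that Zc Hc by blast
  have factor: "\<exists>g \<in> module_hom A Z0 (S i). \<forall>y \<in> carrier P1. g (d1 y) = f y" if f: "f \<in> Z" for f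
    by (rule module_hom_factor[OF rP(2) rZ0 Sm d1 Zhom[OF f]]) (use f Zc in blast)
  have lift: "(\<lambda>y\<in>carrier P1. g (d1 y)) \<in> Z" if g: "g \<in> module_hom A Z0 (S i)" for g
  proof -
    have "(\<lambda>y\<in>carrier P1. g (d1 y)) \<in> module_hom A P1 (S i)"
      using module_homD[OF module_hom_comp[OF d1(1) g]] by (intro module_homI) (auto simp: P1.act_closed)
    then show ?thesis unfolding Zc Hc using module_hom_zero[OF rZ0 Sm g] by simp
  qed
  \<comment> \<open>From \<open>b = b e i\<close> the value at \<open>b\<close> is fixed by
    \<open>e i\<close>, hence a multiple of \<open>w i\<close>.\<close>
  have corner_val: "e i \<odot>\<^bsub>S i\<^esub> f (y b) = f (y b)" "f (y b) \<in> carrier (S i)" if f: "f \<in> Z" and b: "b \<in> I" for f b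
  proof -
    obtain g where g: "g \<in> module_hom A Z0 (S i)" "\<forall>y \<in> carrier P1. g (d1 y) = f y" using factor[OF f] by blast
    have fy: "f (y b) = g (\<alpha> b)" using g(2) y[OF b] by metis
    have h: "(\<lambda>x. g (\<alpha> x)) \<in> module_hom A (eJ i) (S i)" by (rule module_hom_comp[OF \<alpha>Jhom g(1)])
    show "e i \<odot>\<^bsub>S i\<^esub> f (y b) = f (y b)"
      unfolding fy using module_homD(3)[OF h e IJ(1)[OF b]] IJ(2)[OF b] by simp
    show "f (y b) \<in> carrier (S i)" by (rule module_homD(1)[OF Zhom[OF f] y(1)[OF b]])
  qed
  note vH = hom_space_vectorspace[OF Sm rP(2)]
  interpret H: right_module F ?H by (rule vectorspace_right_module[OF vH])
  have Hops: "\<zero>\<^bsub>?H\<^esub> = (\<lambda>x\<in>carrier P1. \<zero>\<^bsub>S i\<^esub>)" "f \<oplus>\<^bsub>?H\<^esub> g = (\<lambda>x\<in>carrier P1. f x \<oplus>\<^bsub>S i\<^esub> g x)"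
    "k \<odot>\<^bsub>?H\<^esub> f = (\<lambda>x\<in>carrier P1. (k \<odot> \<one>) \<odot>\<^bsub>S i\<^esub> f x)" for f g k
    by (simp_all add: hom_space_def)
  have Zsub: "Module.submodule Z F ?H"
    unfolding H.submodule_iff
  proof (intro conjI ballI)
    show "Z \<subseteq> carrier ?H" using Zc by blast
    show "\<zero>\<^bsub>?H\<^esub> \<in> Z" unfolding Zc using H.M.zero_closed by (simp add: Hops)
    fix f assume f: "f \<in> Z"
    show "f \<oplus>\<^bsub>?H\<^esub> g \<in> Z" if g: "g \<in> Z" for g
    proof -
      have "f \<oplus>\<^bsub>?H\<^esub> g \<in> carrier ?H" using f g Zc by (intro H.M.a_closed) auto
      then show ?thesis using f g unfolding Zc by (simp add: Hops)
    qed
    show "k \<odot>\<^bsub>?H\<^esub> f \<in> Z" if k: "k \<in> carrier F" for k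
    proof -
      have "k \<odot>\<^bsub>?H\<^esub> f \<in> carrier ?H" using f k Zc by (intro H.act_closed) auto
      then show ?thesis using f k unfolding Zc by (simp add: Hops Si.act_zero)
    qed
  qed
  let ?V = "?H\<lparr>carrier := Z\<rparr>"
  have vV: "vectorspace F ?V" by (rule right_module_vectorspace[OF field_axioms H.submodule_right_module[OF Zsub]])
  define \<psi> where "\<psi> b f = \<kappa> i (f (y b))" for b f
  have \<psi>_hom: "\<psi> b \<in> module_hom F ?V (regular_module F)" if b: "b \<in> I" for b
  proof (rule module_homI; simp)
    fix f assume f: "f \<in> Z"
    note kf = kappa[OF i corner_val(2)[OF f b] corner_val(1)[OF f b]]
    show "\<psi> b f \<in> carrier F" unfolding \<psi>_def by (rule kf(1))
    show "\<psi> b (f \<oplus>\<^bsub>?H\<^esub> g) = \<psi> b f \<oplus>\<^bsub>F\<^esub> \<psi> b g" if g: "g \<in> Z" for g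
    proof -
      note kg = kappa[OF i corner_val(2)[OF g b] corner_val(1)[OF g b]]
      have "(f \<oplus>\<^bsub>?H\<^esub> g) (y b) = f (y b) \<oplus>\<^bsub>S i\<^esub> g (y b)" using y(1)[OF b] by (simp add: Hops)
      also have "\<dots> = ((\<kappa> i (f (y b)) \<oplus>\<^bsub>F\<^esub> \<kappa> i (g (y b))) \<odot> \<one>) \<odot>\<^bsub>S i\<^esub> w i"
        using scalar_act_add_scalar[OF Sm kf(1) kg(1) w] kf(2) kg(2) by simp
      finally show ?thesis unfolding \<psi>_def using kappa_eq[OF i] kf(1) kg(1) by simp
    qed
    show "\<psi> b (k \<odot>\<^bsub>?H\<^esub> f) = \<psi> b f \<otimes>\<^bsub>F\<^esub> k" if k: "k \<in> carrier F" for k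
    proof -
      have "(k \<odot>\<^bsub>?H\<^esub> f) (y b) = (k \<odot> \<one>) \<odot>\<^bsub>S i\<^esub> f (y b)" using y(1)[OF b] by (simp add: Hops)
      also have "\<dots> = ((k \<otimes>\<^bsub>F\<^esub> \<kappa> i (f (y b))) \<odot> \<one>) \<odot>\<^bsub>S i\<^esub> w i"
        using scalar_act_mult[OF Sm k kf(1) w] kf(2) by simp
      finally show ?thesis unfolding \<psi>_def using kappa_eq[OF i] kf(1) k by (simp add: R.m_comm)
    qed
  qed
  define \<phi> where "\<phi> b = (SOME \<phi>. \<phi> \<in> module_hom A (eJ i) (S i) \<and>
    (\<forall>x \<in> corner i \<inter> J. \<phi> x = (c b x \<odot> \<one>) \<odot>\<^bsub>S i\<^esub> w i))" for b
  have \<phi>: "\<phi> b \<in> module_hom A (eJ i) (S i)" "x \<in> corner i \<inter> J \<Longrightarrow> \<phi> b x = (c b x \<odot> \<one>) \<odot>\<^bsub>S i\<^esub> w i"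
    if "b \<in> I" for b x
    using someI_ex[OF coordinate_extends[OF i I that, unfolded Bex_def]] unfolding \<phi>_def[symmetric] by simp_all
  \<comment> \<open>The cocycle dual to \<open>b\<close>: the coordinate of \<open>b\<close>,
    extended to \<open>eJ i\<close> and transported to \<open>P1\<close>.\<close>
  define f where "f b = (\<lambda>y\<in>carrier P1. \<phi> b (\<beta> (d1 y)))" for b
  have fZ: "f b \<in> Z" if "b \<in> I" for b
    unfolding f_def by (rule lift[OF module_hom_comp[OF \<beta>Zhom \<phi>(1)[OF that]]])
  have dI: "dual_family F (A\<lparr>carrier := corner i \<inter> J\<rparr>) I (\<lambda>b. b) c" and finI: "finite I" and IU: "I \<subseteq> corner i \<inter> J"
    using I by (auto simp: radical_basis_def)
  have dual: "\<psi> b (f b') = (if b = b' then \<one>\<^bsub>F\<^esub> else \<zero>\<^bsub>F\<^esub>)" if b: "b \<in> I" and b': "b' \<in> I" for b b'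
  proof -
    have "f b' (y b) = \<phi> b' b"
      unfolding f_def using y[OF b] \<beta>\<alpha>[OF eJA[OF IJ(1)[OF b]]] by simp
    also have "\<dots> = (c b' b \<odot> \<one>) \<odot>\<^bsub>S i\<^esub> w i" using \<phi>(2)[OF b'] b IU by blast
    finally have "\<psi> b (f b') = c b' b"
      unfolding \<psi>_def using kappa_eq[OF i] module_homD(1)[OF dual_familyD(2)[OF dI b'], of b] b IU by auto
    then show ?thesis using dual_familyD(3)[OF dI b' b] by auto
  qed
  have df: "dual_family F ?V I f \<psi>" unfolding dual_family_def using fZ \<psi>_hom dual by simp
  have BZ: "B = {g \<in> carrier ?V. \<forall>b\<in>I. \<psi> b g = \<zero>\<^bsub>F\<^esub>}"
  proof (intro Set.equalityI subsetI)
    fix g assume "g \<in> B"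
    then obtain h where h: "h \<in> carrier (hom_space A P0 (S i))" "g = (\<lambda>y\<in>carrier P1. h (d1 y))"
      unfolding B_def by blast
    then have hh: "h \<in> module_hom A P0 (S i)" by (simp add: hom_space_def)
    have "h \<in> module_hom A Z0 (S i)"
      using module_homD[OF hh] Z0c by (intro module_homI) (auto simp: Z0ops)
    from lift[OF this] have "g \<in> Z" using h(2) by simp
    moreover have "\<psi> b g = \<zero>\<^bsub>F\<^esub>" if b: "b \<in> I" for b
    proof -
      have "g (y b) = \<zero>\<^bsub>S i\<^esub>" using h(2) y[OF b] kill[OF hh IJ(1)[OF b]] by simp
      also have "\<dots> = (\<zero>\<^bsub>F\<^esub> \<odot> \<one>) \<odot>\<^bsub>S i\<^esub> w i" by (rule scalar_act_zero[OF Sm w, symmetric])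
      finally show ?thesis unfolding \<psi>_def using kappa_eq[OF i R.zero_closed] by simp
    qed
    ultimately show "g \<in> {g \<in> carrier ?V. \<forall>b\<in>I. \<psi> b g = \<zero>\<^bsub>F\<^esub>}" by simp
  next
    fix g assume "g \<in> {g \<in> carrier ?V. \<forall>b\<in>I. \<psi> b g = \<zero>\<^bsub>F\<^esub>}"
    then have gZ: "g \<in> Z" and g0: "\<And>b. b \<in> I \<Longrightarrow> \<psi> b g = \<zero>\<^bsub>F\<^esub>" by auto
    obtain q where q: "q \<in> module_hom A Z0 (S i)" "\<forall>y \<in> carrier P1. q (d1 y) = g y" using factor[OF gZ] by blast
    have q0: "q (\<alpha> b) = \<zero>\<^bsub>S i\<^esub>" if b: "b \<in> I" for b
    proof -
      have "q (\<alpha> b) = g (y b)" using q(2) y[OF b] by metis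
      also have "\<dots> = (\<psi> b g \<odot> \<one>) \<odot>\<^bsub>S i\<^esub> w i"
        unfolding \<psi>_def by (rule kappa(2)[OF i corner_val(2)[OF gZ b] corner_val(1)[OF gZ b]])
      finally show ?thesis using g0[OF b] scalar_act_zero[OF Sm w] by simp
    qed
    have q\<alpha>: "q (\<alpha> x) = \<zero>\<^bsub>S i\<^esub>" if "x \<in> carrier (eJ i)" for x
      by (rule hom_vanishing_on_radical_basis[OF i I module_hom_comp[OF \<alpha>Jhom q(1)] q0 that])
    \<comment> \<open>The map \<open>r\<close> sends \<open>P0\<close> into \<open>Z0\<close>
      because \<open>\<alpha>\<close> and \<open>\<beta>\<close> are maps over \<open>S i\<close>.
      Then \<open>q \<circ> r\<close> extends \<open>q\<close> to \<open>P0\<close>: on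
      \<open>Z0\<close> the correction \<open>\<alpha> (\<beta> z)\<close> comes from
      \<open>eJ i\<close>, where \<open>q \<circ> \<alpha>\<close> vanishes.\<close>
    define r where "r z = z \<ominus>\<^bsub>P0\<^esub> \<alpha> (\<beta> z)" for z
    have \<alpha>\<beta>: "(\<lambda>z. \<alpha> (\<beta> z)) \<in> module_hom A P0 P0" by (rule module_hom_comp[OF \<beta> \<alpha>])
    note h\<alpha>\<beta> = module_homD[OF \<alpha>\<beta>]
    have ev: "free_eval A (S i) \<in> module_hom A P0 (S i)" unfolding P0_def by (rule free_eval_surj(1)[OF Sm])
    have rZ: "r z \<in> carrier Z0" if z: "z \<in> carrier P0" for z
    proof -
      have "free_eval A (S i) (r z) = free_eval A (S i) z \<ominus>\<^bsub>S i\<^esub> free_eval A (S i) (\<alpha> (\<beta> z))"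
        unfolding r_def by (rule module_hom_minus[OF rP(1) Sm ev z h\<alpha>\<beta>(1)[OF z]])
      also have "free_eval A (S i) (\<alpha> (\<beta> z)) = free_eval A (S i) z"
        using ev\<alpha>[OF module_homD(1)[OF \<beta> z]] ev\<beta>[OF z] by simp
      finally show ?thesis
        unfolding Z0c
        using z h\<alpha>\<beta>(1)[OF z] module_homD(1)[OF ev z] by (simp add: r_def a_minus_def[of "S i"] Si.M.r_neg)
    qed
    have rhom: "r \<in> module_hom A P0 Z0"
    proof (rule module_homI)
      fix z assume z: "z \<in> carrier P0"
      show "r z \<in> carrier Z0" by (rule rZ[OF z])
      show "r (z \<oplus>\<^bsub>P0\<^esub> z') = r z \<oplus>\<^bsub>Z0\<^esub> r z'" if z': "z' \<in> carrier P0" for z'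
        unfolding r_def Z0ops using h\<alpha>\<beta>(1,2) z z' by (simp add: a_minus_def P0.M.minus_add P0.M.a_ac)
      show "r (a \<odot>\<^bsub>P0\<^esub> z) = a \<odot>\<^bsub>Z0\<^esub> r z" if a: "a \<in> carrier A" for a
        unfolding r_def Z0ops using h\<alpha>\<beta>(1,3) z a by (simp add: P0.act_minus)
    qed
    define h where "h = (\<lambda>z\<in>carrier P0. q (r z))"
    have "h \<in> module_hom A P0 (S i)"
      unfolding h_def using module_homD[OF module_hom_comp[OF rhom q(1)]]
      by (intro module_homI) (auto simp: P0.act_closed)
    then have hH: "h \<in> carrier (hom_space A P0 (S i))" by (simp add: hom_space_def h_def)
    have hz: "h z = q z" if z: "z \<in> carrier Z0" for z
    proof -
      have zP: "z \<in> carrier P0" using z Z0c by blast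
      have az: "\<alpha> (\<beta> z) \<in> carrier Z0" by (rule \<alpha>J[OF \<beta>Z[OF z]])
      have rz: "r z \<oplus>\<^bsub>Z0\<^esub> \<alpha> (\<beta> z) = z"
        unfolding r_def Z0ops using zP h\<alpha>\<beta>(1)[OF zP] by (simp add: a_minus_def P0.M.a_assoc P0.M.l_neg)
      have "q (r z \<oplus>\<^bsub>Z0\<^esub> \<alpha> (\<beta> z)) = q (r z) \<oplus>\<^bsub>S i\<^esub> q (\<alpha> (\<beta> z))" by (rule module_homD(2)[OF q(1) rZ[OF zP] az])
      then have "q z = q (r z) \<oplus>\<^bsub>S i\<^esub> \<zero>\<^bsub>S i\<^esub>" unfolding rz q\<alpha>[OF \<beta>Z[OF z]] .
      then show ?thesis using zP module_homD(1)[OF q(1) rZ[OF zP]] by (simp add: h_def)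
    qed
    have "g = (\<lambda>y\<in>carrier P1. h (d1 y))"
    proof (rule extensionalityI[of _ "carrier P1"])
      show "g \<in> extensional (carrier P1)" using gZ Zc Hc by blast
      show "g y = (\<lambda>y\<in>carrier P1. h (d1 y)) y" if "y \<in> carrier P1" for y
        using that q(2) hz[OF module_homD(1)[OF d1(1) that]] by simp
    qed simp
    then show "g \<in> B" unfolding B_def using hH by blast
  qed
  have "Ext1 A (S i) (S i) = quot_module ?V B"
    unfolding Ext1_def Let_def Z_def B_def P0_def P1_def P2_def Z0_def[symmetric] Z1_def[symmetric] d1_def d2_def
    by (rule refl)
  then have "vectorspace.dim F (Ext1 A (S i) (S i)) = codim F ?V B" by (simp add: codim_def)
  also have "\<dots> = card I" unfolding BZ by (rule codim_dual_family[OF vV finI df])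
  finally show ?thesis .
qed

section \<open>Assembly of the three statements\<close>

lemma commutator_codimensions:
  "codim F A (KR F A 1) = \<ell> A \<and>
    codim F A (KR F A 2) = \<ell> A + (\<Sum>i<\<ell> A. vectorspace.dim F (Ext1 A (S i) (S i))) \<and>
    (\<ell> A + (\<Sum>i<\<ell> A. vectorspace.dim F (Ext1 A (S i) (S i))) \<le> codim F A (commutator_space F A) \<and>
     codim F A (commutator_space F A) \<le> mat_trace (cartan_matrix A S))"
proof -
  \<comment> \<open>The radical bases are chosen once, so that \<open>KR^2\<close> and
    \<open>Ext\<close> are counted by the same sets.\<close>
  have "\<forall>i. \<exists>I. \<exists>c. i < \<ell> A \<longrightarrow> radical_basis i I c" using radical_basis_exists by blast
  then obtain I c where I: "\<And>i. i < \<ell> A \<Longrightarrow> radical_basis i (I i) (c i)" by metis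
  have "codim F A (KR F A 2) = \<ell> A + (\<Sum>i<\<ell> A. card (I i))" by (rule codim_KR2[OF I])
  also have "(\<Sum>i<\<ell> A. card (I i)) = (\<Sum>i<\<ell> A. vectorspace.dim F (Ext1 A (S i) (S i)))"
    using dim_Ext1[OF _ I] by (intro sum.cong refl) simp
  finally show ?thesis using codim_KR1 codim_KR2_le codim_commutator_space_le_trace by simp
qed

end

theorem theorem1p4:
  fixes F :: "('f, 'k) ring_scheme"
    and A :: "('f, 'a) module"
    and S :: "nat \<Rightarrow> ('a, 'm) module"
  assumes "assoc_algebra F A"
    and "vectorspace.fin_dim F A"
    and simple: "\<And>i. i < \<ell> A \<Longrightarrow> simple_module A (S i)"
    and noniso: "\<And>i j. i < \<ell> A \<Longrightarrow> j < \<ell> A \<Longrightarrow> i \<noteq> j \<Longrightarrow> \<not> module_iso A (S i) (S j)"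
    and complete: "\<And>T :: ('a, 'a set) module. simple_module A T \<Longrightarrow> \<exists>i<\<ell> A. module_iso A T (S i)"
    and "splitting_field F A"
  shows "codim F A (KR F A 1) = \<ell> A \<and>
    codim F A (KR F A 2) = \<ell> A + (\<Sum>i<\<ell> A. vectorspace.dim F (Ext1 A (S i) (S i))) \<and>
    (\<ell> A + (\<Sum>i<\<ell> A. vectorspace.dim F (Ext1 A (S i) (S i))) \<le> codim F A (commutator_space F A) \<and>
     codim F A (commutator_space F A) \<le> mat_trace (cartan_matrix A S))"
proof -
  interpret split_algebra F A S
    by (intro split_algebra.intro split_algebra_axioms.intro assms)
  \<comment> \<open>The conditions on a pair are bundled so that all pairs can be chosen together as
    functions of \<open>i\<close>.\<close>
  define P where "P i e w \<longleftrightarrow> e \<in> carrier A \<and> e \<otimes>\<^bsub>A\<^esub> e = e \<and> w \<in> carrier (S i) \<and> w \<noteq> \<zero>\<^bsub>S i\<^esub> \<and> e \<odot>\<^bsub>S i\<^esub> w = w \<and>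
    (\<forall>U u s. right_ideal U \<longrightarrow> U \<subseteq> {x \<in> carrier A. e \<otimes>\<^bsub>A\<^esub> x = x} \<longrightarrow> e \<notin> U \<longrightarrow> u \<in> U \<longrightarrow> s \<in> carrier (S i) \<longrightarrow>
      u \<odot>\<^bsub>S i\<^esub> s = \<zero>\<^bsub>S i\<^esub>)" for i e w
  have "\<exists>e w. P i e w" if "i < \<ell> A" for i
    by (rule idempotent_exists[OF that]) (unfold P_def, blast)
  then obtain e w where ew: "\<And>i. i < \<ell> A \<Longrightarrow> P i (e i) (w i)" by metis
  interpret basic_idempotents F A S e w
    by unfold_locales (use ew in \<open>simp_all add: P_def\<close>)
  obtain n \<iota> u v where d: "\<And>k. k < (n::nat) \<Longrightarrow> \<iota> k < \<ell> A \<and> u k \<in> carrier A \<and> v k \<in> carrier A \<and>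
      u k \<otimes>\<^bsub>A\<^esub> e (\<iota> k) = u k \<and> e (\<iota> k) \<otimes>\<^bsub>A\<^esub> v k = v k" "\<one>\<^bsub>A\<^esub> = (\<Oplus>\<^bsub>A\<^esub>k\<in>{..<n}. u k \<otimes>\<^bsub>A\<^esub> v k)"
    using G_decomposition[OF one_in_G] by blast
  interpret decomposition F A S e w n \<iota> u v
    by unfold_locales (use d in simp_all)
  show ?thesis by (rule commutator_codimensions)
qed

end
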